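(* Let $G \curvearrowright X$ and $H \curvearrowright Y$ be topologically free partial systems. Then the following are equivalent: (i) $G \curvearrowright X$ and $H \curvearrowright Y$ are continuously orbit equivalent; (ii) the transformation groupoids $G \ltimes X$ and $H \ltimes Y$ are isomorphic as topological groupoids; (iii) there exists a $*$-isomorphism $\Phi : C_0(X) \rtimes_r G \to C_0(Y) \rtimes_r H$ with $\Phi(C_0(X)) = C_0(Y)$. Moreover, the implication (ii) $\Rightarrow$ (i) holds for arbitrary partial systems (i.e., without the assumption of topological freeness).
   Context: Groups are discrete and countable; topological spaces are locally compact, Hausdorff and second countable. A partial system $G \curvearrowright X$ consists of a group $G$ with identity $e$, a space $X$, open subsets $U_g \subseteq X$ ($g \in G$) and homeomorphisms $\alpha_g : U_{g^{-1}} \to U_g$, $x \mapsto g.x$, such that $U_e = X$, $\alpha_e = \mathrm{id}_X$, and for all $g_1,g_2 \in G$: $g_2.(U_{(g_1g_2)^{-1}} \cap U_{g_2^{-1}}) = U_{g_2} \cap U_{g_1^{-1}}$ and $(g_1g_2).x = g_1.(g_2.x)$ for all $x \in U_{(g_1g_2)^{-1}} \cap U_{g_2^{-1}}$. For $x \in X$ put $G_x = \{g \in G : x \in U_{g^{-1}}\}$. The partial system is topologically free if for every $e \neq g \in G$ the set $\{x \in U_{g^{-1}} : g.x \neq x\}$ is dense in $U_{g^{-1}}$. The transformation groupoid is $G \ltimes X = \{(g,x) \in G \times X : x \in U_{g^{-1}}\}$ with the subspace topology of $G \times X$, source $s(g,x)=x$, range $r(g,x) = g.x$, composition $(g_1,g_2.x)(g_2,x)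 = (g_1g_2,x)$ and inverse $(g,x)^{-1} = (g^{-1},g.x)$. Let $\alpha^*_g : C_0(U_{g^{-1}}) \to C_0(U_g)$, $f \mapsto f(g^{-1}.\,\cdot\,)$. The reduced partial crossed product $C_0(X) \rtimes_r G$ is the completion of the $*$-algebra of finite sums $\sum_g f_g \delta_g$ with $f_g \in C_0(U_g)$, with multiplication $(f\delta_g)(f'\delta_h) = \alpha^*_g(\alpha^*_{g^{-1}}(f)f')\delta_{gh}$ and involution $(f\delta_g)^* = \alpha^*_{g^{-1}}(\overline{f})\delta_{g^{-1}}$, in the norm $\sup_{x\in X}\|\rho_x(\cdot)\|$, where $\rho_x$ acts on $\ell^2(G_x)$ by $\rho_x(f\delta_g)\delta_h = f(gh.x)\delta_{gh}$ if $gh \in G_x$ and $0$ otherwise. $C_0(X)$ is viewed as a subalgebra via $f \mapsto f\delta_e$. Partial systems $G \curvearrowright X$ and $H \curvearrowright Y$ (with domains $V_h \subseteq Y$ for $h\in H$) are continuously orbit equivalent if there exist a homeomorphism $\varphi : X \to Y$ and continuous maps $a : \bigcup_{g \in G} \{g\} \times U_{g^{-1}} \to H$ and $b : \bigcup_{h \in H} \{h\} \times V_{h^{-1}} \to G$ such that $\varphi(g.x) = a(g,x).\varphi(x)$ and $\varphi^{-1}(h.y) = b(h,y).\varphi^{-1}(y)$ for all $(g,x)$, $(h,y)$ in the respective domains; implicitly $a(g,x) \in H_{\varphi(x)}$ and $b(h,y) \in G_{\varphi^{-1}(y)}$. *)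

theory Defs
  imports "HOL-Analysis.Analysis" "HOL-Algebra.Group"
begin

section \<open>Partial systems\<close>

text \<open>The homeomorphism \<open>ps_act P g\<close> goes from \<open>ps_dom P (inv g)\<close> to \<open>ps_dom P g\<close>, that is,
  \<open>ps_dom P g\<close> is the set $U_g$ and the range (not the source) of the action of \<open>g\<close>.\<close>

record ('g, 'x) partial_system_data =
  ps_group :: "'g monoid"
  ps_space :: "'x topology"
  ps_dom :: "'g \<Rightarrow> 'x set"
  ps_act :: "'g \<Rightarrow> 'x \<Rightarrow> 'x"

abbreviation ps_mult :: "('g, 'x) partial_system_data \<Rightarrow> 'g \<Rightarrow> 'g \<Rightarrow> 'g"
  where "ps_mult P g h \<equiv> g \<otimes>\<^bsub>ps_group P\<^esub> h"

abbreviation ps_one :: "('g, 'x) partial_system_data \<Rightarrow> 'g"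
  where "ps_one P \<equiv> \<one>\<^bsub>ps_group P\<^esub>"

abbreviation ps_inv :: "('g, 'x) partial_system_data \<Rightarrow> 'g \<Rightarrow> 'g"
  where "ps_inv P g \<equiv> inv\<^bsub>ps_group P\<^esub> g"

definition partial_system :: "('g, 'x) partial_system_data \<Rightarrow> bool" where
  "partial_system P \<longleftrightarrow>
     group (ps_group P) \<and> countable (carrier (ps_group P)) \<and>
     locally_compact_space (ps_space P) \<and> Hausdorff_space (ps_space P) \<and>
     second_countable (ps_space P) \<and>
     (\<forall>g\<in>carrier (ps_group P). openin (ps_space P) (ps_dom P g)) \<and>
     (\<forall>g\<in>carrier (ps_group P).
        homeomorphic_map (subtopology (ps_space P) (ps_dom P (ps_inv P g)))
                         (subtopology (ps_space P) (ps_dom P g)) (ps_act P g)) \<and>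
     ps_dom P (ps_one P) = topspace (ps_space P) \<and>
     (\<forall>x\<in>topspace (ps_space P). ps_act P (ps_one P) x = x) \<and>
     (\<forall>g1\<in>carrier (ps_group P). \<forall>g2\<in>carrier (ps_group P).
        ps_act P g2 ` (ps_dom P (ps_inv P (ps_mult P g1 g2)) \<inter> ps_dom P (ps_inv P g2)) =
          ps_dom P g2 \<inter> ps_dom P (ps_inv P g1) \<and>
        (\<forall>x\<in>ps_dom P (ps_inv P (ps_mult P g1 g2)) \<inter> ps_dom P (ps_inv P g2).
           ps_act P (ps_mult P g1 g2) x = ps_act P g1 (ps_act P g2 x)))"

definition ps_at :: "('g, 'x) partial_system_data \<Rightarrow> 'x \<Rightarrow> 'g set" where
  "ps_at P x = {g \<in> carrier (ps_group P). x \<in> ps_dom P (ps_inv P g)}"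

definition topologically_free :: "('g, 'x) partial_system_data \<Rightarrow> bool" where
  "topologically_free P \<longleftrightarrow>
     (\<forall>g\<in>carrier (ps_group P). g \<noteq> ps_one P \<longrightarrow>
        subtopology (ps_space P) (ps_dom P (ps_inv P g)) closure_of
          {x \<in> ps_dom P (ps_inv P g). ps_act P g x \<noteq> x} = ps_dom P (ps_inv P g))"


section \<open>Topological groupoids and the transformation groupoid\<close>

text \<open>\<open>gpd_comp \<gamma> \<eta>\<close> is meaningful when the source of \<open>\<gamma>\<close> is the range of \<open>\<eta>\<close>.\<close>

record ('a, 'o) topological_groupoid_data =
  gpd_arrows :: "'a topology"
  gpd_objects :: "'o topology"
  gpd_source :: "'a \<Rightarrow> 'o"
  gpd_range :: "'a \<Rightarrow> 'o"
  gpd_comp :: "'a \<Rightarrow> 'a \<Rightarrow> 'a"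
  gpd_inv :: "'a \<Rightarrow> 'a"

definition topological_groupoid_isomorphism ::
  "('a, 'o) topological_groupoid_data \<Rightarrow> ('b, 'p) topological_groupoid_data \<Rightarrow>
   ('a \<Rightarrow> 'b) \<Rightarrow> ('o \<Rightarrow> 'p) \<Rightarrow> bool" where
  "topological_groupoid_isomorphism A B \<Theta> \<theta> \<longleftrightarrow>
     homeomorphic_map (gpd_arrows A) (gpd_arrows B) \<Theta> \<and>
     homeomorphic_map (gpd_objects A) (gpd_objects B) \<theta> \<and>
     (\<forall>\<gamma>\<in>topspace (gpd_arrows A).
        gpd_source B (\<Theta> \<gamma>) = \<theta> (gpd_source A \<gamma>) \<and>
        gpd_range B (\<Theta> \<gamma>) = \<theta> (gpd_range A \<gamma>) \<and>
        \<Theta> (gpd_inv A \<gamma>) = gpd_inv B (\<Theta> \<gamma>)) \<and>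
     (\<forall>\<gamma>\<in>topspace (gpd_arrows A). \<forall>\<eta>\<in>topspace (gpd_arrows A).
        gpd_source A \<gamma> = gpd_range A \<eta> \<longrightarrow>
        \<Theta> (gpd_comp A \<gamma> \<eta>) = gpd_comp B (\<Theta> \<gamma>) (\<Theta> \<eta>))"

definition isomorphic_topological_groupoids ::
  "('a, 'o) topological_groupoid_data \<Rightarrow> ('b, 'p) topological_groupoid_data \<Rightarrow> bool" where
  "isomorphic_topological_groupoids A B \<longleftrightarrow>
     (\<exists>\<Theta> \<theta>. topological_groupoid_isomorphism A B \<Theta> \<theta>)"

definition transformation_space :: "('g, 'x) partial_system_data \<Rightarrow> ('g \<times> 'x) topology" where
  "transformation_space P =
     subtopology (prod_topology (discrete_topology (carrier (ps_group P))) (ps_space P))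
       {(g, x). g \<in> carrier (ps_group P) \<and> x \<in> ps_dom P (ps_inv P g)}"

definition transformation_groupoid ::
  "('g, 'x) partial_system_data \<Rightarrow> ('g \<times> 'x, 'x) topological_groupoid_data" where
  "transformation_groupoid P =
     \<lparr> gpd_arrows = transformation_space P,
       gpd_objects = ps_space P,
       gpd_source = (\<lambda>(g, x). x),
       gpd_range = (\<lambda>(g, x). ps_act P g x),
       gpd_comp = (\<lambda>(g1, y) (g2, x). (ps_mult P g1 g2, x)),
       gpd_inv = (\<lambda>(g, x). (ps_inv P g, ps_act P g x)) \<rparr>"


section \<open>Continuous orbit equivalence\<close>

text \<open>Here \<open>\<psi>\<close> is the inverse of \<open>\<phi>\<close>. The last two clauses contain the implicit requirements that
  \<open>a (g, x)\<close> can be applied to \<open>\<phi> x\<close> and \<open>b (h, y)\<close> to \<open>\<psi> y\<close>.\<close>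

definition continuously_orbit_equivalent ::
  "('g, 'x) partial_system_data \<Rightarrow> ('h, 'y) partial_system_data \<Rightarrow> bool" where
  "continuously_orbit_equivalent P Q \<longleftrightarrow>
     (\<exists>\<phi> \<psi> a b.
        homeomorphic_maps (ps_space P) (ps_space Q) \<phi> \<psi> \<and>
        continuous_map (transformation_space P) (discrete_topology (carrier (ps_group Q))) a \<and>
        continuous_map (transformation_space Q) (discrete_topology (carrier (ps_group P))) b \<and>
        (\<forall>(g, x)\<in>topspace (transformation_space P).
           a (g, x) \<in> ps_at Q (\<phi> x) \<and>
           \<phi> (ps_act P g x) = ps_act Q (a (g, x)) (\<phi> x)) \<and>
        (\<forall>(h, y)\<in>topspace (transformation_space Q).
           b (h, y) \<in> ps_at P (\<psi> y) \<and>
           \<psi> (ps_act Q h y) = ps_act P (b (h, y)) (\<psi> y)))"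


section \<open>Normed star-algebras and their completions\<close>

record 'a normed_star_algebra =
  sa_carrier :: "'a set"
  sa_add :: "'a \<Rightarrow> 'a \<Rightarrow> 'a"
  sa_scale :: "complex \<Rightarrow> 'a \<Rightarrow> 'a"
  sa_mult :: "'a \<Rightarrow> 'a \<Rightarrow> 'a"
  sa_star :: "'a \<Rightarrow> 'a"
  sa_norm :: "'a \<Rightarrow> real"

definition star_isomorphism ::
  "'a normed_star_algebra \<Rightarrow> 'b normed_star_algebra \<Rightarrow> ('a \<Rightarrow> 'b) \<Rightarrow> bool" where
  "star_isomorphism A B \<Phi> \<longleftrightarrow>
     bij_betw \<Phi> (sa_carrier A) (sa_carrier B) \<and>
     (\<forall>a\<in>sa_carrier A. \<forall>b\<in>sa_carrier A.
        \<Phi> (sa_add A a b) = sa_add B (\<Phi> a) (\<Phi> b) \<and>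
        \<Phi> (sa_mult A a b) = sa_mult B (\<Phi> a) (\<Phi> b)) \<and>
     (\<forall>c. \<forall>a\<in>sa_carrier A. \<Phi> (sa_scale A c a) = sa_scale B c (\<Phi> a)) \<and>
     (\<forall>a\<in>sa_carrier A. \<Phi> (sa_star A a) = sa_star B (\<Phi> a))"

definition sa_dist :: "'a normed_star_algebra \<Rightarrow> 'a \<Rightarrow> 'a \<Rightarrow> real" where
  "sa_dist A a b = sa_norm A (sa_add A a (sa_scale A (- 1) b))"

definition sa_cauchy :: "'a normed_star_algebra \<Rightarrow> (nat \<Rightarrow> 'a) set" where
  "sa_cauchy A = {s. (\<forall>n. s n \<in> sa_carrier A) \<and>
     (\<forall>\<epsilon>>0. \<exists>N. \<forall>m\<ge>N. \<forall>n\<ge>N. sa_dist A (s m) (s n) < \<epsilon>)}"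

definition sa_equiv :: "'a normed_star_algebra \<Rightarrow> ((nat \<Rightarrow> 'a) \<times> (nat \<Rightarrow> 'a)) set" where
  "sa_equiv A = {(s, t). s \<in> sa_cauchy A \<and> t \<in> sa_cauchy A \<and>
     (\<lambda>n. sa_dist A (s n) (t n)) \<longlonglongrightarrow> 0}"

definition sa_class :: "'a normed_star_algebra \<Rightarrow> (nat \<Rightarrow> 'a) \<Rightarrow> (nat \<Rightarrow> 'a) set" where
  "sa_class A s = sa_equiv A `` {s}"

text \<open>The completion consists of the classes of Cauchy sequences modulo null sequences. When the norm
  is submultiplicative and the involution isometric, all representatives in the unions below yield
  one and the same class.\<close>

definition sa_completion :: "'a normed_star_algebra \<Rightarrow> (nat \<Rightarrow> 'a) set normed_star_algebra" where
  "sa_completion A =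
     \<lparr> sa_carrier = sa_cauchy A // sa_equiv A,
       sa_add = (\<lambda>S T. \<Union>s\<in>S. \<Union>t\<in>T. sa_class A (\<lambda>n. sa_add A (s n) (t n))),
       sa_scale = (\<lambda>c S. \<Union>s\<in>S. sa_class A (\<lambda>n. sa_scale A c (s n))),
       sa_mult = (\<lambda>S T. \<Union>s\<in>S. \<Union>t\<in>T. sa_class A (\<lambda>n. sa_mult A (s n) (t n))),
       sa_star = (\<lambda>S. \<Union>s\<in>S. sa_class A (\<lambda>n. sa_star A (s n))),
       sa_norm = (\<lambda>S. THE r. \<forall>s\<in>S. (\<lambda>n. sa_norm A (s n)) \<longlonglongrightarrow> r) \<rparr>"

definition sa_embed :: "'a normed_star_algebra \<Rightarrow> 'a \<Rightarrow> (nat \<Rightarrow> 'a) set" where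
  "sa_embed A a = sa_class A (\<lambda>n. a)"


section \<open>The Hilbert spaces $\ell^2(S)$\<close>

text \<open>Vectors are functions on the whole type that are zero off \<open>S\<close>.\<close>

definition ell2 :: "'g set \<Rightarrow> ('g \<Rightarrow> complex) set" where
  "ell2 S = {\<xi>. (\<forall>h. h \<notin> S \<longrightarrow> \<xi> h = 0) \<and> (\<lambda>h. (cmod (\<xi> h))\<^sup>2) summable_on S}"

definition ell2_norm :: "'g set \<Rightarrow> ('g \<Rightarrow> complex) \<Rightarrow> real" where
  "ell2_norm S \<xi> = sqrt (infsum (\<lambda>h. (cmod (\<xi> h))\<^sup>2) S)"

definition ell2_opnorm :: "'g set \<Rightarrow> (('g \<Rightarrow> complex) \<Rightarrow> ('g \<Rightarrow> complex)) \<Rightarrow> real" where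
  "ell2_opnorm S T = Sup {ell2_norm S (T \<xi>) |\<xi>. \<xi> \<in> ell2 S \<and> ell2_norm S \<xi> \<le> 1}"


section \<open>The reduced partial crossed product\<close>

text \<open>Elements of $C_0(X)$ are extended by zero off \<open>topspace X\<close>. For an open subset $U$ of $X$, the
  algebra $C_0(U)$, viewed as an ideal of $C_0(X)$, is then \<open>C0 (subtopology X U)\<close>.\<close>

definition C0 :: "'x topology \<Rightarrow> ('x \<Rightarrow> complex) set" where
  "C0 X = {f. continuous_map X euclidean f \<and> (\<forall>x. x \<notin> topspace X \<longrightarrow> f x = 0) \<and>
     (\<forall>\<epsilon>>0. \<exists>K. compactin X K \<and> (\<forall>x\<in>topspace X - K. cmod (f x) < \<epsilon>))}"

definition ps_pull :: "('g, 'x) partial_system_data \<Rightarrow> 'g \<Rightarrow> ('x \<Rightarrow> complex) \<Rightarrow> 'x \<Rightarrow> complex" where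
  "ps_pull P g f x = (if x \<in> ps_dom P g then f (ps_act P (ps_inv P g) x) else 0)"

text \<open>A finite formal sum of terms $f_g \delta_g$ is the function \<open>g \<mapsto> f\<^sub>g\<close>, and the single term
  $f \delta_g$ is \<open>cp_delta f g\<close>.\<close>

definition cp_delta :: "('x \<Rightarrow> complex) \<Rightarrow> 'g \<Rightarrow> 'g \<Rightarrow> 'x \<Rightarrow> complex" where
  "cp_delta f g k = (if k = g then f else (\<lambda>x. 0))"

definition cp_supp :: "('g \<Rightarrow> 'x \<Rightarrow> complex) \<Rightarrow> 'g set" where
  "cp_supp a = {g. a g \<noteq> (\<lambda>x. 0)}"

definition cp_carrier :: "('g, 'x) partial_system_data \<Rightarrow> ('g \<Rightarrow> 'x \<Rightarrow> complex) set" where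
  "cp_carrier P = {a. finite (cp_supp a) \<and> cp_supp a \<subseteq> carrier (ps_group P) \<and>
     (\<forall>g\<in>carrier (ps_group P). a g \<in> C0 (subtopology (ps_space P) (ps_dom P g)))}"

text \<open>Product and involution extend
  $(f\delta_g)(f'\delta_h) = \alpha^*_g(\alpha^*_{g^{-1}}(f)f')\delta_{gh}$ and
  $(f\delta_g)^* = \alpha^*_{g^{-1}}(\overline{f})\delta_{g^{-1}}$ to finite sums.\<close>

definition cp_mult :: "('g, 'x) partial_system_data \<Rightarrow>
    ('g \<Rightarrow> 'x \<Rightarrow> complex) \<Rightarrow> ('g \<Rightarrow> 'x \<Rightarrow> complex) \<Rightarrow> 'g \<Rightarrow> 'x \<Rightarrow> complex" where
  "cp_mult P a b k x = (\<Sum>g\<in>cp_supp a. \<Sum>h\<in>cp_supp b.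
     cp_delta (ps_pull P g (\<lambda>y. ps_pull P (ps_inv P g) (a g) y * b h y)) (ps_mult P g h) k x)"

definition cp_star :: "('g, 'x) partial_system_data \<Rightarrow>
    ('g \<Rightarrow> 'x \<Rightarrow> complex) \<Rightarrow> 'g \<Rightarrow> 'x \<Rightarrow> complex" where
  "cp_star P a k x = (\<Sum>g\<in>cp_supp a.
     cp_delta (ps_pull P (ps_inv P g) (\<lambda>y. cnj (a g y))) (ps_inv P g) k x)"

text \<open>\<open>cp_rho_basis P x f g h\<close> is $\rho_x(f\delta_g)\delta_h$. In \<open>cp_rho\<close> the operator is extended
  linearly to finite sums in the algebra and, coordinatewise, to all of $\ell^2(G_x)$: at each
  coordinate \<open>k\<close>, at most one \<open>h\<close> contributes to the infinite sum.\<close>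

definition cp_rho_basis :: "('g, 'x) partial_system_data \<Rightarrow> 'x \<Rightarrow>
    ('x \<Rightarrow> complex) \<Rightarrow> 'g \<Rightarrow> 'g \<Rightarrow> 'g \<Rightarrow> complex" where
  "cp_rho_basis P x f g h k =
     (if ps_mult P g h \<in> ps_at P x
      then f (ps_act P (ps_mult P g h) x) * (if k = ps_mult P g h then 1 else 0)
      else 0)"

definition cp_rho :: "('g, 'x) partial_system_data \<Rightarrow> 'x \<Rightarrow>
    ('g \<Rightarrow> 'x \<Rightarrow> complex) \<Rightarrow> ('g \<Rightarrow> complex) \<Rightarrow> 'g \<Rightarrow> complex" where
  "cp_rho P x a \<xi> k =
     (\<Sum>g\<in>cp_supp a. infsum (\<lambda>h. \<xi> h * cp_rho_basis P x (a g) g h k) (ps_at P x))"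

text \<open>Inserting 0 makes the supremum equal to 0 when the space is empty.\<close>

definition cp_norm :: "('g, 'x) partial_system_data \<Rightarrow> ('g \<Rightarrow> 'x \<Rightarrow> complex) \<Rightarrow> real" where
  "cp_norm P a =
     Sup (insert 0 ((\<lambda>x. ell2_opnorm (ps_at P x) (cp_rho P x a)) ` topspace (ps_space P)))"

definition algebraic_crossed_product ::
  "('g, 'x) partial_system_data \<Rightarrow> ('g \<Rightarrow> 'x \<Rightarrow> complex) normed_star_algebra" where
  "algebraic_crossed_product P =
     \<lparr> sa_carrier = cp_carrier P,
       sa_add = (\<lambda>a b g x. a g x + b g x),
       sa_scale = (\<lambda>c a g x. c * a g x),
       sa_mult = cp_mult P,
       sa_star = cp_star P,
       sa_norm = cp_norm P \<rparr>"

definition reduced_crossed_product ::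
  "('g, 'x) partial_system_data \<Rightarrow> (nat \<Rightarrow> 'g \<Rightarrow> 'x \<Rightarrow> complex) set normed_star_algebra" where
  "reduced_crossed_product P = sa_completion (algebraic_crossed_product P)"

definition C0_subalgebra ::
  "('g, 'x) partial_system_data \<Rightarrow> (nat \<Rightarrow> 'g \<Rightarrow> 'x \<Rightarrow> complex) set set" where
  "C0_subalgebra P =
     (\<lambda>f. sa_embed (algebraic_crossed_product P) (cp_delta f (ps_one P))) ` C0 (ps_space P)"

end

theory Submission
  imports Defs
begin

text \<open>
  A topological groupoid isomorphism is the same as a homeomorphism \<open>\<phi>\<close> together with mutually inverse
  continuous cocycles \<open>a\<close>, \<open>b\<close>, the isomorphism being \<open>(g, x) \<mapsto> (a (g, x), \<phi> x)\<close>. For topologically free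
  systems a group element is determined by its germ at any point; as \<open>a\<close> is locally constant, both the
  cocycle identity and the invertibility are forced, so an orbit equivalence is such a pair of cocycles.

  A cocycle pair matches the matrices of $\rho_x(c)$ and $\rho_{\phi(x)}(c \circ \Theta^{-1})$, hence it induces an
  isometric star-isomorphism between dense subalgebras, which extends to the completions.

  Conversely, let \<open>\<Phi>\<close> be an isomorphism preserving the diagonal. Gelfand duality gives \<open>\<phi>\<close>. For a bump
  function \<open>f\<close> near \<open>g.x\<close> the element \<open>N = f \<delta>\<^sub>g\<close> intertwines $k$ and $k(g^{-1}.\,\cdot\,)$, and so does \<open>\<Phi> N\<close>: whenever
  the $h$-th coefficient of \<open>\<Phi> N\<close> is nonzero at \<open>h.y\<close>, $h.y = \phi(g.\phi^{-1}(y))$. Since \<open>\<Phi> (N\<^sup>* N)\<close> does not vanish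
  at \<open>\<phi> x\<close>, some coefficient is nonzero there, hence nonzero nearby, and \<open>h\<close> is the value of the cocycle.
\<close>

section \<open>Functions vanishing at infinity\<close>

text \<open>The operator norms are handled through finite submatrices, with rows and columns indexed
  by the arrows of source x. A cocycle pair only renames these indices, so it preserves norms. The
  obstacle in transferring finite sums is that a cocycle can take infinitely many values on a
  noncompact domain, so the image of a single term need not be a finite sum. On a compact set a
  locally constant map takes finitely many values; hence the passage through compactly supported
  coefficients. In the converse direction the images under \<open>\<Phi>\<close> are only limits of
  finite sums. The norm dominates every coefficient uniformly, so limits have coefficients, and a
  nonzero value of one of them spreads to a neighbourhood. The norm also dominates the l2 norm of
  every column. This stronger bound shows that some coefficient is nonzero at the given point:
  uniform bounds alone would allow the mass to escape through infinitely many coefficients.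
  Topological freeness then makes the locally found group elements unique, so that they fit together
  to a continuous map.\<close>

lemma continuous_map_compose_continuous_on:
  assumes "continuous_map X euclidean f" and "continuous_on UNIV g"
  shows "continuous_map X euclidean (\<lambda>x. g (f x))"
  using continuous_map_compose[OF assms(1), of euclidean g] assms(2) by (simp add: o_def)

lemma continuous_map_complex_mult:
  fixes f g :: "'a \<Rightarrow> complex"
  assumes "continuous_map X euclidean f" "continuous_map X euclidean g"
  shows "continuous_map X euclidean (\<lambda>x. f x * g x)"
proof -
  have "continuous_map X euclidean (\<lambda>x. (f x, g x))"
    unfolding prod_topology_euclidean[symmetric] continuous_map_paired using assms by blast
  moreover have "continuous_on UNIV (\<lambda>p::complex \<times> complex. fst p * snd p)"
    by (intro continuous_intros)
  ultimately show ?thesis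
    using continuous_map_compose_continuous_on[of X "\<lambda>x. (f x, g x)" "\<lambda>p. fst p * snd p"] by simp
qed

text \<open>Expresses the ideal of an open set through superlevel sets in the whole space. These are
  compact, hence closed because the space is Hausdorff, and this makes the extension by zero
  continuous across the boundary of \<open>U\<close>.\<close>

lemma C0_iff:
  assumes H: "Hausdorff_space X" and U: "openin X U"
  shows "f \<in> C0 (subtopology X U) \<longleftrightarrow>
    continuous_map X euclidean f \<and> (\<forall>x. x \<notin> U \<longrightarrow> f x = 0) \<and>
    (\<forall>\<epsilon>>0. compactin X {x \<in> topspace X. \<epsilon> \<le> cmod (f x)})"
proof
  have UX: "U \<subseteq> topspace X" using U openin_subset by blast
  assume f: "f \<in> C0 (subtopology X U)"
  have cont: "continuous_map (subtopology X U) euclidean f" and zero: "\<And>x. x \<notin> U \<Longrightarrow> f x = 0"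
    using f UX by (auto simp: C0_def)
  have comp: "compactin X {x \<in> topspace X. \<epsilon> \<le> cmod (f x)}" if \<epsilon>: "\<epsilon> > 0" for \<epsilon>
  proof -
    obtain K where K: "compactin (subtopology X U) K" "\<And>x. x \<in> U - K \<Longrightarrow> cmod (f x) < \<epsilon>"
      using f \<epsilon> UX unfolding C0_def by (auto simp: topspace_subtopology Int_absorb1)
    have eq: "{x \<in> topspace X. \<epsilon> \<le> cmod (f x)} = {x \<in> topspace (subtopology X U). f x \<in> {z. \<epsilon> \<le> cmod z}}"
      using zero \<epsilon> UX by fastforce
    have "closedin (subtopology X U) {x \<in> topspace (subtopology X U). f x \<in> {z. \<epsilon> \<le> cmod z}}"
      by (rule closedin_continuous_map_preimage[OF cont])
         (auto intro!: closed_Collect_le continuous_intros)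
    moreover have "{x \<in> topspace (subtopology X U). f x \<in> {z. \<epsilon> \<le> cmod z}} \<subseteq> K"
      using K(2) by (force simp: not_le)
    ultimately have "compactin (subtopology X U) {x \<in> topspace X. \<epsilon> \<le> cmod (f x)}"
      unfolding eq using K(1) closed_compactin by blast
    then show ?thesis by (simp add: compactin_subtopology)
  qed
  have "openin X {x \<in> topspace X. f x \<in> V}" if V: "open V" for V
  proof -
    have "openin (subtopology X U) {x \<in> topspace (subtopology X U). f x \<in> V}"
      using openin_continuous_map_preimage[OF cont] V by simp
    moreover have "{x \<in> topspace (subtopology X U). f x \<in> V} = {x \<in> U. f x \<in> V}"
      using UX by auto
    ultimately have 1: "openin X {x \<in> U. f x \<in> V}"
      using U openin_trans_full by auto
    show ?thesis
    \<comment> \<open>The preimage reaches outside \<open>U\<close> only if 0 lies in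
      \<open>V\<close>; then the complement of a superlevel set is an open part of it that covers
      all zeros of \<open>f\<close>.\<close>
    proof (cases "0 \<in> V")
      case True
      then obtain \<epsilon> where \<epsilon>: "\<epsilon> > 0" "ball 0 \<epsilon> \<subseteq> V" using V openE by blast
      have "openin X (topspace X - {x \<in> topspace X. \<epsilon> \<le> cmod (f x)})"
        using comp[OF \<epsilon>(1)] H compactin_imp_closedin by blast
      moreover have "{x \<in> topspace X. f x \<in> V} =
          {x \<in> U. f x \<in> V} \<union> (topspace X - {x \<in> topspace X. \<epsilon> \<le> cmod (f x)})"
      proof (rule Set.set_eqI)
        fix x
        show "x \<in> {x \<in> topspace X. f x \<in> V} \<longleftrightarrow> x \<in> {x \<in> U. f x \<in> V} \<union>
            (topspace X - {x \<in> topspace X. \<epsilon> \<le> cmod (f x)})"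
          using UX \<epsilon> zero[of x] by (cases "x \<in> U"; cases "\<epsilon> \<le> cmod (f x)") (auto simp: subset_iff True)
      qed
      ultimately show ?thesis using openin_Un[OF 1] by simp
    next
      case False
      then have "{x \<in> topspace X. f x \<in> V} = {x \<in> U. f x \<in> V}" using zero UX by force
      then show ?thesis using 1 by simp
    qed
  qed
  then show "continuous_map X euclidean f \<and> (\<forall>x. x \<notin> U \<longrightarrow> f x = 0) \<and>
    (\<forall>\<epsilon>>0. compactin X {x \<in> topspace X. \<epsilon> \<le> cmod (f x)})"
    using zero comp by (auto simp: continuous_map)
next
  have UX: "U \<subseteq> topspace X" using U openin_subset by blast
  assume A: "continuous_map X euclidean f \<and> (\<forall>x. x \<notin> U \<longrightarrow> f x = 0) \<and>
    (\<forall>\<epsilon>>0. compactin X {x \<in> topspace X. \<epsilon> \<le> cmod (f x)})"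
  have "\<exists>K. compactin (subtopology X U) K \<and> (\<forall>x\<in>topspace (subtopology X U) - K. cmod (f x) < \<epsilon>)"
    if "\<epsilon> > 0" for \<epsilon>
  proof (intro exI conjI)
    show "compactin (subtopology X U) {x \<in> topspace X. \<epsilon> \<le> cmod (f x)}"
      using A that by (force simp: compactin_subtopology)
  qed (use UX in auto)
  moreover have "f x = 0" if "x \<notin> topspace (subtopology X U)" for x
    using A UX that by auto
  ultimately show "f \<in> C0 (subtopology X U)"
    using A unfolding C0_def by (simp add: continuous_map_from_subtopology)
qed

lemma closedin_norm_ge:
  fixes f :: "'a \<Rightarrow> complex"
  assumes "continuous_map X euclidean f"
  shows "closedin X {x \<in> topspace X. \<epsilon> \<le> cmod (f x)}"
proof -
  have "closedin X {x \<in> topspace X. f x \<in> {z. \<epsilon> \<le> cmod z}}"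
    by (rule closedin_continuous_map_preimage[OF assms])
       (auto intro!: closed_Collect_le continuous_intros)
  then show ?thesis by simp
qed

lemma C0_bounded:
  assumes "f \<in> C0 X"
  obtains B where "B > 0" "\<And>x. cmod (f x) \<le> B"
proof -
  obtain K where K: "compactin X K" "\<And>x. x \<in> topspace X - K \<Longrightarrow> cmod (f x) < 1"
    using assms unfolding C0_def by (auto dest!: spec[of _ 1])
  have "compact (f ` K)"
    using image_compactin[OF K(1), of euclidean f] assms by (simp add: C0_def)
  then obtain C where C: "\<And>x. x \<in> K \<Longrightarrow> cmod (f x) \<le> C"
    using compact_imp_bounded bounded_iff by (metis image_eqI)
  have "cmod (f x) \<le> max 1 C" for x
  proof (cases "x \<in> topspace X")
    case True
    then show ?thesis using K(2)[of x] C[of x] by (cases "x \<in> K") auto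
  next
    case False
    then show ?thesis using assms by (auto simp: C0_def)
  qed
  then show thesis using that[of "max 1 C"] by auto
qed

lemma C0_mono:
  assumes "Hausdorff_space X" "openin X U" "openin X V" "U \<subseteq> V" "f \<in> C0 (subtopology X U)"
  shows "f \<in> C0 (subtopology X V)"
  using assms by (auto simp: C0_iff)

lemma C0_mono_space:
  assumes "Hausdorff_space X" "openin X U" "f \<in> C0 (subtopology X U)"
  shows "f \<in> C0 X"
  using C0_mono[OF assms(1,2) openin_topspace openin_subset] assms by (simp add: subtopology_topspace)

text \<open>Near 0 the values of \<open>g\<close> are small, so a superlevel set of the composition
  lies in one of \<open>f\<close>. The domain \<open>S\<close> leaves room for functions with a
  pole, such as z / (1 - z) off the point 1.\<close>

lemma C0_continuous_compose:
  fixes g :: "complex \<Rightarrow> complex"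
  assumes H: "Hausdorff_space X" and U: "openin X U" and f: "f \<in> C0 (subtopology X U)"
    and S: "open S" "range f \<subseteq> S" and g: "continuous_on S g" "g 0 = 0" and 0: "0 \<in> S"
  shows "(\<lambda>x. g (f x)) \<in> C0 (subtopology X U)"
proof -
  have cont: "continuous_map X euclidean f" and zero: "\<And>x. x \<notin> U \<Longrightarrow> f x = 0"
    and comp: "\<And>\<epsilon>. \<epsilon> > 0 \<Longrightarrow> compactin X {x \<in> topspace X. \<epsilon> \<le> cmod (f x)}"
    using f by (auto simp: C0_iff[OF H U])
  have "continuous_map X (top_of_set S) f"
    using cont S by (auto simp: continuous_map_in_subtopology)
  then have gf: "continuous_map X euclidean (\<lambda>x. g (f x))"
    using continuous_map_compose[of X "top_of_set S" f euclidean g] g by (simp add: o_def)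
  have "compactin X {x \<in> topspace X. \<epsilon> \<le> cmod (g (f x))}" if \<epsilon>: "\<epsilon> > 0" for \<epsilon>
  proof -
    obtain \<delta> where \<delta>: "\<delta> > 0" "\<And>z. z \<in> S \<Longrightarrow> dist z 0 < \<delta> \<Longrightarrow> dist (g z) (g 0) < \<epsilon>"
      using g(1)[unfolded continuous_on_iff, rule_format, OF 0 \<epsilon>] by blast
    have "{x \<in> topspace X. \<epsilon> \<le> cmod (g (f x))} \<subseteq> {x \<in> topspace X. \<delta> \<le> cmod (f x)}"
    proof clarify
      fix x assume "x \<in> topspace X" "\<epsilon> \<le> cmod (g (f x))"
      then show "\<delta> \<le> cmod (f x)" using \<delta>(2)[of "f x"] S(2) g(2) by (auto simp: not_le[symmetric])
    qed
    then show ?thesis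
      using comp[OF \<delta>(1)] closedin_norm_ge[OF gf] closed_compactin by blast
  qed
  then show ?thesis using gf zero g(2) by (simp add: C0_iff[OF H U])
qed

lemma C0_zero: "(\<lambda>x. 0) \<in> C0 X"
  by (auto simp: C0_def intro!: exI[of _ "{}"])

lemma C0_add:
  assumes H: "Hausdorff_space X" and U: "openin X U"
    and f: "f \<in> C0 (subtopology X U)" and g: "g \<in> C0 (subtopology X U)"
  shows "(\<lambda>x. f x + g x) \<in> C0 (subtopology X U)"
proof -
  note fi = f[unfolded C0_iff[OF H U]] and gi = g[unfolded C0_iff[OF H U]]
  have cont: "continuous_map X euclidean (\<lambda>x. f x + g x)"
    using fi gi by (intro continuous_intros) auto
  have "compactin X {x \<in> topspace X. \<epsilon> \<le> cmod (f x + g x)}" if "\<epsilon> > 0" for \<epsilon>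
  proof -
    have "{x \<in> topspace X. \<epsilon> \<le> cmod (f x + g x)} \<subseteq>
        {x \<in> topspace X. \<epsilon>/2 \<le> cmod (f x)} \<union> {x \<in> topspace X. \<epsilon>/2 \<le> cmod (g x)}"
    proof clarify
      fix x assume "\<epsilon> \<le> cmod (f x + g x)" "x \<in> topspace X" "\<not> \<epsilon>/2 \<le> cmod (g x)"
      then show "\<epsilon>/2 \<le> cmod (f x)" using norm_triangle_ineq[of "f x" "g x"] by linarith
    qed
    moreover have "compactin X ({x \<in> topspace X. \<epsilon>/2 \<le> cmod (f x)} \<union> {x \<in> topspace X. \<epsilon>/2 \<le> cmod (g x)})"
      using fi gi half_gt_zero[OF that] by (intro compactin_Un) blast+
    ultimately show ?thesis using closedin_norm_ge[OF cont] closed_compactin by blast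
  qed
  then show ?thesis using fi gi cont by (simp add: C0_iff[OF H U])
qed

text \<open>A bound on \<open>f\<close> turns superlevel sets of the product into superlevel sets of
  \<open>g\<close>. The intersection is recorded because the product of two terms of the crossed
  product lives on such a set.\<close>

lemma C0_mult:
  assumes H: "Hausdorff_space X" and U: "openin X U" "openin X V"
    and f: "f \<in> C0 (subtopology X U)" and g: "g \<in> C0 (subtopology X V)"
  shows "(\<lambda>x. f x * g x) \<in> C0 (subtopology X (U \<inter> V))"
proof -
  note fi = f[unfolded C0_iff[OF H U(1)]] and gi = g[unfolded C0_iff[OF H U(2)]]
  have cont: "continuous_map X euclidean (\<lambda>x. f x * g x)"
    using fi gi continuous_map_complex_mult by blast
  obtain B where B: "B > 0" "\<And>x. cmod (f x) \<le> B" using C0_bounded[OF f] by blast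
  have "compactin X {x \<in> topspace X. \<epsilon> \<le> cmod (f x * g x)}" if "\<epsilon> > 0" for \<epsilon>
  proof -
    have "{x \<in> topspace X. \<epsilon> \<le> cmod (f x * g x)} \<subseteq> {x \<in> topspace X. \<epsilon>/B \<le> cmod (g x)}"
    proof clarify
      fix x assume "\<epsilon> \<le> cmod (f x * g x)"
      also have "\<dots> \<le> B * cmod (g x)" using B by (simp add: norm_mult mult_right_mono)
      finally show "\<epsilon>/B \<le> cmod (g x)" using B by (simp add: field_simps)
    qed
    moreover have "compactin X {x \<in> topspace X. \<epsilon>/B \<le> cmod (g x)}"
      using gi that B by auto
    ultimately show ?thesis using closedin_norm_ge[OF cont] closed_compactin by blast
  qed
  then show ?thesis using fi gi cont U by (auto simp: C0_iff[OF H openin_Int])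
qed

lemma C0_compose_homeomorphic_map:
  assumes h: "homeomorphic_map X Y h" and f: "f \<in> C0 Y"
  shows "(\<lambda>x. if x \<in> topspace X then f (h x) else 0) \<in> C0 X"
proof -
  have "continuous_map X euclidean (f \<circ> h)"
    by (rule continuous_map_compose[OF homeomorphic_imp_continuous_map[OF h]])
       (use f in \<open>simp add: C0_def\<close>)
  then have 1: "continuous_map X euclidean (\<lambda>x. if x \<in> topspace X then f (h x) else 0)"
    by (rule continuous_map_eq) auto
  have "\<exists>K. compactin X K \<and> (\<forall>x\<in>topspace X - K. cmod (f (h x)) < \<epsilon>)" if \<epsilon>: "\<epsilon> > 0" for \<epsilon>
  proof -
    obtain K where K: "compactin Y K" "\<And>x. x \<in> topspace Y - K \<Longrightarrow> cmod (f x) < \<epsilon>"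
      using f \<epsilon> unfolding C0_def by auto
    obtain h' where h': "homeomorphic_maps X Y h h'" using h homeomorphic_map_maps by blast
    have "compactin X (h' ` K)"
      using K(1) h' image_compactin unfolding homeomorphic_maps_def by blast
    moreover have "cmod (f (h x)) < \<epsilon>" if "x \<in> topspace X - h' ` K" for x
    proof -
      have "h x \<in> topspace Y" "h' (h x) = x"
        using that h' by (auto simp: homeomorphic_maps_def continuous_map_def)
      then show ?thesis using K(2)[of "h x"] that by (metis Diff_iff image_eqI)
    qed
    ultimately show ?thesis by blast
  qed
  then show ?thesis using 1 by (auto simp: C0_def)
qed

section \<open>Bump functions\<close>

text \<open>Complete regularity gives a continuous function that is 0 at \<open>x\<close> and 1 off
  \<open>V\<close>; the compact set \<open>K\<close> between \<open>V\<close> and \<open>U\<close>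
  makes its difference from 1 vanish at infinity.\<close>

lemma C0_bump:
  assumes L: "locally_compact_space X" and H: "Hausdorff_space X" and U: "openin X U" and x: "x \<in> U"
  obtains f where "f \<in> C0 (subtopology X U)" "f x = 1"
proof -
  obtain V K where VK: "openin X V" "compactin X K" "x \<in> V" "V \<subseteq> K" "K \<subseteq> U"
    using L H U x locally_compact_space_neighbourhood_base[of X] unfolding neighbourhood_base_of by metis
  have "completely_regular_space X"
    using L H locally_compact_regular_imp_completely_regular_space
      locally_compact_Hausdorff_imp_regular_space by blast
  then obtain r :: "'a \<Rightarrow> real" where r: "continuous_map X euclideanreal r" "r x = 0"
      "r ` (topspace X - V) \<subseteq> {1}"
    using VK(1,3) unfolding completely_regular_space_alt' by blast
  have xX: "x \<in> topspace X" using U x openin_subset by blast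
  define f where "f = (\<lambda>x. if x \<in> topspace X then complex_of_real (1 - r x) else 0)"
  have "continuous_map X euclidean (\<lambda>x. complex_of_real (1 - r x))"
    by (rule continuous_map_compose_continuous_on[OF r(1)]) (intro continuous_intros)
  then have cont: "continuous_map X euclidean f"
    by (rule continuous_map_eq) (auto simp: f_def)
  have z: "f y = 0" if "y \<notin> V" for y
    using that r(3) by (auto simp: f_def)
  have "compactin X {y \<in> topspace X. \<epsilon> \<le> cmod (f y)}" if "\<epsilon> > 0" for \<epsilon>
  proof -
    have "{y \<in> topspace X. \<epsilon> \<le> cmod (f y)} \<subseteq> K"
      using z VK(4) that by force
    then show ?thesis using VK(2) closedin_norm_ge[OF cont] closed_compactin by blast
  qed
  then have "f \<in> C0 (subtopology X U)"
    using cont z VK(4,5) by (auto simp: C0_iff[OF H U])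
  moreover have "f x = 1" using r(2) xX by (simp add: f_def)
  ultimately show thesis using that by blast
qed

text \<open>The point \<open>z\<close> is removed from \<open>U\<close>. It may lie outside the
  space, where functions are zero by convention, which accounts for the case distinction.\<close>

lemma C0_bump_separating:
  assumes L: "locally_compact_space X" and H: "Hausdorff_space X" and U: "openin X U"
    and x: "x \<in> U" "x \<noteq> z"
  obtains f where "f \<in> C0 (subtopology X U)" "f x = 1" "f z = 0"
proof -
  have O: "openin X (U - {z})"
  proof (cases "z \<in> topspace X")
    case True
    then have "closedin X {z}" using H by (simp add: closedin_Hausdorff_singleton)
    then show ?thesis using U openin_diff by blast
  next
    case False
    then have "U - {z} = U" using U openin_subset by blast
    then show ?thesis using U by simp
  qed
  obtain f where f: "f \<in> C0 (subtopology X (U - {z}))" "f x = 1"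
    using C0_bump[OF L H O] x by blast
  then have "f \<in> C0 (subtopology X U)" using C0_mono[OF H O U] by blast
  moreover have "f z = 0" using f(1) by (auto simp: C0_iff[OF H O])
  ultimately show thesis using that f(2) by blast
qed

text \<open>If \<open>f\<close> never took the value 1, then \<open>g = f / (1 - f)\<close> would satisfy \<open>g - f * g = f\<close>.\<close>

lemma character_takes_value:
  assumes H: "Hausdorff_space X"
    and add: "\<And>f g. f \<in> C0 X \<Longrightarrow> g \<in> C0 X \<Longrightarrow> \<omega> (\<lambda>x. f x + g x) = \<omega> f + \<omega> g"
    and mult: "\<And>f g. f \<in> C0 X \<Longrightarrow> g \<in> C0 X \<Longrightarrow> \<omega> (\<lambda>x. f x * g x) = \<omega> f * \<omega> g"
    and f: "f \<in> C0 X" "\<omega> f = (1::complex)"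
  shows "\<exists>x\<in>topspace X. f x = 1"
proof (rule ccontr)
  assume A: "\<not> ?thesis"
  define g where "g = (\<lambda>x. f x / (1 - f x))"
  have ne: "f x \<noteq> 1" for x using A f(1) by (cases "x \<in> topspace X") (auto simp: C0_def)
  have "(\<lambda>x. (\<lambda>z. z / (1 - z)) (f x)) \<in> C0 (subtopology X (topspace X))"
    by (rule C0_continuous_compose[where S = "- {1}"])
       (use H f ne in \<open>auto simp: subtopology_topspace intro!: continuous_intros\<close>)
  then have g: "g \<in> C0 X" by (simp add: g_def subtopology_topspace)
  then have fg: "(\<lambda>x. f x * g x) \<in> C0 X"
    using C0_mult[OF H openin_topspace openin_topspace] f(1) by (simp add: subtopology_topspace)
  have "(\<lambda>x. f x + f x * g x) = g"
  proof
    fix x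
    have "1 - f x \<noteq> 0" using ne[of x] by simp
    then show "f x + f x * g x = g x" by (simp add: g_def field_simps)
  qed
  then have "\<omega> g = \<omega> f + \<omega> f * \<omega> g"
    using add[OF f(1) fg] mult[OF f(1) g] by simp
  then show False using f(2) by simp
qed

text \<open>A compactness argument in place of maximal ideals: multiplicativity enters through
  \<open>character_takes_value\<close>, applied to one function that is built so as to avoid the
  value 1.\<close>

lemma character_is_evaluation:
  assumes H: "Hausdorff_space X"
    and add: "\<And>f g. f \<in> C0 X \<Longrightarrow> g \<in> C0 X \<Longrightarrow> \<omega> (\<lambda>x. f x + g x) = \<omega> f + \<omega> g"
    and mult: "\<And>f g. f \<in> C0 X \<Longrightarrow> g \<in> C0 X \<Longrightarrow> \<omega> (\<lambda>x. f x * g x) = \<omega> f * \<omega> g"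
    and scale: "\<And>c f. f \<in> C0 X \<Longrightarrow> \<omega> (\<lambda>x. c * f x) = c * \<omega> f"
    and star: "\<And>f. f \<in> C0 X \<Longrightarrow> \<omega> (\<lambda>x. cnj (f x)) = cnj (\<omega> f)"
    and nz: "k \<in> C0 X" "\<omega> k \<noteq> (0::complex)"
  shows "\<exists>x\<in>topspace X. \<forall>f\<in>C0 X. \<omega> f = f x"
proof (rule ccontr)
  assume A: "\<not> ?thesis"
  have Cadd: "(\<lambda>x. f x + g x) \<in> C0 X" if "f \<in> C0 X" "g \<in> C0 X" for f g
    using C0_add[OF H openin_topspace] that by (simp add: subtopology_topspace)
  have Cmult: "(\<lambda>x. f x * g x) \<in> C0 X" if "f \<in> C0 X" "g \<in> C0 X" for f g
    using C0_mult[OF H openin_topspace openin_topspace] that by (simp add: subtopology_topspace)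
  have Cscale: "(\<lambda>x. c * f x) \<in> C0 X" if "f \<in> C0 X" for f c
    using C0_continuous_compose[OF H openin_topspace, of f UNIV "\<lambda>z. c * z"] that
    by (auto simp: subtopology_topspace intro!: continuous_intros)
  have Ccnj: "(\<lambda>x. cnj (f x)) \<in> C0 X" if "f \<in> C0 X" for f
    using C0_continuous_compose[OF H openin_topspace, of f UNIV cnj] that
    by (auto simp: subtopology_topspace intro!: continuous_intros)
  \<comment> \<open>A substitute for the unit: \<open>F x\<close> minus the constant
    \<open>\<omega> (F x)\<close> need not vanish at infinity, but its product with \<open>u\<close>
    does.\<close>
  define u where "u = (\<lambda>x. (1 / \<omega> k) * k x)"
  have u: "u \<in> C0 X" "\<omega> u = 1"
    using nz Cscale[OF nz(1), of "1 / \<omega> k"] scale[OF nz(1), of "1 / \<omega> k"] unfolding u_def by simp_all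
  define q where "q = (\<lambda>x. u x * cnj (u x))"
  have q: "q \<in> C0 X" "\<omega> q = 1" using u Cmult Ccnj mult star by (auto simp: q_def)
  obtain F where F: "\<And>x. x \<in> topspace X \<Longrightarrow> F x \<in> C0 X \<and> \<omega> (F x) \<noteq> F x x"
    using A by metis
  \<comment> \<open>The zero sets of the \<open>p x\<close> have no common point in the compact set \<open>K\<close> below, so for a finite sum
    \<open>S\<close> of their squared moduli \<open>q + \<i> * S\<close> omits the value 1 of the character.\<close>
  define p where "p = (\<lambda>x y. F x y * u y + (- \<omega> (F x)) * u y)"
  have p: "p x \<in> C0 X" "\<omega> (p x) = 0" if "x \<in> topspace X" for x
  proof -
    note Fx = F[OF that]
    have 1: "(\<lambda>y. F x y * u y) \<in> C0 X" using Fx u Cmult by blast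
    have 2: "(\<lambda>y. (- \<omega> (F x)) * u y) \<in> C0 X" using u Cscale by blast
    show "p x \<in> C0 X" using Cadd[OF 1 2] unfolding p_def .
    have "\<omega> (p x) = \<omega> (F x) * \<omega> u + (- \<omega> (F x)) * \<omega> u"
      unfolding p_def using add[OF 1 2] mult[of "F x" u] scale[OF u(1), of "- \<omega> (F x)"] Fx u(1) by simp
    then show "\<omega> (p x) = 0" by simp
  qed
  define s where "s = (\<lambda>x y. p x y * cnj (p x y))"
  have s: "s x \<in> C0 X" "\<omega> (s x) = 0" if "x \<in> topspace X" for x
    using p[OF that] Cmult Ccnj mult star unfolding s_def by auto
  define K where "K = {x \<in> topspace X. q x = 1}"
  have "closedin X {x \<in> topspace X. q x \<in> {1}}"
    using q(1) by (intro closedin_continuous_map_preimage[where Y = euclidean]) (auto simp: C0_def)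
  moreover have "compactin X {x \<in> topspace X. 1 \<le> cmod (q x)}"
    using q(1) C0_iff[OF H openin_topspace, of q] by (simp add: subtopology_topspace)
  ultimately have "compactin X {x \<in> topspace X. q x \<in> {1}}"
    by (elim closed_compactin[rotated 2]) auto
  then have K: "compactin X K" by (simp add: K_def)
  have O: "openin X {y \<in> topspace X. s x y \<in> - {0}}" if "x \<in> topspace X" for x
    using s(1)[OF that] by (intro openin_continuous_map_preimage[where Y = euclidean]) (auto simp: C0_def)
  have un: "u x \<noteq> 0" if "x \<in> K" for x using that by (auto simp: K_def q_def)
  have sx: "s x x \<noteq> 0" if "x \<in> K" for x
  proof -
    have "p x x = (F x x - \<omega> (F x)) * u x" by (simp add: p_def algebra_simps)
    then show ?thesis using un[OF that] F[of x] that by (auto simp: s_def K_def)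
  qed
  define \<U> where "\<U> = (\<lambda>x. {y \<in> topspace X. s x y \<in> - {0}}) ` K"
  have "openin X W" if "W \<in> \<U>" for W using that O by (auto simp: \<U>_def K_def)
  moreover have "K \<subseteq> \<Union>\<U>" using sx by (auto simp: \<U>_def K_def)
  ultimately obtain \<F> where "finite \<F>" "\<F> \<subseteq> \<U>" "K \<subseteq> \<Union>\<F>"
    using compactinD[OF K, of \<U>] by blast
  then have "\<exists>C\<subseteq>K. finite C \<and> \<F> = (\<lambda>x. {y \<in> topspace X. s x y \<in> - {0}}) ` C"
    unfolding \<U>_def by (intro finite_subset_image)
  then obtain C where C: "finite C" "C \<subseteq> K" "K \<subseteq> (\<Union>x\<in>C. {y \<in> topspace X. s x y \<in> - {0}})"
    using \<open>K \<subseteq> \<Union>\<F>\<close> by blast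
  have CX: "C \<subseteq> topspace X" using C(2) by (auto simp: K_def)
  define S where "S = (\<lambda>y. \<Sum>x\<in>C. s x y)"
  have "(\<lambda>y. \<Sum>x\<in>D. s x y) \<in> C0 X \<and> \<omega> (\<lambda>y. \<Sum>x\<in>D. s x y) = 0" if "finite D" "D \<subseteq> topspace X" for D
    using that
  proof (induction D rule: finite_induct)
    case empty
    have "\<omega> (\<lambda>x. 0 * k x) = 0" using scale[OF nz(1), of 0] by simp
    then show ?case by (simp add: C0_zero)
  next
    case (insert x D)
    then show ?case using s[of x] Cadd[of "s x" "\<lambda>y. \<Sum>x\<in>D. s x y"] add[of "s x" "\<lambda>y. \<Sum>x\<in>D. s x y"] by simp
  qed
  then have S: "S \<in> C0 X" "\<omega> S = 0" using C(1) CX by (auto simp: S_def)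
  have iS: "(\<lambda>y. \<i> * S y) \<in> C0 X" "\<omega> (\<lambda>y. \<i> * S y) = 0" using S Cscale scale by auto
  obtain x where x: "x \<in> topspace X" "q x + \<i> * S x = 1"
  proof -
    have "\<omega> (\<lambda>x. q x + \<i> * S x) = 1" using add[OF q(1) iS(1)] q(2) iS(2) by simp
    then show thesis
      using character_takes_value[of X \<omega> "\<lambda>x. q x + \<i> * S x"] H add mult Cadd[OF q(1) iS(1)] that by blast
  qed
  have sr: "s z y = complex_of_real ((cmod (p z y))\<^sup>2)" for z y
    unfolding s_def by (simp only: complex_norm_square)
  have Sr: "S y = complex_of_real (\<Sum>z\<in>C. (cmod (p z y))\<^sup>2)" for y
    unfolding S_def sr by simp
  have qr: "q y = complex_of_real ((cmod (u y))\<^sup>2)" for y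
    unfolding q_def by (simp only: complex_norm_square)
  \<comment> \<open>Both \<open>q\<close> and \<open>S\<close> are real and nonnegative, so the
    factor \<open>\<i>\<close> keeps them from compensating each other; the real part forces
    \<open>q x = 1\<close> and the imaginary part \<open>S x = 0\<close>.\<close>
  have "Re (q x + \<i> * S x) = 1" "Im (q x + \<i> * S x) = 0" using x(2) by auto
  then have "(cmod (u x))\<^sup>2 = 1" "(\<Sum>z\<in>C. (cmod (p z x))\<^sup>2) = 0"
    unfolding qr Sr by (simp_all del: of_real_power of_real_sum)
  then have "q x = 1" "\<forall>z\<in>C. s z x = 0"
    using C(1) by (auto simp: qr sr sum_nonneg_eq_0_iff)
  then show False using C(3) x(1) by (auto simp: K_def)
qed

section \<open>Partial systems\<close>

locale psys =
  fixes P :: "('g, 'x) partial_system_data"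
  assumes partial_system: "partial_system P"
begin

sublocale grp: group "ps_group P"
  using partial_system by (simp add: partial_system_def)

lemma locally_compact: "locally_compact_space (ps_space P)"
  and Hausdorff: "Hausdorff_space (ps_space P)"
  and open_dom: "g \<in> carrier (ps_group P) \<Longrightarrow> openin (ps_space P) (ps_dom P g)"
  and homeo_act: "g \<in> carrier (ps_group P) \<Longrightarrow>
    homeomorphic_map (subtopology (ps_space P) (ps_dom P (ps_inv P g)))
      (subtopology (ps_space P) (ps_dom P g)) (ps_act P g)"
  and dom_one: "ps_dom P (ps_one P) = topspace (ps_space P)"
  and act_one: "x \<in> topspace (ps_space P) \<Longrightarrow> ps_act P (ps_one P) x = x"
  and act_image: "g \<in> carrier (ps_group P) \<Longrightarrow> h \<in> carrier (ps_group P) \<Longrightarrow>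
    ps_act P g ` (ps_dom P (ps_inv P (ps_mult P h g)) \<inter> ps_dom P (ps_inv P g)) =
      ps_dom P g \<inter> ps_dom P (ps_inv P h)"
  and act_mult0: "g \<in> carrier (ps_group P) \<Longrightarrow> h \<in> carrier (ps_group P) \<Longrightarrow>
    x \<in> ps_dom P (ps_inv P (ps_mult P h g)) \<inter> ps_dom P (ps_inv P g) \<Longrightarrow>
    ps_act P (ps_mult P h g) x = ps_act P h (ps_act P g x)"
  using partial_system by (simp_all add: partial_system_def)

lemma dom_subset: "g \<in> carrier (ps_group P) \<Longrightarrow> ps_dom P g \<subseteq> topspace (ps_space P)"
  using open_dom openin_subset by blast

lemma topspace_dom:
  "g \<in> carrier (ps_group P) \<Longrightarrow> topspace (subtopology (ps_space P) (ps_dom P g)) = ps_dom P g"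
  using dom_subset by auto

lemma at_iff: "g \<in> ps_at P x \<longleftrightarrow> g \<in> carrier (ps_group P) \<and> x \<in> ps_dom P (ps_inv P g)"
  by (simp add: ps_at_def)

lemma at_carrier [dest]: "g \<in> ps_at P x \<Longrightarrow> g \<in> carrier (ps_group P)"
  by (simp add: ps_at_def)

lemma at_space: "g \<in> ps_at P x \<Longrightarrow> x \<in> topspace (ps_space P)"
  using dom_subset grp.inv_closed unfolding at_iff by blast

lemma dom_iff_at: "g \<in> carrier (ps_group P) \<Longrightarrow> x \<in> ps_dom P g \<longleftrightarrow> ps_inv P g \<in> ps_at P x"
  by (simp add: at_iff)

lemma one_at: "x \<in> topspace (ps_space P) \<Longrightarrow> ps_one P \<in> ps_at P x"
  by (simp add: at_iff dom_one)

lemma act_dom: "g \<in> ps_at P x \<Longrightarrow> ps_act P g x \<in> ps_dom P g"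
  using homeomorphic_imp_surjective_map[OF homeo_act, of g] topspace_dom[of g]
    topspace_dom[of "ps_inv P g"] unfolding at_iff by (metis grp.inv_closed imageI)

lemma act_space: "g \<in> ps_at P x \<Longrightarrow> ps_act P g x \<in> topspace (ps_space P)"
  using act_dom dom_subset at_carrier by blast

lemma act_inj:
  assumes "g \<in> ps_at P x" "g \<in> ps_at P y" "ps_act P g x = ps_act P g y"
  shows "x = y"
  using homeomorphic_imp_injective_map[OF homeo_act, of g] assms topspace_dom[of "ps_inv P g"]
  by (auto simp: at_iff inj_on_def)

text \<open>The image axiom gives one direction directly. For the other it produces some preimage of
  \<open>h.x\<close> in the domain of \<open>gh\<close>, and injectivity of the action of
  \<open>h\<close> identifies it with \<open>x\<close>.\<close>

lemma at_mult_iff: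
  assumes h: "h \<in> ps_at P x" and g: "g \<in> carrier (ps_group P)"
  shows "ps_mult P g h \<in> ps_at P x \<longleftrightarrow> g \<in> ps_at P (ps_act P h x)"
proof
  have hG: "h \<in> carrier (ps_group P)" using h by blast
  assume "ps_mult P g h \<in> ps_at P x"
  then have "x \<in> ps_dom P (ps_inv P (ps_mult P g h)) \<inter> ps_dom P (ps_inv P h)"
    using h by (simp add: at_iff)
  then have "ps_act P h x \<in> ps_dom P h \<inter> ps_dom P (ps_inv P g)" using act_image[OF hG g] by blast
  then show "g \<in> ps_at P (ps_act P h x)" using g by (simp add: at_iff)
next
  have hG: "h \<in> carrier (ps_group P)" using h by blast
  assume "g \<in> ps_at P (ps_act P h x)"
  then have "ps_act P h x \<in> ps_dom P h \<inter> ps_dom P (ps_inv P g)"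
    using act_dom[OF h] by (simp add: at_iff)
  then obtain y where y: "y \<in> ps_dom P (ps_inv P (ps_mult P g h))" "y \<in> ps_dom P (ps_inv P h)"
      "ps_act P h x = ps_act P h y"
    using act_image[OF hG g] by blast
  then have "x = y" using act_inj[OF h] hG by (simp add: at_iff)
  then show "ps_mult P g h \<in> ps_at P x" using y(1) hG g by (simp add: at_iff)
qed

lemma act_mult:
  assumes h: "h \<in> ps_at P x" and g: "g \<in> ps_at P (ps_act P h x)"
  shows "ps_act P (ps_mult P g h) x = ps_act P g (ps_act P h x)"
  using act_mult0[of h g x] at_mult_iff[OF h, of g] h g by (auto simp: at_iff)

lemma inv_at: "g \<in> ps_at P x \<Longrightarrow> ps_inv P g \<in> ps_at P (ps_act P g x)"
  using act_dom dom_iff_at by blast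

lemma act_inv_act: "g \<in> ps_at P x \<Longrightarrow> ps_act P (ps_inv P g) (ps_act P g x) = x"
  using act_mult[OF _ inv_at, of g x] act_one at_space at_carrier by fastforce

lemma inv_at': "g \<in> carrier (ps_group P) \<Longrightarrow> x \<in> ps_dom P g \<Longrightarrow>
    g \<in> ps_at P (ps_act P (ps_inv P g) x)"
  using inv_at[of "ps_inv P g" x] by (simp add: dom_iff_at)

lemma act_act_inv: "g \<in> carrier (ps_group P) \<Longrightarrow> x \<in> ps_dom P g \<Longrightarrow>
    ps_act P g (ps_act P (ps_inv P g) x) = x"
  using act_inv_act[of "ps_inv P g" x] by (simp add: dom_iff_at)

text \<open>The arrow that leads from \<open>h.x\<close> to \<open>k.x\<close>; it indexes the
  matrix entry in row \<open>k\<close> and column \<open>h\<close>.\<close>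

lemma mult_inv_at:
  assumes "k \<in> ps_at P x" "h \<in> ps_at P x"
  shows "ps_mult P k (ps_inv P h) \<in> ps_at P (ps_act P h x)"
    and "ps_act P (ps_mult P k (ps_inv P h)) (ps_act P h x) = ps_act P k x"
proof -
  have c: "k \<in> carrier (ps_group P)" "h \<in> carrier (ps_group P)" using assms by auto
  then have eq: "ps_mult P (ps_mult P k (ps_inv P h)) h = k"
    by (simp add: grp.m_assoc)
  show 1: "ps_mult P k (ps_inv P h) \<in> ps_at P (ps_act P h x)"
    using at_mult_iff[OF assms(2), of "ps_mult P k (ps_inv P h)"] eq assms(1) c by simp
  show "ps_act P (ps_mult P k (ps_inv P h)) (ps_act P h x) = ps_act P k x"
    using act_mult[OF assms(2) 1] eq by simp
qed

lemma C0_dom: "g \<in> carrier (ps_group P) \<Longrightarrow> f \<in> C0 (subtopology (ps_space P) (ps_dom P g)) \<Longrightarrow>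
    f \<in> C0 (ps_space P)"
  using C0_mono_space[OF Hausdorff open_dom] by blast

end


section \<open>The norm of the algebraic crossed product\<close>

text \<open>Cauchy-Schwarz in one direction, the test vector \<open>cnj (v i)\<close> in the other.
  The pairing is bilinear, so that a bound on a matrix becomes a condition that treats rows and
  columns alike.\<close>

lemma L2_set_le_iff_functional:
  fixes v :: "'i \<Rightarrow> complex"
  assumes "C \<ge> 0"
  shows "L2_set (\<lambda>i. cmod (v i)) F \<le> C \<longleftrightarrow>
    (\<forall>\<eta>. cmod (\<Sum>i\<in>F. \<eta> i * v i) \<le> L2_set (\<lambda>i. cmod (\<eta> i)) F * C)"
proof
  assume L: "L2_set (\<lambda>i. cmod (v i)) F \<le> C"
  show "\<forall>\<eta>. cmod (\<Sum>i\<in>F. \<eta> i * v i) \<le> L2_set (\<lambda>i. cmod (\<eta> i)) F * C"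
  proof
    fix \<eta> :: "'i \<Rightarrow> complex"
    have "cmod (\<Sum>i\<in>F. \<eta> i * v i) \<le> (\<Sum>i\<in>F. \<bar>cmod (\<eta> i)\<bar> * \<bar>cmod (v i)\<bar>)"
      by (rule order_trans[OF norm_sum]) (simp add: norm_mult)
    also have "\<dots> \<le> L2_set (\<lambda>i. cmod (\<eta> i)) F * L2_set (\<lambda>i. cmod (v i)) F"
      by (rule L2_set_mult_ineq)
    also have "\<dots> \<le> L2_set (\<lambda>i. cmod (\<eta> i)) F * C"
      using L by (simp add: mult_left_mono)
    finally show "cmod (\<Sum>i\<in>F. \<eta> i * v i) \<le> L2_set (\<lambda>i. cmod (\<eta> i)) F * C" .
  qed
next
  assume A: "\<forall>\<eta>. cmod (\<Sum>i\<in>F. \<eta> i * v i) \<le> L2_set (\<lambda>i. cmod (\<eta> i)) F * C"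
  define n where "n = L2_set (\<lambda>i. cmod (v i)) F"
  have "(\<Sum>i\<in>F. cnj (v i) * v i) = complex_of_real (n\<^sup>2)"
    by (simp add: n_def L2_set_def sum_nonneg mult.commute complex_norm_square del: of_real_power)
  then have "n\<^sup>2 \<le> n * C"
    using A[rule_format, of "\<lambda>i. cnj (v i)"] by (simp add: n_def norm_power)
  moreover have "n \<ge> 0" by (simp add: n_def)
  ultimately show "n \<le> C"
    using assms by (cases "n = 0") (auto simp: power2_eq_square)
qed

lemma L2_set_mono2:
  assumes "finite G" "F \<subseteq> G"
  shows "L2_set f F \<le> L2_set f G"
  unfolding L2_set_def using assms by (intro real_sqrt_le_mono sum_mono2) auto

lemma L2_set_reindex: "inj_on j F \<Longrightarrow> L2_set f (j ` F) = L2_set (\<lambda>i. f (j i)) F"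
  by (simp add: L2_set_def sum.reindex)

lemma ell2I_norm_le:
  assumes z: "\<And>h. h \<notin> S \<Longrightarrow> \<xi> h = 0"
    and le: "\<And>F. finite F \<Longrightarrow> F \<subseteq> S \<Longrightarrow> L2_set (\<lambda>i. cmod (\<xi> i)) F \<le> C"
  shows "\<xi> \<in> ell2 S" "ell2_norm S \<xi> \<le> C"
proof -
  have C: "C \<ge> 0" using le[of "{}"] by simp
  have le2: "(\<Sum>h\<in>F. (cmod (\<xi> h))\<^sup>2) \<le> C\<^sup>2" if "finite F" "F \<subseteq> S" for F
    using le[OF that] C unfolding L2_set_def by (simp add: sqrt_le_D)
  have s: "(\<lambda>h. (cmod (\<xi> h))\<^sup>2) summable_on S"
    by (rule nonneg_bdd_above_summable_on) (auto intro!: bdd_aboveI2[where M = "C\<^sup>2"] le2)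
  then show "\<xi> \<in> ell2 S" using z by (simp add: ell2_def)
  have "infsum (\<lambda>h. (cmod (\<xi> h))\<^sup>2) S \<le> C\<^sup>2"
    by (rule infsum_le_finite_sums[OF s]) (use le2 in auto)
  then show "ell2_norm S \<xi> \<le> C"
    unfolding ell2_norm_def using C real_le_lsqrt by (simp add: real_sqrt_le_iff' infsum_nonneg real_le_lsqrt)
qed

lemma L2_set_le_ell2_norm:
  assumes "\<xi> \<in> ell2 S" "finite F" "F \<subseteq> S"
  shows "L2_set (\<lambda>i. cmod (\<xi> i)) F \<le> ell2_norm S \<xi>"
  unfolding ell2_norm_def L2_set_def
  by (intro real_sqrt_le_mono finite_sum_le_infsum) (use assms in \<open>auto simp: ell2_def\<close>)

text \<open>In the canonical basis, $\rho_x(a)$ has the matrix entry $a_{k h^{-1}}(k.x)$ at $(k, h)$, and rows and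
  columns are finite; the norm is therefore determined by the finite submatrices.\<close>

definition cp_bound_at :: "('g, 'x) partial_system_data \<Rightarrow> 'x \<Rightarrow> real \<Rightarrow> ('g \<Rightarrow> 'x \<Rightarrow> complex) \<Rightarrow> bool" where
  "cp_bound_at P x C a \<longleftrightarrow> (\<forall>F F' \<eta> \<xi>. finite F \<and> finite F' \<and> F \<subseteq> ps_at P x \<and> F' \<subseteq> ps_at P x \<longrightarrow>
     cmod (\<Sum>k\<in>F. \<Sum>h\<in>F'. \<eta> k * (a (ps_mult P k (ps_inv P h)) (ps_act P k x) * \<xi> h)) \<le>
       L2_set (\<lambda>k. cmod (\<eta> k)) F * (C * L2_set (\<lambda>h. cmod (\<xi> h)) F'))"

text \<open>The bilinear form of the bound suits sums and adjoints, this form suits products, where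
  the output of one matrix is the input of the next.\<close>

lemma cp_bound_at_iff:
  assumes "C \<ge> 0"
  shows "cp_bound_at P x C a \<longleftrightarrow>
    (\<forall>F F' \<xi>. finite F \<and> finite F' \<and> F \<subseteq> ps_at P x \<and> F' \<subseteq> ps_at P x \<longrightarrow>
     L2_set (\<lambda>k. cmod (\<Sum>h\<in>F'. a (ps_mult P k (ps_inv P h)) (ps_act P k x) * \<xi> h)) F \<le>
       C * L2_set (\<lambda>h. cmod (\<xi> h)) F')"
  unfolding cp_bound_at_def using assms
  by (subst L2_set_le_iff_functional) (auto simp: sum_distrib_left)

lemma cp_carrier_zero: "a \<in> cp_carrier P \<Longrightarrow> g \<notin> carrier (ps_group P) \<Longrightarrow> a g = (\<lambda>x. 0)"
  by (auto simp: cp_carrier_def cp_supp_def)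

lemma cp_supp_zero: "g \<notin> cp_supp a \<Longrightarrow> a g x = 0"
  by (auto simp: cp_supp_def)

context psys
begin

text \<open>For one \<open>g\<close>, the entries with \<open>k h^{-1} = g\<close> occupy at most
  one place in each row and column, so that part has norm at most \<open>B g\<close>.\<close>

lemma cp_bound_at_sum:
  assumes a: "a \<in> cp_carrier P" and B: "\<And>g y. g \<in> cp_supp a \<Longrightarrow> cmod (a g y) \<le> B g"
  shows "cp_bound_at P x (\<Sum>g\<in>cp_supp a. B g) a"
  unfolding cp_bound_at_def
proof clarify
  fix F F' \<eta> \<xi>
  assume F: "finite F" "finite F'" "F \<subseteq> ps_at P x" "F' \<subseteq> ps_at P x"
  have fin: "finite (cp_supp a)" and sub: "cp_supp a \<subseteq> carrier (ps_group P)"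
    using a by (auto simp: cp_carrier_def)
  let ?M = "\<lambda>k h. a (ps_mult P k (ps_inv P h)) (ps_act P k x)"
  have B0: "B g \<ge> 0" if "g \<in> cp_supp a" for g using B[OF that] norm_ge_zero order_trans by blast
  \<comment> \<open>The sum over \<open>g\<close> is a selector: for given \<open>k\<close> and
    \<open>h\<close> the index \<open>k h^{-1}\<close> is the one that satisfies the
    condition.\<close>
  have *: "cmod (\<eta> k * (?M k h * \<xi> h)) \<le>
      (\<Sum>g\<in>cp_supp a. if h = ps_mult P (ps_inv P g) k then B g * (cmod (\<eta> k) * cmod (\<xi> h)) else 0)"
    if "k \<in> F" "h \<in> F'" for k h
  proof (cases "ps_mult P k (ps_inv P h) \<in> cp_supp a")
    case True
    have c: "k \<in> carrier (ps_group P)" "h \<in> carrier (ps_group P)" using that F by auto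
    have "h = ps_mult P (ps_inv P (ps_mult P k (ps_inv P h))) k"
      using c by (simp add: grp.inv_mult_group grp.m_assoc)
    have "cmod (\<eta> k * (?M k h * \<xi> h)) \<le> B (ps_mult P k (ps_inv P h)) * (cmod (\<eta> k) * cmod (\<xi> h))"
      using mult_right_mono[OF B[OF True, of "ps_act P k x"], of "cmod (\<eta> k) * cmod (\<xi> h)"]
      by (simp add: norm_mult algebra_simps)
    also have "\<dots> = (\<lambda>g. if h = ps_mult P (ps_inv P g) k then B g * (cmod (\<eta> k) * cmod (\<xi> h)) else 0)
        (ps_mult P k (ps_inv P h))"
      using c by (simp add: grp.inv_mult_group grp.m_assoc)
    also have "\<dots> \<le> (\<Sum>g\<in>cp_supp a. if h = ps_mult P (ps_inv P g) k then B g * (cmod (\<eta> k) * cmod (\<xi> h)) else 0)"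
      by (rule member_le_sum[OF True _ fin]) (use B0 in auto)
    finally show ?thesis .
  next
    case False
    then have "?M k h = 0" by (rule cp_supp_zero)
    then show ?thesis using B0 by (auto intro!: sum_nonneg)
  qed
  have CS: "(\<Sum>k\<in>F. \<Sum>h\<in>F'. if h = ps_mult P (ps_inv P g) k then B g * (cmod (\<eta> k) * cmod (\<xi> h)) else 0)
      \<le> B g * (L2_set (\<lambda>k. cmod (\<eta> k)) F * L2_set (\<lambda>h. cmod (\<xi> h)) F')" if g: "g \<in> cp_supp a" for g
  proof -
    define K where "K = {k \<in> F. ps_mult P (ps_inv P g) k \<in> F'}"
    have gG: "g \<in> carrier (ps_group P)" using g sub by blast
    have FG: "F \<subseteq> carrier (ps_group P)" using F(3) by auto
    \<comment> \<open>Translation by the inverse of \<open>g\<close> pairs the rows in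
      \<open>K\<close> with distinct columns, so the double sum collapses to a single sum to which
      Cauchy-Schwarz applies.\<close>
    have inj: "inj_on (\<lambda>k. ps_mult P (ps_inv P g) k) K"
      using FG gG by (auto simp: inj_on_def K_def dest!: subsetD[OF FG])
    have "(\<Sum>k\<in>F. \<Sum>h\<in>F'. if h = ps_mult P (ps_inv P g) k then B g * (cmod (\<eta> k) * cmod (\<xi> h)) else 0)
      = (\<Sum>k\<in>F. if ps_mult P (ps_inv P g) k \<in> F' then B g * (cmod (\<eta> k) * cmod (\<xi> (ps_mult P (ps_inv P g) k))) else 0)"
      using F(2) by (intro sum.cong) (auto simp: sum.delta)
    also have "\<dots> = (\<Sum>k\<in>K. B g * (cmod (\<eta> k) * cmod (\<xi> (ps_mult P (ps_inv P g) k))))"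
      unfolding K_def using F(1) by (simp add: sum.inter_filter)
    also have "\<dots> = B g * (\<Sum>k\<in>K. \<bar>cmod (\<eta> k)\<bar> * \<bar>cmod (\<xi> (ps_mult P (ps_inv P g) k))\<bar>)"
      by (simp add: sum_distrib_left)
    also have "\<dots> \<le> B g * (L2_set (\<lambda>k. cmod (\<eta> k)) K * L2_set (\<lambda>k. cmod (\<xi> (ps_mult P (ps_inv P g) k))) K)"
      by (rule mult_left_mono[OF L2_set_mult_ineq B0[OF g]])
    also have "L2_set (\<lambda>k. cmod (\<xi> (ps_mult P (ps_inv P g) k))) K =
        L2_set (\<lambda>h. cmod (\<xi> h)) ((\<lambda>k. ps_mult P (ps_inv P g) k) ` K)"
      by (rule L2_set_reindex[OF inj, symmetric])
    also have "B g * (L2_set (\<lambda>k. cmod (\<eta> k)) K * \<dots>) \<le>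
        B g * (L2_set (\<lambda>k. cmod (\<eta> k)) F * L2_set (\<lambda>h. cmod (\<xi> h)) F')"
      using B0[OF g] F(1,2) by (intro mult_left_mono mult_mono L2_set_mono2) (auto simp: K_def)
    finally show ?thesis .
  qed
  have "cmod (\<Sum>k\<in>F. \<Sum>h\<in>F'. \<eta> k * (?M k h * \<xi> h)) \<le> (\<Sum>k\<in>F. \<Sum>h\<in>F'. cmod (\<eta> k * (?M k h * \<xi> h)))"
    by (rule order_trans[OF norm_sum]) (intro sum_mono norm_sum)
  also have "\<dots> \<le> (\<Sum>k\<in>F. \<Sum>h\<in>F'. \<Sum>g\<in>cp_supp a.
      if h = ps_mult P (ps_inv P g) k then B g * (cmod (\<eta> k) * cmod (\<xi> h)) else 0)"
    by (intro sum_mono *)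
  also have "\<dots> = (\<Sum>k\<in>F. \<Sum>g\<in>cp_supp a. \<Sum>h\<in>F'.
      if h = ps_mult P (ps_inv P g) k then B g * (cmod (\<eta> k) * cmod (\<xi> h)) else 0)"
    by (intro sum.cong refl sum.swap)
  also have "\<dots> = (\<Sum>g\<in>cp_supp a. \<Sum>k\<in>F. \<Sum>h\<in>F'.
      if h = ps_mult P (ps_inv P g) k then B g * (cmod (\<eta> k) * cmod (\<xi> h)) else 0)"
    by (rule sum.swap)
  also have "\<dots> \<le> (\<Sum>g\<in>cp_supp a. B g * (L2_set (\<lambda>k. cmod (\<eta> k)) F * L2_set (\<lambda>h. cmod (\<xi> h)) F'))"
    by (intro sum_mono CS)
  also have "\<dots> = L2_set (\<lambda>k. cmod (\<eta> k)) F * ((\<Sum>g\<in>cp_supp a. B g) * L2_set (\<lambda>h. cmod (\<xi> h)) F')"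
    by (simp add: sum_distrib_right[symmetric])
  finally show "cmod (\<Sum>k\<in>F. \<Sum>h\<in>F'. \<eta> k * (?M k h * \<xi> h))
    \<le> L2_set (\<lambda>k. cmod (\<eta> k)) F * ((\<Sum>g\<in>cp_supp a. B g) * L2_set (\<lambda>h. cmod (\<xi> h)) F')" .
qed

lemma cp_carrier_bounded:
  assumes "a \<in> cp_carrier P"
  obtains B where "\<And>g y. cmod (a g y) \<le> B g"
proof -
  have "\<exists>B. \<forall>y. cmod (a g y) \<le> B" for g
  proof (cases "g \<in> carrier (ps_group P)")
    case True
    then have "a g \<in> C0 (subtopology (ps_space P) (ps_dom P g))" using assms by (simp add: cp_carrier_def)
    then show ?thesis using C0_bounded by blast
  next
    case False
    then show ?thesis using cp_carrier_zero[OF assms] by (auto intro!: exI[of _ 0])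
  qed
  then show thesis using that by metis
qed

text \<open>One constant for all points: without it the suprema in \<open>ell2_opnorm\<close> and
  \<open>cp_norm\<close> would be taken over sets not known to be bounded.\<close>

lemma cp_bound_at_exists:
  assumes a: "a \<in> cp_carrier P"
  obtains C where "C \<ge> 0" "\<And>x. cp_bound_at P x C a"
proof -
  obtain B where B: "\<And>g y. cmod (a g y) \<le> B g" using cp_carrier_bounded[OF a] by blast
  have "0 \<le> B g" for g using B order_trans norm_ge_zero by blast
  then show thesis using that[of "\<Sum>g\<in>cp_supp a. B g"] cp_bound_at_sum[OF a B] by (simp add: sum_nonneg)
qed

section \<open>Operator norms through finite submatrices\<close>

lemma cp_rho_off: "k \<notin> ps_at P x \<Longrightarrow> cp_rho P x a \<xi> k = 0"
  unfolding cp_rho_def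
  by (intro sum.neutral ballI infsum_0) (auto simp: cp_rho_basis_def)

text \<open>In row \<open>k\<close> only the columns \<open>g^{-1} k\<close> with \<open>g\<close>
  in the finite support contribute. Leaving \<open>F\<close> free above these makes it possible to
  use the same columns for several rows.\<close>

lemma cp_rho_eq:
  assumes a: "a \<in> cp_carrier P" and k: "k \<in> ps_at P x" and F: "finite F" "F \<subseteq> ps_at P x"
    and F_sup: "\<And>g. g \<in> cp_supp a \<Longrightarrow> ps_mult P (ps_inv P g) k \<in> ps_at P x \<Longrightarrow> ps_mult P (ps_inv P g) k \<in> F"
  shows "cp_rho P x a \<xi> k = (\<Sum>h\<in>F. a (ps_mult P k (ps_inv P h)) (ps_act P k x) * \<xi> h)"
proof -
  have fin: "finite (cp_supp a)" and sub: "cp_supp a \<subseteq> carrier (ps_group P)"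
    using a by (auto simp: cp_carrier_def)
  have kG: "k \<in> carrier (ps_group P)" using k by blast
  have 1: "infsum (\<lambda>h. \<xi> h * cp_rho_basis P x (a g) g h k) (ps_at P x) =
      (if ps_mult P (ps_inv P g) k \<in> ps_at P x then a g (ps_act P k x) * \<xi> (ps_mult P (ps_inv P g) k) else 0)"
    if g: "g \<in> cp_supp a" for g
  proof -
    have gG: "g \<in> carrier (ps_group P)" using g sub by blast
    have iff: "k = ps_mult P g h \<longleftrightarrow> h = ps_mult P (ps_inv P g) k" if "h \<in> carrier (ps_group P)" for h
      using that gG kG by (auto simp flip: grp.m_assoc)
    have "infsum (\<lambda>h. \<xi> h * cp_rho_basis P x (a g) g h k) (ps_at P x) =
      infsum (\<lambda>h. \<xi> h * a g (ps_act P k x)) (ps_at P x \<inter> {ps_mult P (ps_inv P g) k})"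
      by (rule infsum_cong_neutral) (use iff k kG gG in \<open>auto simp: cp_rho_basis_def simp flip: grp.m_assoc\<close>)
    also have "\<dots> = (if ps_mult P (ps_inv P g) k \<in> ps_at P x
        then a g (ps_act P k x) * \<xi> (ps_mult P (ps_inv P g) k) else 0)"
      by (simp add: mult.commute)
    finally show ?thesis .
  qed
  have "cp_rho P x a \<xi> k = (\<Sum>g\<in>cp_supp a. if ps_mult P (ps_inv P g) k \<in> ps_at P x
      then a g (ps_act P k x) * \<xi> (ps_mult P (ps_inv P g) k) else 0)"
    unfolding cp_rho_def by (rule sum.cong) (simp_all add: 1)
  also have "\<dots> = (\<Sum>g | g \<in> cp_supp a \<and> ps_mult P (ps_inv P g) k \<in> ps_at P x.
      a g (ps_act P k x) * \<xi> (ps_mult P (ps_inv P g) k))"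
    using fin by (simp add: sum.inter_filter)
  also have "\<dots> = (\<Sum>h\<in>F. a (ps_mult P k (ps_inv P h)) (ps_act P k x) * \<xi> h)"
  proof (rule sum.reindex_bij_witness_not_neutral
      [where S' = "{}" and T' = "{h \<in> F. ps_mult P k (ps_inv P h) \<notin> cp_supp a}"
         and i = "\<lambda>h. ps_mult P k (ps_inv P h)" and j = "\<lambda>g. ps_mult P (ps_inv P g) k"])
    have eq: "ps_mult P k (ps_inv P (ps_mult P (ps_inv P g) k)) = g" if "g \<in> cp_supp a" for g
      using subsetD[OF sub that] kG by (simp add: grp.inv_mult_group flip: grp.m_assoc)
    show "ps_mult P k (ps_inv P (ps_mult P (ps_inv P g) k)) = g"
      "ps_mult P (ps_inv P g) k \<in> F - {h \<in> F. ps_mult P k (ps_inv P h) \<notin> cp_supp a}"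
      if "g \<in> {g \<in> cp_supp a. ps_mult P (ps_inv P g) k \<in> ps_at P x} - {}" for g
      using that F_sup eq by auto
    show "a (ps_mult P k (ps_inv P (ps_mult P (ps_inv P g) k))) (ps_act P k x) * \<xi> (ps_mult P (ps_inv P g) k) =
      a g (ps_act P k x) * \<xi> (ps_mult P (ps_inv P g) k)"
      if "g \<in> {g \<in> cp_supp a. ps_mult P (ps_inv P g) k \<in> ps_at P x}" for g
      using that eq by simp
  next
    fix h assume h: "h \<in> F - {h \<in> F. ps_mult P k (ps_inv P h) \<notin> cp_supp a}"
    then have hG: "h \<in> carrier (ps_group P)" using F(2) by blast
    show eq: "ps_mult P (ps_inv P (ps_mult P k (ps_inv P h))) k = h"
      using hG kG by (simp add: grp.inv_mult_group grp.m_assoc)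
    show "ps_mult P k (ps_inv P h) \<in> {g \<in> cp_supp a. ps_mult P (ps_inv P g) k \<in> ps_at P x} - {}"
      using h F(2) eq by auto
  qed (use F(1) in \<open>auto simp: cp_supp_zero\<close>)
  finally show ?thesis .
qed

lemma cp_rho_eq_finite:
  assumes a: "a \<in> cp_carrier P" and F: "finite F" "F \<subseteq> ps_at P x" and E: "finite E" "E \<subseteq> ps_at P x"
  obtains F' where "finite F'" "F' \<subseteq> ps_at P x" "E \<subseteq> F'"
    "\<And>\<xi> k. k \<in> F \<Longrightarrow> cp_rho P x a \<xi> k = (\<Sum>h\<in>F'. a (ps_mult P k (ps_inv P h)) (ps_act P k x) * \<xi> h)"
proof
  let ?F' = "(\<lambda>(g, k). ps_mult P (ps_inv P g) k) ` (cp_supp a \<times> F) \<inter> ps_at P x \<union> E"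
  show fF': "finite ?F'" using a F E by (auto simp: cp_carrier_def)
  show F'at: "?F' \<subseteq> ps_at P x" using E by blast
  show "cp_rho P x a \<xi> k = (\<Sum>h\<in>?F'. a (ps_mult P k (ps_inv P h)) (ps_act P k x) * \<xi> h)" if "k \<in> F" for \<xi> k
    by (rule cp_rho_eq[OF a _ fF' F'at]) (use that F in auto)
qed auto

lemma ell2_norm_cp_rho_le:
  assumes a: "a \<in> cp_carrier P" and C: "C \<ge> 0" "cp_bound_at P x C a" and \<xi>: "\<xi> \<in> ell2 (ps_at P x)"
  shows "cp_rho P x a \<xi> \<in> ell2 (ps_at P x)" "ell2_norm (ps_at P x) (cp_rho P x a \<xi>) \<le> C * ell2_norm (ps_at P x) \<xi>"
proof -
  have *: "L2_set (\<lambda>i. cmod (cp_rho P x a \<xi> i)) F \<le> C * ell2_norm (ps_at P x) \<xi>"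
    if F: "finite F" "F \<subseteq> ps_at P x" for F
  proof -
    obtain F' where F': "finite F'" "F' \<subseteq> ps_at P x"
      "\<And>k. k \<in> F \<Longrightarrow> cp_rho P x a \<xi> k = (\<Sum>h\<in>F'. a (ps_mult P k (ps_inv P h)) (ps_act P k x) * \<xi> h)"
      using cp_rho_eq_finite[OF a F finite.emptyI] by (metis empty_subsetI)
    have "L2_set (\<lambda>i. cmod (cp_rho P x a \<xi> i)) F =
        L2_set (\<lambda>k. cmod (\<Sum>h\<in>F'. a (ps_mult P k (ps_inv P h)) (ps_act P k x) * \<xi> h)) F"
      using F'(3) by (intro L2_set_cong) auto
    also have "\<dots> \<le> C * L2_set (\<lambda>h. cmod (\<xi> h)) F'"
      using C F F' by (auto simp: cp_bound_at_iff)
    also have "\<dots> \<le> C * ell2_norm (ps_at P x) \<xi>"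
      using L2_set_le_ell2_norm[OF \<xi> F'(1,2)] C by (simp add: mult_left_mono)
    finally show ?thesis .
  qed
  show "cp_rho P x a \<xi> \<in> ell2 (ps_at P x)"
    "ell2_norm (ps_at P x) (cp_rho P x a \<xi>) \<le> C * ell2_norm (ps_at P x) \<xi>"
    by (rule ell2I_norm_le[OF cp_rho_off *]; assumption)+
qed

text \<open>Finitely many rows meet finitely many columns, so a bound on finite submatrices bounds
  every finite section of the image vector; conversely the finite test vectors, scaled to norm 1,
  are admissible in the supremum.\<close>

lemma ell2_opnorm_le_iff:
  assumes a: "a \<in> cp_carrier P" and C: "C \<ge> 0"
  shows "ell2_opnorm (ps_at P x) (cp_rho P x a) \<le> C \<longleftrightarrow> cp_bound_at P x C a"
proof
  have 0: "(\<lambda>h. 0) \<in> ell2 (ps_at P x)" "ell2_norm (ps_at P x) (\<lambda>h. 0) \<le> 1"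
    by (simp_all add: ell2_def ell2_norm_def)
  assume "cp_bound_at P x C a"
  then have "ell2_norm (ps_at P x) (cp_rho P x a \<xi>) \<le> C"
    if "\<xi> \<in> ell2 (ps_at P x)" "ell2_norm (ps_at P x) \<xi> \<le> 1" for \<xi>
    using ell2_norm_cp_rho_le(2)[OF a C _ that(1)] mult_left_mono[OF that(2) C] by fastforce
  then show "ell2_opnorm (ps_at P x) (cp_rho P x a) \<le> C"
    unfolding ell2_opnorm_def using 0 by (intro cSup_least) auto
next
  assume le: "ell2_opnorm (ps_at P x) (cp_rho P x a) \<le> C"
  \<comment> \<open>An a priori bound, which makes the set of norms bounded above so that its
    members lie below the supremum.\<close>
  obtain C0 where C0: "C0 \<ge> 0" "cp_bound_at P x C0 a" using cp_bound_at_exists[OF a] by metis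
  have bdd: "bdd_above {ell2_norm (ps_at P x) (cp_rho P x a \<xi>) |\<xi>. \<xi> \<in> ell2 (ps_at P x) \<and> ell2_norm (ps_at P x) \<xi> \<le> 1}"
  proof (rule bdd_aboveI[of _ C0], clarify)
    fix \<xi> assume "\<xi> \<in> ell2 (ps_at P x)" "ell2_norm (ps_at P x) \<xi> \<le> 1"
    then show "ell2_norm (ps_at P x) (cp_rho P x a \<xi>) \<le> C0"
      using ell2_norm_cp_rho_le(2)[OF a C0] mult_left_mono[of _ 1 C0] C0(1) by fastforce
  qed
  have unit: "ell2_norm (ps_at P x) (cp_rho P x a \<xi>) \<le> C"
    if "\<xi> \<in> ell2 (ps_at P x)" "ell2_norm (ps_at P x) \<xi> \<le> 1" for \<xi>
    using cSup_upper[OF _ bdd] le that unfolding ell2_opnorm_def by fastforce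
  show "cp_bound_at P x C a"
    unfolding cp_bound_at_iff[OF C]
  proof clarify
    fix F F' and \<xi> :: "'g \<Rightarrow> complex"
    assume F: "finite F" "finite F'" "F \<subseteq> ps_at P x" "F' \<subseteq> ps_at P x"
    define r where "r = L2_set (\<lambda>h. cmod (\<xi> h)) F'"
    let ?M = "\<lambda>k h. a (ps_mult P k (ps_inv P h)) (ps_act P k x)"
    show "L2_set (\<lambda>k. cmod (\<Sum>h\<in>F'. ?M k h * \<xi> h)) F \<le> C * r"
    \<comment> \<open>A vector of norm 0 cannot be scaled to norm 1, but it vanishes on
      \<open>F'\<close>, and both sides are 0.\<close>
    proof (cases "r = 0")
      case True
      then have "\<xi> h = 0" if "h \<in> F'" for h using that F(2) by (simp add: r_def L2_set_eq_0_iff)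
      then show ?thesis using True by (simp add: L2_set_0')
    next
      case False
      then have r: "r > 0" using L2_set_nonneg[of "\<lambda>h. cmod (\<xi> h)" F'] unfolding r_def by linarith
      define \<zeta> where "\<zeta> = (\<lambda>h. if h \<in> F' then \<xi> h / r else 0)"
      have "L2_set (\<lambda>i. cmod (\<zeta> i)) E \<le> 1" if "finite E" for E
      proof -
        have "L2_set (\<lambda>i. cmod (\<zeta> i)) E \<le> L2_set (\<lambda>i. cmod (\<zeta> i)) (E \<union> F')"
          using that F(2) by (intro L2_set_mono2) auto
        also have "\<dots> = L2_set (\<lambda>i. cmod (\<zeta> i)) F'"
          unfolding L2_set_def using that F(2)
          by (intro arg_cong[of _ _ sqrt] sum.mono_neutral_right) (auto simp: \<zeta>_def)
        also have "\<dots> = L2_set (\<lambda>i. (1 / r) * cmod (\<xi> i)) F'"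
          using r by (intro L2_set_cong) (auto simp: \<zeta>_def norm_divide)
        also have "\<dots> = 1"
          using L2_set_right_distrib[of "1 / r" "\<lambda>i. cmod (\<xi> i)" F'] r by (simp add: r_def)
        finally show ?thesis .
      qed
      moreover have "\<zeta> h = 0" if "h \<notin> ps_at P x" for h using that F(4) by (auto simp: \<zeta>_def)
      ultimately have \<zeta>: "\<zeta> \<in> ell2 (ps_at P x)" "ell2_norm (ps_at P x) \<zeta> \<le> 1"
        using ell2I_norm_le[of "ps_at P x" \<zeta> 1] by blast+
      obtain E where E: "finite E" "F' \<subseteq> E"
        "\<And>\<xi> k. k \<in> F \<Longrightarrow> cp_rho P x a \<xi> k = (\<Sum>h\<in>E. ?M k h * \<xi> h)"
        using cp_rho_eq_finite[OF a F(1,3,2,4)] by metis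
      have eq: "cp_rho P x a \<zeta> k = (\<Sum>h\<in>F'. ?M k h * \<xi> h) / r" if "k \<in> F" for k
      proof -
        have "cp_rho P x a \<zeta> k = (\<Sum>h\<in>F'. ?M k h * \<zeta> h)"
          unfolding E(3)[OF that] using E(1,2) by (intro sum.mono_neutral_right) (auto simp: \<zeta>_def)
        then show ?thesis by (simp add: \<zeta>_def sum_divide_distrib)
      qed
      have "L2_set (\<lambda>k. cmod (\<Sum>h\<in>F'. ?M k h * \<xi> h)) F = L2_set (\<lambda>k. r * cmod (cp_rho P x a \<zeta> k)) F"
        using r by (intro L2_set_cong) (auto simp: eq norm_divide)
      also have "\<dots> = r * L2_set (\<lambda>k. cmod (cp_rho P x a \<zeta> k)) F"
        using r by (simp add: L2_set_right_distrib)
      also have "\<dots> \<le> r * ell2_norm (ps_at P x) (cp_rho P x a \<zeta>)"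
        using L2_set_le_ell2_norm[OF ell2_norm_cp_rho_le(1)[OF a C0 \<zeta>(1)] F(1,3)] r by simp
      also have "\<dots> \<le> r * C" using unit[OF \<zeta>] r by simp
      finally show ?thesis by (simp add: mult.commute)
    qed
  qed
qed

definition cp_bound :: "real \<Rightarrow> ('g \<Rightarrow> 'x \<Rightarrow> complex) \<Rightarrow> bool" where
  "cp_bound C a \<longleftrightarrow> (\<forall>x\<in>topspace (ps_space P). cp_bound_at P x C a)"

text \<open>With \<open>cp_norm_nonneg\<close> and \<open>cp_bound_norm\<close> this is the
  interface to the norm: all later estimates are shown for finite submatrices and carried over
  here.\<close>

lemma cp_norm_le_iff:
  assumes a: "a \<in> cp_carrier P" and C: "C \<ge> 0"
  shows "cp_norm P a \<le> C \<longleftrightarrow> cp_bound C a"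
proof -
  let ?S = "insert 0 ((\<lambda>x. ell2_opnorm (ps_at P x) (cp_rho P x a)) ` topspace (ps_space P))"
  obtain C0 where C0: "C0 \<ge> 0" "\<And>x. cp_bound_at P x C0 a" using cp_bound_at_exists[OF a] by metis
  have bdd: "bdd_above ?S"
    using C0 by (intro bdd_aboveI[of _ C0]) (auto simp: ell2_opnorm_le_iff[OF a C0(1)])
  have "cp_norm P a \<le> C \<longleftrightarrow> (\<forall>s\<in>?S. s \<le> C)"
    unfolding cp_norm_def by (rule cSup_le_iff) (use bdd in auto)
  also have "\<dots> \<longleftrightarrow> cp_bound C a"
    using C by (auto simp: cp_bound_def ell2_opnorm_le_iff[OF a C])
  finally show ?thesis .
qed

lemma cp_norm_nonneg:
  assumes a: "a \<in> cp_carrier P"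
  shows "cp_norm P a \<ge> 0"
proof -
  let ?S = "insert 0 ((\<lambda>x. ell2_opnorm (ps_at P x) (cp_rho P x a)) ` topspace (ps_space P))"
  obtain C0 where C0: "C0 \<ge> 0" "\<And>x. cp_bound_at P x C0 a" using cp_bound_at_exists[OF a] by metis
  have "bdd_above ?S"
    using C0 by (intro bdd_aboveI[of _ C0]) (auto simp: ell2_opnorm_le_iff[OF a C0(1)])
  then show ?thesis unfolding cp_norm_def by (intro cSup_upper) auto
qed

lemma cp_bound_norm: "a \<in> cp_carrier P \<Longrightarrow> cp_bound (cp_norm P a) a"
  using cp_norm_le_iff cp_norm_nonneg by blast

end

section \<open>The star-algebra operations on finite sums\<close>

lemma C0_sum:
  assumes "Hausdorff_space X" "openin X U" "\<And>i. i \<in> I \<Longrightarrow> f i \<in> C0 (subtopology X U)"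
  shows "(\<lambda>x. \<Sum>i\<in>I. f i x) \<in> C0 (subtopology X U)"
  using assms(3)
proof (induction I rule: infinite_finite_induct)
  case (insert i I)
  then show ?case using C0_add[OF assms(1,2), of "f i" "\<lambda>x. \<Sum>i\<in>I. f i x"] by simp
qed (simp_all add: C0_zero)

lemma C0_scale:
  assumes "Hausdorff_space X" "openin X U" "f \<in> C0 (subtopology X U)"
  shows "(\<lambda>x. c * f x) \<in> C0 (subtopology X U)"
  by (rule C0_continuous_compose[OF assms, of UNIV]) (auto intro!: continuous_intros)

lemma C0_cnj:
  assumes "Hausdorff_space X" "openin X U" "f \<in> C0 (subtopology X U)"
  shows "(\<lambda>x. cnj (f x)) \<in> C0 (subtopology X U)"
  by (rule C0_continuous_compose[OF assms, of UNIV]) (auto intro!: continuous_intros)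

context psys
begin

lemma cp_carrierD:
  assumes "a \<in> cp_carrier P"
  shows "finite (cp_supp a)" "cp_supp a \<subseteq> carrier (ps_group P)"
    "g \<in> carrier (ps_group P) \<Longrightarrow> a g \<in> C0 (subtopology (ps_space P) (ps_dom P g))"
  using assms by (auto simp: cp_carrier_def)

lemma C0_off: "g \<in> carrier (ps_group P) \<Longrightarrow> f \<in> C0 (subtopology (ps_space P) (ps_dom P g)) \<Longrightarrow>
    x \<notin> ps_dom P g \<Longrightarrow> f x = 0"
  using C0_iff[OF Hausdorff open_dom] by blast

lemma cp_off:
  assumes "a \<in> cp_carrier P" "x \<notin> ps_dom P g \<or> g \<notin> carrier (ps_group P)"
  shows "a g x = 0"
  using assms C0_off cp_carrierD(3) cp_carrier_zero by metis

lemma cp_carrierI: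
  assumes "finite S" "S \<subseteq> carrier (ps_group P)"
    and "\<And>g. g \<in> carrier (ps_group P) \<Longrightarrow> a g \<in> C0 (subtopology (ps_space P) (ps_dom P g))"
    and "\<And>g. g \<notin> S \<Longrightarrow> a g = (\<lambda>x. 0)"
  shows "a \<in> cp_carrier P"
proof -
  have "cp_supp a \<subseteq> S" using assms(4) by (auto simp: cp_supp_def)
  then show ?thesis using assms finite_subset by (auto simp: cp_carrier_def)
qed

text \<open>The inverse of \<open>g\<close> acts as a homeomorphism from \<open>?U\<close> onto
  \<open>?V\<close>. This is what places the product of terms over \<open>g\<close> and
  \<open>h\<close> in the ideal that belongs to \<open>gh\<close>.\<close>

lemma C0_pull:
  assumes g: "g \<in> carrier (ps_group P)" and h: "h \<in> carrier (ps_group P)"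
    and f: "f \<in> C0 (subtopology (ps_space P) (ps_dom P (ps_inv P g) \<inter> ps_dom P h))"
  shows "ps_pull P g f \<in> C0 (subtopology (ps_space P) (ps_dom P (ps_mult P g h)))"
proof -
  let ?U = "ps_dom P g \<inter> ps_dom P (ps_mult P g h)" and ?V = "ps_dom P (ps_inv P g) \<inter> ps_dom P h"
  have oU: "openin (ps_space P) ?U" and oV: "openin (ps_space P) ?V"
    using g h open_dom by auto
  have hom: "homeomorphic_map (subtopology (ps_space P) (ps_dom P g))
      (subtopology (ps_space P) (ps_dom P (ps_inv P g))) (ps_act P (ps_inv P g))"
    using homeo_act[of "ps_inv P g"] g by simp
  have im: "ps_act P (ps_inv P g) ` ?U = ?V"
    using act_image[of "ps_inv P g" "ps_inv P h"] g h by (simp add: grp.inv_mult_group Int_commute)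
  have "homeomorphic_map (subtopology (subtopology (ps_space P) (ps_dom P g)) ?U)
      (subtopology (subtopology (ps_space P) (ps_dom P (ps_inv P g))) ?V) (ps_act P (ps_inv P g))"
    by (rule homeomorphic_map_subtopologies[OF hom])
       (use im topspace_dom[of g] topspace_dom[of "ps_inv P g"] g in \<open>simp add: Int_assoc[symmetric]\<close>)
  then have hom': "homeomorphic_map (subtopology (ps_space P) ?U) (subtopology (ps_space P) ?V) (ps_act P (ps_inv P g))"
    by (simp add: subtopology_subtopology Int_assoc[symmetric])
  have tU: "topspace (subtopology (ps_space P) ?U) = ?U" using oU openin_subset by force
  have "(\<lambda>x. if x \<in> ?U then f (ps_act P (ps_inv P g) x) else 0) \<in> C0 (subtopology (ps_space P) ?U)"
    using C0_compose_homeomorphic_map[OF hom' f] unfolding tU .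
  moreover have "(\<lambda>x. if x \<in> ?U then f (ps_act P (ps_inv P g) x) else 0) = ps_pull P g f"
  proof
    fix x
    \<comment> \<open>\<open>ps_pull\<close> tests membership in the domain of \<open>g\<close>
      only; at the remaining points outside \<open>?U\<close> the value is 0 because the image
      misses \<open>?V\<close>.\<close>
    have "f (ps_act P (ps_inv P g) x) = 0" if x: "x \<in> ps_dom P g" "x \<notin> ps_dom P (ps_mult P g h)"
    proof -
      have "ps_act P (ps_inv P g) x \<notin> ?V"
      proof
        assume "ps_act P (ps_inv P g) x \<in> ?V"
        then obtain y where y: "y \<in> ?U" "ps_act P (ps_inv P g) x = ps_act P (ps_inv P g) y"
          using im by blast
        then have "x = y" using act_inj[of "ps_inv P g" x y] x g by (simp add: at_iff)
        then show False using x y by blast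
      qed
      then show ?thesis using f C0_iff[OF Hausdorff oV] by blast
    qed
    then show "(if x \<in> ?U then f (ps_act P (ps_inv P g) x) else 0) = ps_pull P g f x"
      by (auto simp: ps_pull_def)
  qed
  ultimately have "ps_pull P g f \<in> C0 (subtopology (ps_space P) ?U)" by simp
  then show ?thesis using C0_mono[OF Hausdorff oU open_dom] g h by simp
qed

lemma C0_pull':
  assumes g: "g \<in> carrier (ps_group P)" and f: "f \<in> C0 (subtopology (ps_space P) (ps_dom P (ps_inv P g)))"
  shows "ps_pull P g f \<in> C0 (subtopology (ps_space P) (ps_dom P g))"
proof -
  have "ps_dom P (ps_inv P g) \<inter> ps_dom P (ps_one P) = ps_dom P (ps_inv P g)"
    using dom_subset[of "ps_inv P g"] g by (auto simp: dom_one)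
  then show ?thesis using C0_pull[OF g grp.one_closed] f g by simp
qed

text \<open>On the domain of \<open>g\<close> the two pull-backs of \<open>a g\<close> cancel; off
  it \<open>a g x\<close> is 0, so the arbitrary value of the action there does no harm.\<close>

lemma cp_term_eq:
  assumes a: "a \<in> cp_carrier P" and g: "g \<in> carrier (ps_group P)"
  shows "ps_pull P g (\<lambda>y. ps_pull P (ps_inv P g) (a g) y * b h y) x = a g x * b h (ps_act P (ps_inv P g) x)"
proof (cases "x \<in> ps_dom P g")
  case True
  then have "ps_act P (ps_inv P g) x \<in> ps_dom P (ps_inv P g)"
    using act_dom[of "ps_inv P g" x] g by (simp add: dom_iff_at)
  then show ?thesis using True act_act_inv[OF g True] g by (simp add: ps_pull_def)
next
  case False
  then show ?thesis using cp_off[OF a] by (simp add: ps_pull_def)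
qed

lemma cp_mult_double_sum:
  assumes a: "a \<in> cp_carrier P" and b: "b \<in> cp_carrier P"
  shows "cp_mult P a b k x = (\<Sum>g\<in>cp_supp a. \<Sum>h\<in>cp_supp b.
    if k = ps_mult P g h then a g x * b h (ps_act P (ps_inv P g) x) else 0)"
  unfolding cp_mult_def
  by (intro sum.cong refl) (use cp_carrierD[OF a] in \<open>auto simp: cp_delta_def cp_term_eq[OF a]\<close>)

text \<open>The equation \<open>k = gh\<close> is solved for \<open>h\<close>. A superset
  \<open>S\<close> of the support is allowed so that sums of elements can be expanded over a common
  index set.\<close>

lemma cp_mult_eq:
  assumes a: "a \<in> cp_carrier P" and b: "b \<in> cp_carrier P" and k: "k \<in> carrier (ps_group P)"
    and S: "finite S" "S \<subseteq> carrier (ps_group P)" "cp_supp a \<subseteq> S"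
  shows "cp_mult P a b k x = (\<Sum>g\<in>S. a g x * b (ps_mult P (ps_inv P g) k) (ps_act P (ps_inv P g) x))"
proof -
  have "(\<Sum>h\<in>cp_supp b. if k = ps_mult P g h then a g x * b h (ps_act P (ps_inv P g) x) else 0) =
      a g x * b (ps_mult P (ps_inv P g) k) (ps_act P (ps_inv P g) x)" if g: "g \<in> cp_supp a" for g
  proof -
    have gG: "g \<in> carrier (ps_group P)" using cp_carrierD[OF a] g by blast
    have "(\<Sum>h\<in>cp_supp b. if k = ps_mult P g h then a g x * b h (ps_act P (ps_inv P g) x) else 0) =
      (\<Sum>h\<in>cp_supp b. if h = ps_mult P (ps_inv P g) k then a g x * b h (ps_act P (ps_inv P g) x) else 0)"
      by (intro sum.cong refl if_cong) (use gG k cp_carrierD(2)[OF b] in \<open>auto simp flip: grp.m_assoc\<close>)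
    also have "\<dots> = a g x * b (ps_mult P (ps_inv P g) k) (ps_act P (ps_inv P g) x)"
      using cp_carrierD(1)[OF b] cp_supp_zero[of "ps_mult P (ps_inv P g) k" b] by (auto simp: sum.delta)
    finally show ?thesis .
  qed
  then have "cp_mult P a b k x = (\<Sum>g\<in>cp_supp a. a g x * b (ps_mult P (ps_inv P g) k) (ps_act P (ps_inv P g) x))"
    by (simp add: cp_mult_double_sum[OF a b])
  also have "\<dots> = (\<Sum>g\<in>S. a g x * b (ps_mult P (ps_inv P g) k) (ps_act P (ps_inv P g) x))"
    by (rule sum.mono_neutral_left) (use S cp_supp_zero in \<open>auto intro: cp_supp_zero\<close>)
  finally show ?thesis .
qed

lemma cp_mult_off:
  assumes a: "a \<in> cp_carrier P" and b: "b \<in> cp_carrier P" and k: "k \<notin> carrier (ps_group P)"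
  shows "cp_mult P a b k x = 0"
  unfolding cp_mult_double_sum[OF a b]
  by (intro sum.neutral ballI) (use k cp_carrierD(2)[OF a] cp_carrierD(2)[OF b] in auto)

lemma cp_mult_closed:
  assumes a: "a \<in> cp_carrier P" and b: "b \<in> cp_carrier P"
  shows "cp_mult P a b \<in> cp_carrier P"
proof (rule cp_carrierI)
  let ?S = "(\<lambda>(g, h). ps_mult P g h) ` (cp_supp a \<times> cp_supp b)"
  show "finite ?S" "?S \<subseteq> carrier (ps_group P)"
    using cp_carrierD[OF a] cp_carrierD[OF b] by auto
  show "cp_mult P a b k = (\<lambda>x. 0)" if "k \<notin> ?S" for k
    unfolding cp_mult_double_sum[OF a b] using that by (intro ext sum.neutral ballI) auto
  fix k assume k: "k \<in> carrier (ps_group P)"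
  have "(\<lambda>x. if k = ps_mult P g h then a g x * b h (ps_act P (ps_inv P g) x) else 0)
      \<in> C0 (subtopology (ps_space P) (ps_dom P k))" if "g \<in> cp_supp a" "h \<in> cp_supp b" for g h
  proof (cases "k = ps_mult P g h")
    case True
    have gh: "g \<in> carrier (ps_group P)" "h \<in> carrier (ps_group P)"
      using that cp_carrierD[OF a] cp_carrierD[OF b] by auto
    have "ps_pull P (ps_inv P g) (a g) \<in> C0 (subtopology (ps_space P) (ps_dom P (ps_inv P g)))"
      using C0_pull'[of "ps_inv P g" "a g"] gh cp_carrierD(3)[OF a] by simp
    then have "(\<lambda>y. ps_pull P (ps_inv P g) (a g) y * b h y)
        \<in> C0 (subtopology (ps_space P) (ps_dom P (ps_inv P g) \<inter> ps_dom P h))"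
      using C0_mult[OF Hausdorff open_dom open_dom] gh cp_carrierD(3)[OF b] by simp
    from C0_pull[OF gh this]
    have "ps_pull P g (\<lambda>y. ps_pull P (ps_inv P g) (a g) y * b h y) \<in> C0 (subtopology (ps_space P) (ps_dom P k))"
      using True by simp
    moreover have "ps_pull P g (\<lambda>y. ps_pull P (ps_inv P g) (a g) y * b h y) =
        (\<lambda>x. a g x * b h (ps_act P (ps_inv P g) x))"
      using cp_term_eq[OF a gh(1)] by (intro ext)
    ultimately show ?thesis using True by simp
  next
    case False
    then show ?thesis by (simp add: C0_zero)
  qed
  then show "cp_mult P a b k \<in> C0 (subtopology (ps_space P) (ps_dom P k))"
    unfolding cp_mult_double_sum[OF a b, abs_def] by (intro C0_sum Hausdorff open_dom k)
qed

lemma cp_star_eq: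
  assumes a: "a \<in> cp_carrier P" and k: "k \<in> carrier (ps_group P)"
  shows "cp_star P a k = ps_pull P k (\<lambda>y. cnj (a (ps_inv P k) y))"
proof
  fix x
  have iff: "k = ps_inv P g \<longleftrightarrow> g = ps_inv P k" if "g \<in> cp_supp a" for g
    using that k cp_carrierD(2)[OF a] by auto
  have "cp_star P a k x = (\<Sum>g\<in>cp_supp a.
     if g = ps_inv P k then ps_pull P (ps_inv P g) (\<lambda>y. cnj (a g y)) x else 0)"
    unfolding cp_star_def by (intro sum.cong refl) (use iff in \<open>auto simp: cp_delta_def\<close>)
  also have "\<dots> = ps_pull P k (\<lambda>y. cnj (a (ps_inv P k) y)) x"
    using cp_carrierD(1)[OF a] cp_supp_zero[of "ps_inv P k" a] k by (auto simp: sum.delta ps_pull_def)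
  finally show "cp_star P a k x = ps_pull P k (\<lambda>y. cnj (a (ps_inv P k) y)) x" .
qed

lemma cp_star_off:
  assumes a: "a \<in> cp_carrier P" and k: "k \<notin> carrier (ps_group P)"
  shows "cp_star P a k x = 0"
  unfolding cp_star_def
  by (intro sum.neutral ballI) (use k cp_carrierD(2)[OF a] in \<open>auto simp: cp_delta_def\<close>)

lemma cp_star_closed:
  assumes a: "a \<in> cp_carrier P"
  shows "cp_star P a \<in> cp_carrier P"
proof (rule cp_carrierI)
  let ?S = "ps_inv P ` cp_supp a"
  show "finite ?S" "?S \<subseteq> carrier (ps_group P)" using cp_carrierD[OF a] by auto
  show "cp_star P a k = (\<lambda>x. 0)" if "k \<notin> ?S" for k
    unfolding cp_star_def using that by (intro ext sum.neutral ballI) (auto simp: cp_delta_def)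
  fix k assume k: "k \<in> carrier (ps_group P)"
  have "(\<lambda>y. cnj (a (ps_inv P k) y)) \<in> C0 (subtopology (ps_space P) (ps_dom P (ps_inv P k)))"
    using C0_cnj[OF Hausdorff open_dom] cp_carrierD(3)[OF a] k by simp
  then show "cp_star P a k \<in> C0 (subtopology (ps_space P) (ps_dom P k))"
    unfolding cp_star_eq[OF a k] by (rule C0_pull'[OF k])
qed

lemma cp_add_closed:
  assumes a: "a \<in> cp_carrier P" and b: "b \<in> cp_carrier P"
  shows "(\<lambda>g x. a g x + b g x) \<in> cp_carrier P"
proof (rule cp_carrierI)
  show "finite (cp_supp a \<union> cp_supp b)" "cp_supp a \<union> cp_supp b \<subseteq> carrier (ps_group P)"
    using cp_carrierD[OF a] cp_carrierD[OF b] by auto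
  show "(\<lambda>x. a g x + b g x) = (\<lambda>x. 0)" if "g \<notin> cp_supp a \<union> cp_supp b" for g
    using that by (auto simp: cp_supp_def)
qed (use C0_add[OF Hausdorff open_dom] cp_carrierD(3)[OF a] cp_carrierD(3)[OF b] in simp)

lemma cp_scale_closed:
  assumes a: "a \<in> cp_carrier P"
  shows "(\<lambda>g x. c * a g x) \<in> cp_carrier P"
proof (rule cp_carrierI)
  show "finite (cp_supp a)" "cp_supp a \<subseteq> carrier (ps_group P)"
    using cp_carrierD[OF a] by auto
  show "(\<lambda>x. c * a g x) = (\<lambda>x. 0)" if "g \<notin> cp_supp a" for g
    using that by (auto simp: cp_supp_def)
qed (use C0_scale[OF Hausdorff open_dom] cp_carrierD(3)[OF a] in simp)

lemma cp_delta_closed: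
  assumes g: "g \<in> carrier (ps_group P)" and f: "f \<in> C0 (subtopology (ps_space P) (ps_dom P g))"
  shows "cp_delta f g \<in> cp_carrier P"
  by (rule cp_carrierI[of "{g}"]) (use g f C0_zero in \<open>auto simp: cp_delta_def\<close>)

section \<open>Matrices of products and adjoints, and the norm estimates they give\<close>

text \<open>The matrix of a product is the product of the matrices, by the substitution
  \<open>l = g^{-1} k\<close> in the convolution sum.\<close>

lemma cp_kernel_mult:
  assumes a: "a \<in> cp_carrier P" and b: "b \<in> cp_carrier P" and k: "k \<in> ps_at P x" and h: "h \<in> ps_at P x"
    and F: "finite F" "F \<subseteq> ps_at P x"
    and F_sup: "\<And>g. g \<in> cp_supp a \<Longrightarrow> ps_mult P (ps_inv P g) k \<in> ps_at P x \<Longrightarrow> ps_mult P (ps_inv P g) k \<in> F"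
  shows "cp_mult P a b (ps_mult P k (ps_inv P h)) (ps_act P k x) =
    (\<Sum>l\<in>F. a (ps_mult P k (ps_inv P l)) (ps_act P k x) * b (ps_mult P l (ps_inv P h)) (ps_act P l x))"
proof -
  have kG: "k \<in> carrier (ps_group P)" and hG: "h \<in> carrier (ps_group P)" using k h by auto
  have "cp_mult P a b (ps_mult P k (ps_inv P h)) (ps_act P k x) =
    (\<Sum>g\<in>cp_supp a. a g (ps_act P k x) *
       b (ps_mult P (ps_inv P g) (ps_mult P k (ps_inv P h))) (ps_act P (ps_inv P g) (ps_act P k x)))"
    by (rule cp_mult_eq[OF a b]) (use kG hG cp_carrierD[OF a] in auto)
  also have "\<dots> = (\<Sum>l\<in>F. a (ps_mult P k (ps_inv P l)) (ps_act P k x) * b (ps_mult P l (ps_inv P h)) (ps_act P l x))"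
  proof (rule sum.reindex_bij_witness_not_neutral
      [where S' = "{g \<in> cp_supp a. ps_act P k x \<notin> ps_dom P g}"
         and T' = "{l \<in> F. ps_mult P k (ps_inv P l) \<notin> cp_supp a}"
         and i = "\<lambda>l. ps_mult P k (ps_inv P l)" and j = "\<lambda>g. ps_mult P (ps_inv P g) k"])
    fix g assume g: "g \<in> cp_supp a"
    then have gG: "g \<in> carrier (ps_group P)" using cp_carrierD(2)[OF a] by blast
    have eq: "ps_mult P k (ps_inv P (ps_mult P (ps_inv P g) k)) = g"
      using gG kG by (simp add: grp.inv_mult_group flip: grp.m_assoc)
    show "a (ps_mult P k (ps_inv P (ps_mult P (ps_inv P g) k))) (ps_act P k x) *
          b (ps_mult P (ps_mult P (ps_inv P g) k) (ps_inv P h)) (ps_act P (ps_mult P (ps_inv P g) k) x) =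
        a g (ps_act P k x) *
          b (ps_mult P (ps_inv P g) (ps_mult P k (ps_inv P h))) (ps_act P (ps_inv P g) (ps_act P k x))"
    proof (cases "ps_act P k x \<in> ps_dom P g")
      case True
      then have "ps_inv P g \<in> ps_at P (ps_act P k x)" using gG by (simp add: dom_iff_at)
      then show ?thesis using eq act_mult[OF k] gG kG hG by (simp add: grp.m_assoc)
    next
      case False
      then show ?thesis using eq cp_off[OF a] by simp
    qed
  next
    fix g assume "g \<in> cp_supp a - {g \<in> cp_supp a. ps_act P k x \<notin> ps_dom P g}"
    then have g: "g \<in> cp_supp a" "ps_act P k x \<in> ps_dom P g" by auto
    then have gG: "g \<in> carrier (ps_group P)" using cp_carrierD(2)[OF a] by blast
    show eq: "ps_mult P k (ps_inv P (ps_mult P (ps_inv P g) k)) = g"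
      using gG kG by (simp add: grp.inv_mult_group flip: grp.m_assoc)
    have "ps_mult P (ps_inv P g) k \<in> ps_at P x"
      using at_mult_iff[OF k, of "ps_inv P g"] g gG by (simp add: dom_iff_at)
    then show "ps_mult P (ps_inv P g) k \<in> F - {l \<in> F. ps_mult P k (ps_inv P l) \<notin> cp_supp a}"
      using F_sup g eq by auto
  next
    fix l assume l: "l \<in> F - {l \<in> F. ps_mult P k (ps_inv P l) \<notin> cp_supp a}"
    then have lG: "l \<in> carrier (ps_group P)" and lat: "l \<in> ps_at P x" using F(2) by blast+
    show eq: "ps_mult P (ps_inv P (ps_mult P k (ps_inv P l))) k = l"
      using lG kG by (simp add: grp.inv_mult_group grp.m_assoc)
    have "ps_act P k x \<in> ps_dom P (ps_mult P k (ps_inv P l))"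
      using act_dom[OF mult_inv_at(1)[OF k lat]] mult_inv_at(2)[OF k lat] by simp
    then show "ps_mult P k (ps_inv P l) \<in> cp_supp a - {g \<in> cp_supp a. ps_act P k x \<notin> ps_dom P g}"
      using l by auto
  qed (use F(1) cp_carrierD(1)[OF a] cp_off[OF a] in \<open>auto simp: cp_supp_zero\<close>)
  finally show ?thesis .
qed

text \<open>Conjugate transposition: \<open>k h^{-1}\<close> at \<open>h.x\<close> and
  \<open>h k^{-1}\<close> at \<open>k.x\<close> are inverse arrows.\<close>

lemma cp_kernel_star:
  assumes a: "a \<in> cp_carrier P" and k: "k \<in> ps_at P x" and h: "h \<in> ps_at P x"
  shows "cp_star P a (ps_mult P k (ps_inv P h)) (ps_act P k x) =
    cnj (a (ps_mult P h (ps_inv P k)) (ps_act P h x))"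
proof -
  have c: "k \<in> carrier (ps_group P)" "h \<in> carrier (ps_group P)" using k h by auto
  have "ps_act P k x \<in> ps_dom P (ps_mult P k (ps_inv P h))"
    using act_dom[OF mult_inv_at(1)[OF k h]] mult_inv_at(2)[OF k h] by simp
  then show ?thesis
    using mult_inv_at(2)[OF h k] c by (simp add: cp_star_eq[OF a] ps_pull_def grp.inv_mult_group)
qed

lemma cp_bound_add:
  assumes "cp_bound C a" "cp_bound D b"
  shows "cp_bound (C + D) (\<lambda>g x. a g x + b g x)"
  unfolding cp_bound_def cp_bound_at_def
proof (intro ballI allI impI, elim conjE)
  fix x F F' and \<eta> \<xi> :: "'g \<Rightarrow> complex"
  assume x: "x \<in> topspace (ps_space P)" and F: "finite F" "finite F'" "F \<subseteq> ps_at P x" "F' \<subseteq> ps_at P x"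
  let ?S = "\<lambda>a. \<Sum>k\<in>F. \<Sum>h\<in>F'. \<eta> k * (a (ps_mult P k (ps_inv P h)) (ps_act P k x) * \<xi> h)"
  let ?e = "L2_set (\<lambda>k. cmod (\<eta> k)) F" and ?x = "L2_set (\<lambda>h. cmod (\<xi> h)) F'"
  have eq: "?S (\<lambda>g x. a g x + b g x) = ?S a + ?S b"
    by (simp add: distrib_left distrib_right sum.distrib)
  have "cmod (?S a) \<le> ?e * (C * ?x)" "cmod (?S b) \<le> ?e * (D * ?x)"
    using assms(1)[unfolded cp_bound_def cp_bound_at_def, rule_format, OF x, of F F' \<eta> \<xi>]
      assms(2)[unfolded cp_bound_def cp_bound_at_def, rule_format, OF x, of F F' \<eta> \<xi>] F by blast+
  then have "cmod (?S a + ?S b) \<le> ?e * (C * ?x) + ?e * (D * ?x)" by (rule norm_triangle_mono)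
  also have "\<dots> = ?e * ((C + D) * ?x)" by (simp only: distrib_left distrib_right)
  finally show "cmod (?S (\<lambda>g x. a g x + b g x)) \<le> ?e * ((C + D) * ?x)" unfolding eq .
qed

lemma cp_bound_scale:
  assumes "cp_bound C a"
  shows "cp_bound (cmod c * C) (\<lambda>g x. c * a g x)"
  unfolding cp_bound_def cp_bound_at_def
proof (intro ballI allI impI, elim conjE)
  fix x F F' and \<eta> \<xi> :: "'g \<Rightarrow> complex"
  assume x: "x \<in> topspace (ps_space P)" and F: "finite F" "finite F'" "F \<subseteq> ps_at P x" "F' \<subseteq> ps_at P x"
  let ?S = "\<lambda>a. \<Sum>k\<in>F. \<Sum>h\<in>F'. \<eta> k * (a (ps_mult P k (ps_inv P h)) (ps_act P k x) * \<xi> h)"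
  let ?e = "L2_set (\<lambda>k. cmod (\<eta> k)) F" and ?x = "L2_set (\<lambda>h. cmod (\<xi> h)) F'"
  have "?S (\<lambda>g x. c * a g x) = c * ?S a"
    by (simp add: sum_distrib_left mult_ac)
  moreover have "cmod (?S a) \<le> ?e * (C * ?x)"
    using assms x F unfolding cp_bound_def cp_bound_at_def by blast
  ultimately show "cmod (?S (\<lambda>g x. c * a g x)) \<le> ?e * (cmod c * C * ?x)"
    using mult_left_mono[of "cmod (?S a)" "?e * (C * ?x)" "cmod c"] by (simp add: norm_mult mult_ac)
qed

text \<open>The bound for \<open>a\<close> is used with rows and columns exchanged and both test
  vectors conjugated, which changes none of the norms.\<close>

lemma cp_bound_star:
  assumes a: "a \<in> cp_carrier P" and "cp_bound C a"
  shows "cp_bound C (cp_star P a)"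
  unfolding cp_bound_def cp_bound_at_def
proof (intro ballI allI impI, elim conjE)
  fix x F F' and \<eta> \<xi> :: "'g \<Rightarrow> complex"
  assume x: "x \<in> topspace (ps_space P)" and F: "finite F" "finite F'" "F \<subseteq> ps_at P x" "F' \<subseteq> ps_at P x"
  let ?e = "L2_set (\<lambda>k. cmod (\<eta> k)) F" and ?x = "L2_set (\<lambda>h. cmod (\<xi> h)) F'"
  let ?S = "\<Sum>h\<in>F'. \<Sum>k\<in>F. cnj (\<xi> h) * (a (ps_mult P h (ps_inv P k)) (ps_act P h x) * cnj (\<eta> k))"
  have "(\<Sum>k\<in>F. \<Sum>h\<in>F'. \<eta> k * (cp_star P a (ps_mult P k (ps_inv P h)) (ps_act P k x) * \<xi> h)) =
      (\<Sum>k\<in>F. \<Sum>h\<in>F'. \<eta> k * (cnj (a (ps_mult P h (ps_inv P k)) (ps_act P h x)) * \<xi> h))"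
  proof (intro sum.cong refl)
    fix k h assume "k \<in> F" "h \<in> F'"
    then show "\<eta> k * (cp_star P a (ps_mult P k (ps_inv P h)) (ps_act P k x) * \<xi> h) =
        \<eta> k * (cnj (a (ps_mult P h (ps_inv P k)) (ps_act P h x)) * \<xi> h)"
      using cp_kernel_star[OF a, of k x h] F by (simp add: subset_iff)
  qed
  also have "\<dots> = cnj ?S"
    unfolding cnj_sum complex_cnj_mult complex_cnj_cnj by (subst sum.swap) (simp add: mult_ac)
  finally have "cmod (\<Sum>k\<in>F. \<Sum>h\<in>F'. \<eta> k * (cp_star P a (ps_mult P k (ps_inv P h)) (ps_act P k x) * \<xi> h)) = cmod ?S"
    by (simp only: complex_mod_cnj)
  also have "\<dots> \<le> L2_set (\<lambda>h. cmod (cnj (\<xi> h))) F' * (C * L2_set (\<lambda>k. cmod (cnj (\<eta> k))) F)"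
    using assms(2)[unfolded cp_bound_def cp_bound_at_def, rule_format, OF x,
        of F' F "\<lambda>h. cnj (\<xi> h)" "\<lambda>k. cnj (\<eta> k)"] F by blast
  finally show "cmod (\<Sum>k\<in>F. \<Sum>h\<in>F'. \<eta> k * (cp_star P a (ps_mult P k (ps_inv P h)) (ps_act P k x) * \<xi> h))
      \<le> ?e * (C * ?x)" by (simp add: mult_ac)
qed

lemma cp_bound_mult:
  assumes a: "a \<in> cp_carrier P" and b: "b \<in> cp_carrier P"
    and C: "C \<ge> 0" "cp_bound C a" and D: "D \<ge> 0" "cp_bound D b"
  shows "cp_bound (C * D) (cp_mult P a b)"
  unfolding cp_bound_def
proof
  fix x assume x: "x \<in> topspace (ps_space P)"
  note Ca = C(2)[unfolded cp_bound_def, THEN bspec, OF x, unfolded cp_bound_at_iff[OF C(1)]]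
    and Db = D(2)[unfolded cp_bound_def, THEN bspec, OF x, unfolded cp_bound_at_iff[OF D(1)]]
  have CD: "C * D \<ge> 0" using C D by simp
  show "cp_bound_at P x (C * D) (cp_mult P a b)"
    unfolding cp_bound_at_iff[OF CD]
  proof clarify
    fix F F' and \<xi> :: "'g \<Rightarrow> complex"
    assume F: "finite F" "finite F'" "F \<subseteq> ps_at P x" "F' \<subseteq> ps_at P x"
    \<comment> \<open>All columns of the matrix of \<open>a\<close> that can be nonzero in the rows
      \<open>F\<close>; they serve as the rows of the matrix of \<open>b\<close>.\<close>
    define E where "E = (\<lambda>(g, k). ps_mult P (ps_inv P g) k) ` (cp_supp a \<times> F) \<inter> ps_at P x"
    have E: "finite E" "E \<subseteq> ps_at P x" using F(1) cp_carrierD(1)[OF a] by (auto simp: E_def)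
    define \<zeta> where "\<zeta> l = (\<Sum>h\<in>F'. b (ps_mult P l (ps_inv P h)) (ps_act P l x) * \<xi> h)" for l
    have "(\<Sum>h\<in>F'. cp_mult P a b (ps_mult P k (ps_inv P h)) (ps_act P k x) * \<xi> h) =
        (\<Sum>l\<in>E. a (ps_mult P k (ps_inv P l)) (ps_act P k x) * \<zeta> l)" if k: "k \<in> F" for k
    proof -
      have "(\<Sum>h\<in>F'. cp_mult P a b (ps_mult P k (ps_inv P h)) (ps_act P k x) * \<xi> h) =
        (\<Sum>h\<in>F'. (\<Sum>l\<in>E. a (ps_mult P k (ps_inv P l)) (ps_act P k x) *
          b (ps_mult P l (ps_inv P h)) (ps_act P l x)) * \<xi> h)"
      proof (rule sum.cong[OF refl])
        fix h assume h: "h \<in> F'"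
        show "cp_mult P a b (ps_mult P k (ps_inv P h)) (ps_act P k x) * \<xi> h =
          (\<Sum>l\<in>E. a (ps_mult P k (ps_inv P l)) (ps_act P k x) *
          b (ps_mult P l (ps_inv P h)) (ps_act P l x)) * \<xi> h"
          by (subst cp_kernel_mult[OF a b _ _ E]) (use k h F in \<open>auto simp: E_def\<close>)
      qed
      also have "\<dots> = (\<Sum>l\<in>E. \<Sum>h\<in>F'. a (ps_mult P k (ps_inv P l)) (ps_act P k x) *
          (b (ps_mult P l (ps_inv P h)) (ps_act P l x) * \<xi> h))"
        by (subst sum.swap) (simp add: sum_distrib_right mult.assoc)
      also have "\<dots> = (\<Sum>l\<in>E. a (ps_mult P k (ps_inv P l)) (ps_act P k x) * \<zeta> l)"
        by (simp add: \<zeta>_def sum_distrib_left)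
      finally show ?thesis .
    qed
    then have "L2_set (\<lambda>k. cmod (\<Sum>h\<in>F'. cp_mult P a b (ps_mult P k (ps_inv P h)) (ps_act P k x) * \<xi> h)) F =
        L2_set (\<lambda>k. cmod (\<Sum>l\<in>E. a (ps_mult P k (ps_inv P l)) (ps_act P k x) * \<zeta> l)) F"
      by (intro L2_set_cong) auto
    also have "\<dots> \<le> C * L2_set (\<lambda>l. cmod (\<zeta> l)) E"
      using Ca F E by blast
    also have "\<dots> \<le> C * (D * L2_set (\<lambda>h. cmod (\<xi> h)) F')"
      using Db F E C(1) unfolding \<zeta>_def by (intro mult_left_mono) auto
    finally show "L2_set (\<lambda>k. cmod (\<Sum>h\<in>F'. cp_mult P a b (ps_mult P k (ps_inv P h)) (ps_act P k x) * \<xi> h)) F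
        \<le> C * D * L2_set (\<lambda>h. cmod (\<xi> h)) F'" by (simp add: mult.assoc)
  qed
qed

text \<open>The matrix is applied to the basis vector at the identity, which returns the column
  \<open>a h (h.x)\<close>.\<close>

lemma cp_bound_column:
  assumes a: "a \<in> cp_carrier P" and C: "C \<ge> 0" "cp_bound C a"
    and F: "finite F" "F \<subseteq> ps_at P x" and x: "x \<in> topspace (ps_space P)"
  shows "L2_set (\<lambda>h. cmod (a h (ps_act P h x))) F \<le> C"
proof -
  have "L2_set (\<lambda>k. cmod (\<Sum>h\<in>{ps_one P}. a (ps_mult P k (ps_inv P h)) (ps_act P k x) * 1)) F
      \<le> C * L2_set (\<lambda>h. cmod (1::complex)) {ps_one P}"
    using C(2)[unfolded cp_bound_def, THEN bspec, OF x, unfolded cp_bound_at_iff[OF C(1)],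
        rule_format, of F "{ps_one P}" "\<lambda>_. 1"] F one_at[OF x] by simp
  moreover have "L2_set (\<lambda>k. cmod (\<Sum>h\<in>{ps_one P}. a (ps_mult P k (ps_inv P h)) (ps_act P k x) * 1)) F =
      L2_set (\<lambda>h. cmod (a h (ps_act P h x))) F"
    by (intro L2_set_cong refl) (use F(2) in \<open>auto dest!: subsetD at_carrier\<close>)
  ultimately show ?thesis by (simp add: L2_set_def)
qed

lemma cp_column_le_norm:
  assumes a: "a \<in> cp_carrier P" and F: "finite F" "F \<subseteq> ps_at P x"
  shows "L2_set (\<lambda>h. cmod (a h (ps_act P h x))) F \<le> cp_norm P a"
proof (cases "F = {}")
  case True
  then show ?thesis using cp_norm_nonneg[OF a] by simp
next
  case False
  then have "x \<in> topspace (ps_space P)" using F(2) at_space by blast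
  then show ?thesis using cp_bound_column[OF a cp_norm_nonneg[OF a] cp_bound_norm[OF a] F] by blast
qed

text \<open>The point \<open>x\<close> is written as \<open>g.(g^{-1}.x)\<close>, so the value is
  one entry of a column. The bound is uniform in \<open>g\<close> and \<open>x\<close> and lets
  coefficients survive the passage to limits.\<close>

lemma cp_entry_le_norm:
  assumes a: "a \<in> cp_carrier P"
  shows "cmod (a g x) \<le> cp_norm P a"
proof (cases "g \<in> carrier (ps_group P) \<and> x \<in> ps_dom P g")
  case True
  then have "g \<in> ps_at P (ps_act P (ps_inv P g) x)" using inv_at' by blast
  then show ?thesis
    using cp_column_le_norm[OF a, of "{g}" "ps_act P (ps_inv P g) x"] act_act_inv True by (simp add: L2_set_def)
next
  case False
  then show ?thesis using cp_off[OF a] cp_norm_nonneg[OF a] by auto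
qed

lemma cp_norm_add:
  assumes "a \<in> cp_carrier P" "b \<in> cp_carrier P"
  shows "cp_norm P (\<lambda>g x. a g x + b g x) \<le> cp_norm P a + cp_norm P b"
  using assms cp_norm_le_iff[OF cp_add_closed] cp_norm_nonneg cp_bound_add cp_bound_norm by simp

lemma cp_norm_scale_le:
  assumes "a \<in> cp_carrier P"
  shows "cp_norm P (\<lambda>g x. c * a g x) \<le> cmod c * cp_norm P a"
  using assms cp_norm_le_iff[OF cp_scale_closed] cp_norm_nonneg cp_bound_scale cp_bound_norm by simp

lemma cp_norm_star_le:
  assumes "a \<in> cp_carrier P"
  shows "cp_norm P (cp_star P a) \<le> cp_norm P a"
  using assms cp_norm_le_iff[OF cp_star_closed] cp_norm_nonneg cp_bound_star cp_bound_norm by simp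

lemma cp_norm_mult:
  assumes "a \<in> cp_carrier P" "b \<in> cp_carrier P"
  shows "cp_norm P (cp_mult P a b) \<le> cp_norm P a * cp_norm P b"
  using assms cp_norm_le_iff[OF cp_mult_closed] cp_norm_nonneg cp_bound_mult cp_bound_norm by simp

lemma cp_norm_le_sum:
  assumes "a \<in> cp_carrier P" and "\<And>g y. g \<in> cp_supp a \<Longrightarrow> cmod (a g y) \<le> B g"
  shows "cp_norm P a \<le> (\<Sum>g\<in>cp_supp a. B g)"
proof -
  have "0 \<le> B g" if "g \<in> cp_supp a" for g using assms(2)[OF that] norm_ge_zero order_trans by blast
  then have "0 \<le> (\<Sum>g\<in>cp_supp a. B g)" by (rule sum_nonneg)
  then show ?thesis using cp_bound_at_sum[OF assms] cp_norm_le_iff[OF assms(1)] by (auto simp: cp_bound_def)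
qed

end

section \<open>Completions of normed star-algebras\<close>

text \<open>No algebraic laws are assumed, only the estimates that make the operations on classes of Cauchy
  sequences well defined.\<close>

locale seminormed_star_algebra =
  fixes A :: "'a normed_star_algebra"
  assumes add_closed: "a \<in> sa_carrier A \<Longrightarrow> b \<in> sa_carrier A \<Longrightarrow> sa_add A a b \<in> sa_carrier A"
    and scale_closed: "a \<in> sa_carrier A \<Longrightarrow> sa_scale A z a \<in> sa_carrier A"
    and mult_closed: "a \<in> sa_carrier A \<Longrightarrow> b \<in> sa_carrier A \<Longrightarrow> sa_mult A a b \<in> sa_carrier A"
    and star_closed: "a \<in> sa_carrier A \<Longrightarrow> sa_star A a \<in> sa_carrier A"
    and dist_self: "a \<in> sa_carrier A \<Longrightarrow> sa_dist A a a = 0"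
    and dist_sym: "a \<in> sa_carrier A \<Longrightarrow> b \<in> sa_carrier A \<Longrightarrow> sa_dist A a b = sa_dist A b a"
    and dist_triangle: "a \<in> sa_carrier A \<Longrightarrow> b \<in> sa_carrier A \<Longrightarrow> c \<in> sa_carrier A \<Longrightarrow>
      sa_dist A a c \<le> sa_dist A a b + sa_dist A b c"
    and dist_add: "a \<in> sa_carrier A \<Longrightarrow> b \<in> sa_carrier A \<Longrightarrow> a' \<in> sa_carrier A \<Longrightarrow> b' \<in> sa_carrier A \<Longrightarrow>
      sa_dist A (sa_add A a b) (sa_add A a' b') \<le> sa_dist A a a' + sa_dist A b b'"
    and dist_scale: "a \<in> sa_carrier A \<Longrightarrow> b \<in> sa_carrier A \<Longrightarrow>
      sa_dist A (sa_scale A z a) (sa_scale A z b) \<le> cmod z * sa_dist A a b"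
    and dist_mult: "a \<in> sa_carrier A \<Longrightarrow> b \<in> sa_carrier A \<Longrightarrow> a' \<in> sa_carrier A \<Longrightarrow> b' \<in> sa_carrier A \<Longrightarrow>
      sa_dist A (sa_mult A a b) (sa_mult A a' b') \<le> sa_norm A a * sa_dist A b b' + sa_dist A a a' * sa_norm A b'"
    and dist_star: "a \<in> sa_carrier A \<Longrightarrow> b \<in> sa_carrier A \<Longrightarrow>
      sa_dist A (sa_star A a) (sa_star A b) \<le> sa_dist A a b"
    and norm_le: "a \<in> sa_carrier A \<Longrightarrow> b \<in> sa_carrier A \<Longrightarrow> sa_norm A a \<le> sa_norm A b + sa_dist A a b"
begin

lemma dist_nonneg: "a \<in> sa_carrier A \<Longrightarrow> b \<in> sa_carrier A \<Longrightarrow> sa_dist A a b \<ge> 0"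
  using dist_triangle[of a b a] dist_self[of a] dist_sym[of a b] by simp

lemma cauchyD: "s \<in> sa_cauchy A \<Longrightarrow> s n \<in> sa_carrier A"
  and cauchyD2: "s \<in> sa_cauchy A \<Longrightarrow> \<epsilon> > 0 \<Longrightarrow> \<exists>N. \<forall>m\<ge>N. \<forall>n\<ge>N. sa_dist A (s m) (s n) < \<epsilon>"
  by (auto simp: sa_cauchy_def)

lemma cauchyI: "(\<And>n. s n \<in> sa_carrier A) \<Longrightarrow>
    (\<And>\<epsilon>. \<epsilon> > 0 \<Longrightarrow> \<exists>N. \<forall>m\<ge>N. \<forall>n\<ge>N. sa_dist A (s m) (s n) < \<epsilon>) \<Longrightarrow> s \<in> sa_cauchy A"
  by (auto simp: sa_cauchy_def)

lemma sa_equivI: "s \<in> sa_cauchy A \<Longrightarrow> t \<in> sa_cauchy A \<Longrightarrow> (\<lambda>n. sa_dist A (s n) (t n)) \<longlonglongrightarrow> 0 \<Longrightarrow>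
    (s, t) \<in> sa_equiv A"
  by (auto simp: sa_equiv_def)

lemma sa_equivD: "(s, t) \<in> sa_equiv A \<Longrightarrow> s \<in> sa_cauchy A" "(s, t) \<in> sa_equiv A \<Longrightarrow> t \<in> sa_cauchy A"
  "(s, t) \<in> sa_equiv A \<Longrightarrow> (\<lambda>n. sa_dist A (s n) (t n)) \<longlonglongrightarrow> 0"
  by (auto simp: sa_equiv_def)

lemma equiv_sa_equiv: "equiv (sa_cauchy A) (sa_equiv A)"
proof (rule equivI)
  show "sa_equiv A \<subseteq> sa_cauchy A \<times> sa_cauchy A" by (auto simp: sa_equiv_def)
  show "refl_on (sa_cauchy A) (sa_equiv A)"
    by (rule refl_onI) (auto simp: sa_equiv_def dist_self cauchyD)
  show "sym (sa_equiv A)"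
    by (rule symI) (auto simp: sa_equiv_def dist_sym cauchyD)
  show "trans (sa_equiv A)"
  proof (rule transI)
    fix s t u assume st: "(s, t) \<in> sa_equiv A" and tu: "(t, u) \<in> sa_equiv A"
    note c = sa_equivD[OF st] sa_equivD[OF tu]
    have "(\<lambda>n. sa_dist A (s n) (t n) + sa_dist A (t n) (u n)) \<longlonglongrightarrow> 0"
      using tendsto_add[OF c(3,6)] by simp
    then have "(\<lambda>n. sa_dist A (s n) (u n)) \<longlonglongrightarrow> 0"
      by (rule tendsto_sandwich[OF _ _ tendsto_const, rotated 2])
         (use c dist_nonneg dist_triangle cauchyD in \<open>auto intro!: always_eventually\<close>)
    then show "(s, u) \<in> sa_equiv A" using c sa_equivI by blast
  qed
qed

lemma class_eq_iff: "s \<in> sa_cauchy A \<Longrightarrow> t \<in> sa_cauchy A \<Longrightarrow>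
    sa_class A s = sa_class A t \<longleftrightarrow> (\<lambda>n. sa_dist A (s n) (t n)) \<longlonglongrightarrow> 0"
  unfolding sa_class_def using eq_equiv_class_iff[OF equiv_sa_equiv, of s t] by (auto simp: sa_equiv_def)

lemma class_mem: "s \<in> sa_cauchy A \<Longrightarrow> s \<in> sa_class A s"
  unfolding sa_class_def by (rule equiv_class_self[OF equiv_sa_equiv])

lemma mem_class: "t \<in> sa_class A s \<Longrightarrow> t \<in> sa_cauchy A \<and> s \<in> sa_cauchy A \<and> sa_class A t = sa_class A s"
  unfolding sa_class_def using equiv_class_eq[OF equiv_sa_equiv] by (auto simp: sa_equiv_def)

lemma completion_carrier: "sa_carrier (sa_completion A) = sa_class A ` sa_cauchy A"
  by (auto simp: sa_completion_def quotient_def sa_class_def)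

lemma cauchy_bounded:
  assumes s: "s \<in> sa_cauchy A"
  obtains B where "B > 0" "\<And>n. sa_norm A (s n) \<le> B"
proof -
  obtain N where N: "\<forall>m\<ge>N. \<forall>n\<ge>N. sa_dist A (s m) (s n) < 1"
    using cauchyD2[OF s, of 1] by auto
  define B where "B = Max (insert 1 ((\<lambda>n. sa_norm A (s n)) ` {..N})) + 1"
  have M: "1 \<le> Max (insert 1 ((\<lambda>n. sa_norm A (s n)) ` {..N}))"
    "\<And>n. n \<le> N \<Longrightarrow> sa_norm A (s n) \<le> Max (insert 1 ((\<lambda>n. sa_norm A (s n)) ` {..N}))"
    by (rule Max_ge; simp)+
  have "sa_norm A (s n) \<le> B" for n
  proof (cases "n \<le> N")
    case True
    then show ?thesis using M(2)[of n] by (simp add: B_def)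
  next
    case False
    then have "sa_dist A (s n) (s N) < 1" using N by simp
    then show ?thesis using norm_le[of "s n" "s N"] M(2)[of N] cauchyD[OF s] by (fastforce simp: B_def)
  qed
  moreover have "B > 0" using M(1) by (simp add: B_def)
  ultimately show thesis using that by blast
qed

text \<open>One criterion for all four operations; the unary ones use it with
  \<open>t = s\<close>.\<close>

lemma cauchy_dominated:
  assumes s: "s \<in> sa_cauchy A" and t: "t \<in> sa_cauchy A" and u: "\<And>n. u n \<in> sa_carrier A"
    and K: "K > 0" "\<And>m n. sa_dist A (u m) (u n) \<le> K * (sa_dist A (s m) (s n) + sa_dist A (t m) (t n))"
  shows "u \<in> sa_cauchy A"
proof (rule cauchyI[OF u])
  fix \<epsilon> :: real assume "\<epsilon> > 0"
  then have e: "\<epsilon> / (2 * K) > 0" using K by simp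
  obtain M N where MN: "\<forall>m\<ge>M. \<forall>n\<ge>M. sa_dist A (s m) (s n) < \<epsilon> / (2 * K)"
      "\<forall>m\<ge>N. \<forall>n\<ge>N. sa_dist A (t m) (t n) < \<epsilon> / (2 * K)"
    using cauchyD2[OF s e] cauchyD2[OF t e] by blast
  have "sa_dist A (u m) (u n) < \<epsilon>" if "m \<ge> max M N" "n \<ge> max M N" for m n
  proof -
    have "sa_dist A (s m) (s n) + sa_dist A (t m) (t n) < \<epsilon> / (2 * K) + \<epsilon> / (2 * K)"
      using MN that by (intro add_strict_mono) auto
    then have "K * (sa_dist A (s m) (s n) + sa_dist A (t m) (t n)) < K * (\<epsilon> / (2 * K) + \<epsilon> / (2 * K))"
      by (rule mult_strict_left_mono[OF _ K(1)])
    also have "\<dots> = \<epsilon>" using K by (simp add: field_simps)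
    finally show ?thesis using K(2)[of m n] by simp
  qed
  then show "\<exists>N. \<forall>m\<ge>N. \<forall>n\<ge>N. sa_dist A (u m) (u n) < \<epsilon>" by blast
qed

lemma tendsto_dominated:
  assumes "(\<lambda>n. sa_dist A (s n) (s' n)) \<longlonglongrightarrow> 0" "(\<lambda>n. sa_dist A (t n) (t' n)) \<longlonglongrightarrow> 0"
    and "\<And>n. u n \<in> sa_carrier A" "\<And>n. u' n \<in> sa_carrier A"
    and "\<And>n. sa_dist A (u n) (u' n) \<le> K * (sa_dist A (s n) (s' n) + sa_dist A (t n) (t' n))"
  shows "(\<lambda>n. sa_dist A (u n) (u' n)) \<longlonglongrightarrow> 0"
proof -
  have "(\<lambda>n. K * (sa_dist A (s n) (s' n) + sa_dist A (t n) (t' n))) \<longlonglongrightarrow> 0"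
    using tendsto_mult_left[OF tendsto_add[OF assms(1,2)], of K] by simp
  then show ?thesis
    by (rule tendsto_sandwich[OF _ _ tendsto_const, rotated 2])
       (use assms(3-5) dist_nonneg in \<open>auto intro!: always_eventually\<close>)
qed

lemma mult_dominated:
  assumes "a \<in> sa_carrier A" "b \<in> sa_carrier A" "a' \<in> sa_carrier A" "b' \<in> sa_carrier A"
    and "sa_norm A a \<le> B" "sa_norm A b' \<le> B'" "B > 0" "B' > 0"
  shows "sa_dist A (sa_mult A a b) (sa_mult A a' b') \<le> (B + B') * (sa_dist A a a' + sa_dist A b b')"
proof -
  have "sa_norm A a * sa_dist A b b' \<le> B * sa_dist A b b'" "sa_dist A a a' * sa_norm A b' \<le> sa_dist A a a' * B'"
    using assms dist_nonneg by (auto intro: mult_right_mono mult_left_mono)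
  moreover have "0 \<le> B * sa_dist A a a'" "0 \<le> B' * sa_dist A b b'"
    using assms dist_nonneg by auto
  ultimately show ?thesis using dist_mult[OF assms(1-4)] by (simp add: algebra_simps)
qed

section \<open>Operations on classes of Cauchy sequences\<close>

lemma cauchy_add:
  assumes s: "s \<in> sa_cauchy A" and t: "t \<in> sa_cauchy A"
  shows "(\<lambda>n. sa_add A (s n) (t n)) \<in> sa_cauchy A"
  by (rule cauchy_dominated[OF s t, where K = 1])
     (use s t cauchyD add_closed dist_add in auto)

lemma cauchy_scale:
  assumes s: "s \<in> sa_cauchy A"
  shows "(\<lambda>n. sa_scale A c (s n)) \<in> sa_cauchy A"
\<comment> \<open>The summand 1 keeps the constant positive when \<open>c\<close> is 0.\<close>
proof (rule cauchy_dominated[OF s s, where K = "cmod c + 1"])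
  show "sa_dist A (sa_scale A c (s m)) (sa_scale A c (s n)) \<le>
      (cmod c + 1) * (sa_dist A (s m) (s n) + sa_dist A (s m) (s n))" for m n
    using dist_scale[of "s m" "s n" c] dist_nonneg[of "s m" "s n"]
      mult_nonneg_nonneg[of "cmod c" "sa_dist A (s m) (s n)"] cauchyD[OF s]
    by (auto simp: algebra_simps intro: order_trans)
qed (use s cauchyD scale_closed in \<open>auto simp: add_nonneg_pos\<close>)

lemma cauchy_star:
  assumes s: "s \<in> sa_cauchy A"
  shows "(\<lambda>n. sa_star A (s n)) \<in> sa_cauchy A"
proof (rule cauchy_dominated[OF s s, where K = 1])
  show "sa_dist A (sa_star A (s m)) (sa_star A (s n)) \<le> 1 * (sa_dist A (s m) (s n) + sa_dist A (s m) (s n))" for m n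
    using dist_star[of "s m" "s n"] dist_nonneg[of "s m" "s n"] cauchyD[OF s] by simp
qed (use s cauchyD star_closed in auto)

lemma cauchy_mult:
  assumes s: "s \<in> sa_cauchy A" and t: "t \<in> sa_cauchy A"
  shows "(\<lambda>n. sa_mult A (s n) (t n)) \<in> sa_cauchy A"
proof -
  obtain B B' where B: "B > 0" "\<And>n. sa_norm A (s n) \<le> B" "B' > 0" "\<And>n. sa_norm A (t n) \<le> B'"
    using cauchy_bounded[OF s] cauchy_bounded[OF t] by metis
  show ?thesis
    by (rule cauchy_dominated[OF s t, where K = "B + B'"])
       (use s t cauchyD mult_closed B in \<open>auto intro!: mult_dominated\<close>)
qed

lemma cauchy_const: "a \<in> sa_carrier A \<Longrightarrow> (\<lambda>n. a) \<in> sa_cauchy A"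
  by (rule cauchyI) (auto simp: dist_self)

text \<open>The operations of the completion are unions over all representatives; once every
  representative yields the same set, the union is that set.\<close>

lemma Union_class2:
  assumes s: "s \<in> sa_cauchy A" and t: "t \<in> sa_cauchy A"
    and eq: "\<And>s' t'. s' \<in> sa_cauchy A \<Longrightarrow> t' \<in> sa_cauchy A \<Longrightarrow> sa_class A s' = sa_class A s \<Longrightarrow>
      sa_class A t' = sa_class A t \<Longrightarrow> f s' t' = f s t"
  shows "(\<Union>s'\<in>sa_class A s. \<Union>t'\<in>sa_class A t. f s' t') = f s t"
proof -
  have "f s' t' = f s t" if "s' \<in> sa_class A s" "t' \<in> sa_class A t" for s' t'
    using eq mem_class[OF that(1)] mem_class[OF that(2)] by blast
  then show ?thesis using class_mem[OF s] class_mem[OF t] by blast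
qed

lemma completion_add:
  assumes s: "s \<in> sa_cauchy A" and t: "t \<in> sa_cauchy A"
  shows "sa_add (sa_completion A) (sa_class A s) (sa_class A t) = sa_class A (\<lambda>n. sa_add A (s n) (t n))"
proof -
  have "(\<Union>s'\<in>sa_class A s. \<Union>t'\<in>sa_class A t. sa_class A (\<lambda>n. sa_add A (s' n) (t' n))) =
      sa_class A (\<lambda>n. sa_add A (s n) (t n))"
  proof (rule Union_class2[OF s t])
    fix s' t' assume c: "s' \<in> sa_cauchy A" "t' \<in> sa_cauchy A"
      and e: "sa_class A s' = sa_class A s" "sa_class A t' = sa_class A t"
    show "sa_class A (\<lambda>n. sa_add A (s' n) (t' n)) = sa_class A (\<lambda>n. sa_add A (s n) (t n))"
      unfolding class_eq_iff[OF cauchy_add[OF c] cauchy_add[OF s t]]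
      by (rule tendsto_dominated[where K = 1, OF e[unfolded class_eq_iff[OF c(1) s] class_eq_iff[OF c(2) t]]])
         (use c s t cauchyD add_closed dist_add in auto)
  qed
  then show ?thesis by (simp add: sa_completion_def)
qed

lemma completion_mult:
  assumes s: "s \<in> sa_cauchy A" and t: "t \<in> sa_cauchy A"
  shows "sa_mult (sa_completion A) (sa_class A s) (sa_class A t) = sa_class A (\<lambda>n. sa_mult A (s n) (t n))"
proof -
  have "(\<Union>s'\<in>sa_class A s. \<Union>t'\<in>sa_class A t. sa_class A (\<lambda>n. sa_mult A (s' n) (t' n))) =
      sa_class A (\<lambda>n. sa_mult A (s n) (t n))"
  proof (rule Union_class2[OF s t])
    fix s' t' assume c: "s' \<in> sa_cauchy A" "t' \<in> sa_cauchy A"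
      and e: "sa_class A s' = sa_class A s" "sa_class A t' = sa_class A t"
    \<comment> \<open>Bounds for the left factor of one product and the right factor of the other:
      the two norms that occur in \<open>dist_mult\<close>.\<close>
    obtain B B' where B: "B > 0" "\<And>n. sa_norm A (s' n) \<le> B" "B' > 0" "\<And>n. sa_norm A (t n) \<le> B'"
      using cauchy_bounded[OF c(1)] cauchy_bounded[OF t] by metis
    show "sa_class A (\<lambda>n. sa_mult A (s' n) (t' n)) = sa_class A (\<lambda>n. sa_mult A (s n) (t n))"
      unfolding class_eq_iff[OF cauchy_mult[OF c] cauchy_mult[OF s t]]
      by (rule tendsto_dominated[where K = "B + B'", OF e[unfolded class_eq_iff[OF c(1) s] class_eq_iff[OF c(2) t]]])
         (use c s t cauchyD mult_closed B in \<open>auto intro!: mult_dominated\<close>)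
  qed
  then show ?thesis by (simp add: sa_completion_def)
qed

lemma completion_scale:
  assumes s: "s \<in> sa_cauchy A"
  shows "sa_scale (sa_completion A) c (sa_class A s) = sa_class A (\<lambda>n. sa_scale A c (s n))"
proof -
  have "sa_class A (\<lambda>n. sa_scale A c (s' n)) = sa_class A (\<lambda>n. sa_scale A c (s n))" if "s' \<in> sa_class A s" for s'
  proof -
    have c: "s' \<in> sa_cauchy A" and e: "sa_class A s' = sa_class A s" using mem_class[OF that] by auto
    note l = e[unfolded class_eq_iff[OF c s]]
    have "sa_dist A (sa_scale A c (s' n)) (sa_scale A c (s n)) \<le>
        (cmod c) * (sa_dist A (s' n) (s n) + sa_dist A (s' n) (s n))" for n
      using dist_scale[of "s' n" "s n" c] dist_nonneg[of "s' n" "s n"]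
        mult_nonneg_nonneg[of "cmod c" "sa_dist A (s' n) (s n)"] cauchyD[OF s] cauchyD[OF c]
      by (auto simp: algebra_simps intro: order_trans)
    then show ?thesis
      unfolding class_eq_iff[OF cauchy_scale[OF c] cauchy_scale[OF s]]
      by (intro tendsto_dominated[OF l l]) (use c s cauchyD scale_closed in auto)
  qed
  then have "(\<Union>s'\<in>sa_class A s. sa_class A (\<lambda>n. sa_scale A c (s' n))) = sa_class A (\<lambda>n. sa_scale A c (s n))"
    using class_mem[OF s] by blast
  then show ?thesis by (simp add: sa_completion_def)
qed

lemma completion_star:
  assumes s: "s \<in> sa_cauchy A"
  shows "sa_star (sa_completion A) (sa_class A s) = sa_class A (\<lambda>n. sa_star A (s n))"
proof -
  have "sa_class A (\<lambda>n. sa_star A (s' n)) = sa_class A (\<lambda>n. sa_star A (s n))" if "s' \<in> sa_class A s" for s'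
  proof -
    have c: "s' \<in> sa_cauchy A" and e: "sa_class A s' = sa_class A s" using mem_class[OF that] by auto
    note l = e[unfolded class_eq_iff[OF c s]]
    have "sa_dist A (sa_star A (s' n)) (sa_star A (s n)) \<le>
        1 * (sa_dist A (s' n) (s n) + sa_dist A (s' n) (s n))" for n
      using dist_star[of "s' n" "s n"] dist_nonneg[of "s' n" "s n"] cauchyD[OF s] cauchyD[OF c] by simp
    then show ?thesis
      unfolding class_eq_iff[OF cauchy_star[OF c] cauchy_star[OF s]]
      by (intro tendsto_dominated[OF l l, where K = 1]) (use c s cauchyD star_closed in auto)
  qed
  then have "(\<Union>s'\<in>sa_class A s. sa_class A (\<lambda>n. sa_star A (s' n))) = sa_class A (\<lambda>n. sa_star A (s n))"
    using class_mem[OF s] by blast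
  then show ?thesis by (simp add: sa_completion_def)
qed

lemma close_to_cauchy:
  assumes s: "s \<in> sa_cauchy A" and t: "\<And>n. t n \<in> sa_carrier A"
    and l: "(\<lambda>n. sa_dist A (s n) (t n)) \<longlonglongrightarrow> 0"
  shows "t \<in> sa_cauchy A" "sa_class A t = sa_class A s"
proof -
  show c: "t \<in> sa_cauchy A"
  proof (rule cauchyI[OF t])
    fix \<epsilon> :: real assume "\<epsilon> > 0"
    then have e: "\<epsilon> / 3 > 0" by simp
    obtain M N where MN: "\<forall>m\<ge>M. \<forall>n\<ge>M. sa_dist A (s m) (s n) < \<epsilon> / 3"
        "\<forall>n\<ge>N. sa_dist A (s n) (t n) < \<epsilon> / 3"
      using cauchyD2[OF s e] order_tendstoD(2)[OF l e] by (auto simp: eventually_sequentially)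
    have "sa_dist A (t m) (t n) < \<epsilon>" if "m \<ge> max M N" "n \<ge> max M N" for m n
    proof -
      have "sa_dist A (s m) (s n) < \<epsilon> / 3" "sa_dist A (s m) (t m) < \<epsilon> / 3" "sa_dist A (s n) (t n) < \<epsilon> / 3"
        using MN that by auto
      then show ?thesis
        using dist_triangle[of "t m" "s m" "t n"] dist_triangle[of "s m" "s n" "t n"]
          dist_sym[of "s m" "t m"] t cauchyD[OF s] by fastforce
    qed
    then show "\<exists>N. \<forall>m\<ge>N. \<forall>n\<ge>N. sa_dist A (t m) (t n) < \<epsilon>" by blast
  qed
  then show "sa_class A t = sa_class A s" using class_eq_iff[OF s c] l by simp
qed

lemma cauchy_approximation:
  assumes D: "D \<subseteq> sa_carrier A"
    and dense: "\<And>a \<epsilon>. a \<in> sa_carrier A \<Longrightarrow> \<epsilon> > 0 \<Longrightarrow> \<exists>d\<in>D. sa_dist A a d < \<epsilon>"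
    and s: "s \<in> sa_cauchy A"
  obtains d where "d \<in> sa_cauchy A" "range d \<subseteq> D" "sa_class A d = sa_class A s"
proof -
  have "\<forall>n. \<exists>d. d \<in> D \<and> sa_dist A (s n) d < 1 / real (Suc n)"
    using dense[OF cauchyD[OF s]] by (metis of_nat_0_less_iff zero_less_Suc zero_less_divide_1_iff)
  then obtain d where d: "\<And>n. d n \<in> D" "\<And>n. sa_dist A (s n) (d n) < 1 / real (Suc n)"
    by metis
  have "(\<lambda>n. sa_dist A (s n) (d n)) \<longlonglongrightarrow> 0"
  proof (rule tendsto_sandwich[OF _ _ tendsto_const])
    show "(\<lambda>n. 1 / real (Suc n)) \<longlonglongrightarrow> 0" using LIMSEQ_Suc lim_1_over_n by fast
    show "\<forall>\<^sub>F n in sequentially. sa_dist A (s n) (d n) \<le> 1 / real (Suc n)"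
      using d(2) by (auto intro!: always_eventually less_imp_le)
    show "\<forall>\<^sub>F n in sequentially. 0 \<le> sa_dist A (s n) (d n)"
      using dist_nonneg[OF cauchyD[OF s] subsetD[OF D d(1)]] by (auto intro!: always_eventually)
  qed
  from close_to_cauchy[OF s _ this] show thesis using that d(1) D by blast
qed

end

section \<open>Extension of isometric isomorphisms by density\<close>

text \<open>Each class has a representative with values in \<open>D\<close>, and
  \<open>\<tau>\<close> is applied to it termwise. As distances are preserved, the resulting class
  depends only on the original one and determines it. The formula for \<open>\<Phi>\<close> is part
  of the conclusion so that it can be evaluated on constant sequences.\<close>

lemma isometric_star_isomorphism_extends:
  assumes A: "seminormed_star_algebra A" and B: "seminormed_star_algebra B"
    and D: "D \<subseteq> sa_carrier A" and E: "E \<subseteq> sa_carrier B"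
    and dense_D: "\<And>a \<epsilon>. a \<in> sa_carrier A \<Longrightarrow> \<epsilon> > 0 \<Longrightarrow> \<exists>d\<in>D. sa_dist A a d < \<epsilon>"
    and dense_E: "\<And>b \<epsilon>. b \<in> sa_carrier B \<Longrightarrow> \<epsilon> > 0 \<Longrightarrow> \<exists>e\<in>E. sa_dist B b e < \<epsilon>"
    and closed: "\<And>a b. a \<in> D \<Longrightarrow> b \<in> D \<Longrightarrow> sa_add A a b \<in> D \<and> sa_mult A a b \<in> D"
      "\<And>a c. a \<in> D \<Longrightarrow> sa_scale A c a \<in> D" "\<And>a. a \<in> D \<Longrightarrow> sa_star A a \<in> D"
    and image: "\<tau> ` D = E"
    and hom: "\<And>a b. a \<in> D \<Longrightarrow> b \<in> D \<Longrightarrow> \<tau> (sa_add A a b) = sa_add B (\<tau> a) (\<tau> b)"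
      "\<And>a b. a \<in> D \<Longrightarrow> b \<in> D \<Longrightarrow> \<tau> (sa_mult A a b) = sa_mult B (\<tau> a) (\<tau> b)"
      "\<And>a c. a \<in> D \<Longrightarrow> \<tau> (sa_scale A c a) = sa_scale B c (\<tau> a)"
      "\<And>a. a \<in> D \<Longrightarrow> \<tau> (sa_star A a) = sa_star B (\<tau> a)"
    and isometric: "\<And>a b. a \<in> D \<Longrightarrow> b \<in> D \<Longrightarrow> sa_dist B (\<tau> a) (\<tau> b) = sa_dist A a b"
  shows "\<exists>\<Phi>. star_isomorphism (sa_completion A) (sa_completion B) \<Phi> \<and>
    (\<forall>d\<in>sa_cauchy A. range d \<subseteq> D \<longrightarrow> \<Phi> (sa_class A d) = sa_class B (\<lambda>n. \<tau> (d n)))"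
proof -
  interpret A: seminormed_star_algebra A by fact
  interpret B: seminormed_star_algebra B by fact
  have cauchy: "(\<lambda>n. \<tau> (d n)) \<in> sa_cauchy B" if "d \<in> sa_cauchy A" "range d \<subseteq> D" for d
  proof (rule B.cauchyI)
    show "\<tau> (d n) \<in> sa_carrier B" for n using that(2) image E by auto
    have "sa_dist B (\<tau> (d m)) (\<tau> (d n)) = sa_dist A (d m) (d n)" for m n
      using that(2) by (intro isometric) auto
    then show "\<exists>N. \<forall>m\<ge>N. \<forall>n\<ge>N. sa_dist B (\<tau> (d m)) (\<tau> (d n)) < \<epsilon>" if "\<epsilon> > 0" for \<epsilon>
      using A.cauchyD2[OF \<open>d \<in> sa_cauchy A\<close> that] by simp
  qed
  have class_iff: "sa_class B (\<lambda>n. \<tau> (d n)) = sa_class B (\<lambda>n. \<tau> (d' n)) \<longleftrightarrow> sa_class A d = sa_class A d'"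
    if "d \<in> sa_cauchy A" "range d \<subseteq> D" "d' \<in> sa_cauchy A" "range d' \<subseteq> D" for d d'
  proof -
    have "sa_dist B (\<tau> (d n)) (\<tau> (d' n)) = sa_dist A (d n) (d' n)" for n
      using that by (intro isometric) auto
    then show ?thesis
      using A.class_eq_iff[OF that(1,3)] B.class_eq_iff[OF cauchy cauchy, OF that] by simp
  qed
  \<comment> \<open>A union of classes that all coincide, as in the definition of the operations of
    the completion.\<close>
  define \<Phi> where "\<Phi> S = (\<Union>d\<in>{d \<in> S. range d \<subseteq> D}. sa_class B (\<lambda>n. \<tau> (d n)))" for S
  have \<Phi>: "\<Phi> (sa_class A d) = sa_class B (\<lambda>n. \<tau> (d n))" if d: "d \<in> sa_cauchy A" "range d \<subseteq> D" for d
  proof -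
    have "sa_class B (\<lambda>n. \<tau> (d' n)) = sa_class B (\<lambda>n. \<tau> (d n))" if "d' \<in> sa_class A d" "range d' \<subseteq> D" for d'
      using class_iff that d A.mem_class[OF that(1)] by blast
    then show ?thesis unfolding \<Phi>_def using A.class_mem[OF d(1)] d(2) by blast
  qed
  have rep: "\<exists>d. d \<in> sa_cauchy A \<and> range d \<subseteq> D \<and> S = sa_class A d" if "S \<in> sa_carrier (sa_completion A)" for S
    using that A.cauchy_approximation[OF D dense_D] unfolding A.completion_carrier by (metis imageE)
  have "bij_betw \<Phi> (sa_carrier (sa_completion A)) (sa_carrier (sa_completion B))"
    unfolding bij_betw_def
  proof
    show "inj_on \<Phi> (sa_carrier (sa_completion A))"
    proof (rule inj_onI)
      fix S T assume "S \<in> sa_carrier (sa_completion A)" "T \<in> sa_carrier (sa_completion A)" "\<Phi> S = \<Phi> T"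
      then show "S = T" using rep[of S] rep[of T] \<Phi> class_iff by metis
    qed
    show "\<Phi> ` sa_carrier (sa_completion A) = sa_carrier (sa_completion B)"
    proof (intro equalityI subsetI)
      fix T assume "T \<in> \<Phi> ` sa_carrier (sa_completion A)"
      then show "T \<in> sa_carrier (sa_completion B)"
        using rep \<Phi> cauchy unfolding B.completion_carrier by blast
    next
      fix T assume "T \<in> sa_carrier (sa_completion B)"
      then obtain e where e: "e \<in> sa_cauchy B" "range e \<subseteq> E" "T = sa_class B e"
        using B.cauchy_approximation[OF E dense_E] unfolding B.completion_carrier by (metis imageE)
      then have "\<forall>n. \<exists>d\<in>D. e n = \<tau> d" using image by blast
      then obtain d where d: "\<And>n. d n \<in> D" "\<And>n. e n = \<tau> (d n)" by metis
      have "d \<in> sa_cauchy A"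
        using d D e(1) isometric by (auto simp: sa_cauchy_def)
      moreover have "(\<lambda>n. \<tau> (d n)) = e" "range d \<subseteq> D" using d by auto
      ultimately have "T = \<Phi> (sa_class A d)" "sa_class A d \<in> sa_carrier (sa_completion A)"
        using \<Phi>[of d] e(3) by (auto simp: A.completion_carrier)
      then show "T \<in> \<Phi> ` sa_carrier (sa_completion A)" by blast
    qed
  qed
  moreover have "\<Phi> (sa_add (sa_completion A) S T) = sa_add (sa_completion B) (\<Phi> S) (\<Phi> T) \<and>
      \<Phi> (sa_mult (sa_completion A) S T) = sa_mult (sa_completion B) (\<Phi> S) (\<Phi> T)"
    if S: "S \<in> sa_carrier (sa_completion A)" and T: "T \<in> sa_carrier (sa_completion A)" for S T
  proof -
    obtain s where s: "s \<in> sa_cauchy A" "range s \<subseteq> D" "S = sa_class A s" using rep[OF S] by blast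
    obtain t where t: "t \<in> sa_cauchy A" "range t \<subseteq> D" "T = sa_class A t" using rep[OF T] by blast
    have st: "s n \<in> D" "t n \<in> D" for n using s(2) t(2) by auto
    have r: "range (\<lambda>n. sa_add A (s n) (t n)) \<subseteq> D" "range (\<lambda>n. sa_mult A (s n) (t n)) \<subseteq> D"
      using closed(1)[OF st] by auto
    show ?thesis
      unfolding s(3) t(3) A.completion_add[OF s(1) t(1)] A.completion_mult[OF s(1) t(1)]
        \<Phi>[OF A.cauchy_add[OF s(1) t(1)] r(1)] \<Phi>[OF A.cauchy_mult[OF s(1) t(1)] r(2)] \<Phi>[OF s(1,2)] \<Phi>[OF t(1,2)]
        B.completion_add[OF cauchy[OF s(1,2)] cauchy[OF t(1,2)]]
        B.completion_mult[OF cauchy[OF s(1,2)] cauchy[OF t(1,2)]]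
      by (simp add: hom st)
  qed
  moreover have "\<Phi> (sa_scale (sa_completion A) c S) = sa_scale (sa_completion B) c (\<Phi> S)"
      "\<Phi> (sa_star (sa_completion A) S) = sa_star (sa_completion B) (\<Phi> S)"
    if S: "S \<in> sa_carrier (sa_completion A)" for S c
  proof -
    obtain s where s: "s \<in> sa_cauchy A" "range s \<subseteq> D" "S = sa_class A s" using rep[OF S] by blast
    have sD: "s n \<in> D" for n using s(2) by auto
    have r: "range (\<lambda>n. sa_scale A c (s n)) \<subseteq> D" "range (\<lambda>n. sa_star A (s n)) \<subseteq> D"
      using closed(2,3)[OF sD] by auto
    show "\<Phi> (sa_scale (sa_completion A) c S) = sa_scale (sa_completion B) c (\<Phi> S)"
      unfolding s(3) A.completion_scale[OF s(1)] \<Phi>[OF A.cauchy_scale[OF s(1)] r(1)] \<Phi>[OF s(1,2)]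
        B.completion_scale[OF cauchy[OF s(1,2)]] by (simp add: hom sD)
    show "\<Phi> (sa_star (sa_completion A) S) = sa_star (sa_completion B) (\<Phi> S)"
      unfolding s(3) A.completion_star[OF s(1)] \<Phi>[OF A.cauchy_star[OF s(1)] r(2)] \<Phi>[OF s(1,2)]
        B.completion_star[OF cauchy[OF s(1,2)]] by (simp add: hom sD)
  qed
  ultimately have "star_isomorphism (sa_completion A) (sa_completion B) \<Phi>"
    unfolding star_isomorphism_def by blast
  then show ?thesis using \<Phi> by blast
qed

section \<open>The reduced crossed product\<close>

lemma alg_simps [simp]:
  "sa_carrier (algebraic_crossed_product P) = cp_carrier P"
  "sa_add (algebraic_crossed_product P) a b = (\<lambda>g x. a g x + b g x)"
  "sa_scale (algebraic_crossed_product P) c a = (\<lambda>g x. c * a g x)"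
  "sa_mult (algebraic_crossed_product P) = cp_mult P"
  "sa_star (algebraic_crossed_product P) = cp_star P"
  "sa_norm (algebraic_crossed_product P) = cp_norm P"
  by (simp_all add: algebraic_crossed_product_def)

lemma alg_dist: "sa_dist (algebraic_crossed_product P) a b = cp_norm P (\<lambda>g x. a g x - b g x)"
  by (simp add: sa_dist_def)

context psys
begin

lemma cp_diff_closed:
  assumes "a \<in> cp_carrier P" "b \<in> cp_carrier P"
  shows "(\<lambda>g x. a g x - b g x) \<in> cp_carrier P"
  using cp_add_closed[OF assms(1) cp_scale_closed[OF assms(2), of "-1"]] by simp

lemma cp_mult_add_left:
  assumes "a \<in> cp_carrier P" "a' \<in> cp_carrier P" "b \<in> cp_carrier P"
  shows "cp_mult P (\<lambda>g x. a g x + a' g x) b = (\<lambda>g x. cp_mult P a b g x + cp_mult P a' b g x)"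
proof (intro ext)
  fix k x
  have S: "finite (cp_supp a \<union> cp_supp a')" "cp_supp a \<union> cp_supp a' \<subseteq> carrier (ps_group P)"
    "cp_supp (\<lambda>g x. a g x + a' g x) \<subseteq> cp_supp a \<union> cp_supp a'"
    using cp_carrierD assms by (auto simp: cp_supp_def)
  show "cp_mult P (\<lambda>g x. a g x + a' g x) b k x = cp_mult P a b k x + cp_mult P a' b k x"
  proof (cases "k \<in> carrier (ps_group P)")
    case True
    have "cp_mult P a b k x = (\<Sum>g\<in>cp_supp a \<union> cp_supp a'. a g x * b (ps_mult P (ps_inv P g) k) (ps_act P (ps_inv P g) x))"
      "cp_mult P a' b k x = (\<Sum>g\<in>cp_supp a \<union> cp_supp a'. a' g x * b (ps_mult P (ps_inv P g) k) (ps_act P (ps_inv P g) x))"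
      by (rule cp_mult_eq; use assms True S in blast)+
    then show ?thesis
      by (simp add: cp_mult_eq[OF cp_add_closed[OF assms(1,2)] assms(3) True S] distrib_right sum.distrib)
  qed (use assms in \<open>simp add: cp_mult_off cp_add_closed\<close>)
qed

lemma cp_mult_add_right:
  assumes "a \<in> cp_carrier P" "b \<in> cp_carrier P" "b' \<in> cp_carrier P"
  shows "cp_mult P a (\<lambda>g x. b g x + b' g x) = (\<lambda>g x. cp_mult P a b g x + cp_mult P a b' g x)"
proof (intro ext)
  fix k x
  have S: "finite (cp_supp a)" "cp_supp a \<subseteq> carrier (ps_group P)" "cp_supp a \<subseteq> cp_supp a"
    using cp_carrierD assms by auto
  show "cp_mult P a (\<lambda>g x. b g x + b' g x) k x = cp_mult P a b k x + cp_mult P a b' k x"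
  proof (cases "k \<in> carrier (ps_group P)")
    case True
    then show ?thesis
      using assms by (simp add: cp_mult_eq[OF _ _ True S] cp_add_closed distrib_left sum.distrib)
  qed (use assms in \<open>simp add: cp_mult_off cp_add_closed\<close>)
qed

lemma cp_star_diff:
  assumes "a \<in> cp_carrier P" "b \<in> cp_carrier P"
  shows "cp_star P (\<lambda>g x. a g x - b g x) = (\<lambda>g x. cp_star P a g x - cp_star P b g x)"
proof (intro ext)
  fix k x
  show "cp_star P (\<lambda>g x. a g x - b g x) k x = cp_star P a k x - cp_star P b k x"
    using assms cp_diff_closed[OF assms]
    by (cases "k \<in> carrier (ps_group P)") (simp_all add: cp_star_eq cp_star_off ps_pull_def)
qed

lemma cp_norm_zero: "cp_norm P (\<lambda>g x. 0) = 0"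
proof -
  have c: "(\<lambda>g x. 0) \<in> cp_carrier P" by (rule cp_carrierI[of "{}"]) (auto simp: C0_zero)
  then have "cp_norm P (\<lambda>g x. 0) \<le> 0" using cp_norm_le_sum[OF c, of "\<lambda>_. 0"] by (simp add: cp_supp_def)
  then show ?thesis using cp_norm_nonneg[OF c] by simp
qed

lemma seminormed_algebraic_crossed_product: "seminormed_star_algebra (algebraic_crossed_product P)"
proof
  fix a b a' b' c and z :: complex
  let ?A = "algebraic_crossed_product P"
  assume "a \<in> sa_carrier ?A" "b \<in> sa_carrier ?A"
  then have a: "a \<in> cp_carrier P" and b: "b \<in> cp_carrier P" by auto
  note ab = cp_diff_closed[OF a b] and ba = cp_diff_closed[OF b a]
  show "sa_dist ?A a b = sa_dist ?A b a"
    using cp_norm_scale_le[OF ab, of "-1"] cp_norm_scale_le[OF ba, of "-1"] by (simp add: alg_dist)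
  show "sa_add ?A a b \<in> sa_carrier ?A" using a b by (simp add: cp_add_closed)
  show "sa_mult ?A a b \<in> sa_carrier ?A" using a b by (simp add: cp_mult_closed)
  show "sa_dist ?A (sa_scale ?A z a) (sa_scale ?A z b) \<le> cmod z * sa_dist ?A a b"
    using cp_norm_scale_le[OF ab, of z] by (simp add: alg_dist right_diff_distrib)
  show "sa_dist ?A (sa_star ?A a) (sa_star ?A b) \<le> sa_dist ?A a b"
    using cp_norm_star_le[OF ab] by (simp add: alg_dist cp_star_diff[OF a b])
  show "sa_norm ?A a \<le> sa_norm ?A b + sa_dist ?A a b"
    using cp_norm_add[OF b ab] by (simp add: alg_dist)
  show "sa_dist ?A a c \<le> sa_dist ?A a b + sa_dist ?A b c" if "c \<in> sa_carrier ?A"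
    using cp_norm_add[OF ab cp_diff_closed[OF b, of c]] that by (simp add: alg_dist)
  assume "a' \<in> sa_carrier ?A" "b' \<in> sa_carrier ?A"
  then have a': "a' \<in> cp_carrier P" and b': "b' \<in> cp_carrier P" by auto
  note aa' = cp_diff_closed[OF a a'] and bb' = cp_diff_closed[OF b b']
  show "sa_dist ?A (sa_add ?A a b) (sa_add ?A a' b') \<le> sa_dist ?A a a' + sa_dist ?A b b'"
    using cp_norm_add[OF aa' bb'] by (simp add: alg_dist algebra_simps)
  \<comment> \<open>Here and in the next step, \<open>ab - a'b'\<close> is split as
    \<open>a(b - b') + (a - a')b'\<close>.\<close>
  have 1: "cp_mult P a b = (\<lambda>g x. cp_mult P a (\<lambda>g x. b g x - b' g x) g x + cp_mult P a b' g x)"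
    using cp_mult_add_right[OF a bb' b'] by simp
  have 2: "cp_mult P a b' = (\<lambda>g x. cp_mult P (\<lambda>g x. a g x - a' g x) b' g x + cp_mult P a' b' g x)"
    using cp_mult_add_left[OF aa' a' b'] by simp
  have eq: "(\<lambda>g x. cp_mult P a b g x - cp_mult P a' b' g x) =
      (\<lambda>g x. cp_mult P a (\<lambda>g x. b g x - b' g x) g x + cp_mult P (\<lambda>g x. a g x - a' g x) b' g x)"
    unfolding 1 2 by (intro ext) simp
  show "sa_dist ?A (sa_mult ?A a b) (sa_mult ?A a' b') \<le>
      sa_norm ?A a * sa_dist ?A b b' + sa_dist ?A a a' * sa_norm ?A b'"
    using cp_norm_add[OF cp_mult_closed[OF a bb'] cp_mult_closed[OF aa' b']]
      cp_norm_mult[OF a bb'] cp_norm_mult[OF aa' b'] by (simp add: alg_dist eq)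
qed (auto simp: cp_scale_closed cp_star_closed alg_dist cp_norm_zero)

sublocale alg: seminormed_star_algebra "algebraic_crossed_product P"
  by (rule seminormed_algebraic_crossed_product)

section \<open>Coefficients of elements of the completion\<close>

text \<open>The coefficient functions of a limit of finite sums, read off a representing sequence.
  Infinitely many of them may be nonzero.\<close>

definition cp_lim :: "(nat \<Rightarrow> 'g \<Rightarrow> 'x \<Rightarrow> complex) \<Rightarrow> 'g \<Rightarrow> 'x \<Rightarrow> complex" where
  "cp_lim s g x = lim (\<lambda>n. s n g x)"

lemma cauchy_carrier: "s \<in> sa_cauchy (algebraic_crossed_product P) \<Longrightarrow> s n \<in> cp_carrier P"
  using alg.cauchyD by simp

lemma entry_dist:
  assumes "a \<in> cp_carrier P" "b \<in> cp_carrier P"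
  shows "cmod (a g x - b g x) \<le> sa_dist (algebraic_crossed_product P) a b"
  using cp_entry_le_norm[OF cp_diff_closed[OF assms]] by (simp add: alg_dist)

lemma cp_lim_tendsto:
  assumes s: "s \<in> sa_cauchy (algebraic_crossed_product P)"
  shows "(\<lambda>n. s n g x) \<longlonglongrightarrow> cp_lim s g x"
proof -
  have "Cauchy (\<lambda>n. s n g x)"
  proof (rule metric_CauchyI)
    fix \<epsilon> :: real assume "\<epsilon> > 0"
    then show "\<exists>N. \<forall>m\<ge>N. \<forall>n\<ge>N. dist (s m g x) (s n g x) < \<epsilon>"
      using alg.cauchyD2[OF s] entry_dist[OF cauchy_carrier[OF s] cauchy_carrier[OF s]]
      unfolding dist_norm by (meson le_less_trans)
  qed
  then show ?thesis
    unfolding cp_lim_def by (simp add: Cauchy_convergent convergent_LIMSEQ_iff[symmetric])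
qed

text \<open>The bound holds for all \<open>g\<close> and \<open>x\<close> at once, so a lower bound
  for \<open>s n g\<close> on an open set passes to the limit coefficient.\<close>

lemma cp_lim_uniform:
  assumes s: "s \<in> sa_cauchy (algebraic_crossed_product P)" and e: "\<epsilon> > 0"
  obtains N where "\<And>n g x. n \<ge> N \<Longrightarrow> cmod (s n g x - cp_lim s g x) \<le> \<epsilon>"
proof -
  obtain N where N: "\<forall>m\<ge>N. \<forall>n\<ge>N. sa_dist (algebraic_crossed_product P) (s m) (s n) < \<epsilon>"
    using alg.cauchyD2[OF s e] by blast
  have "cmod (s n g x - cp_lim s g x) \<le> \<epsilon>" if n: "n \<ge> N" for n g x
  proof (rule LIMSEQ_le_const2)
    show "(\<lambda>m. cmod (s n g x - s m g x)) \<longlonglongrightarrow> cmod (s n g x - cp_lim s g x)"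
      by (intro tendsto_intros cp_lim_tendsto[OF s])
    show "\<exists>M. \<forall>m\<ge>M. cmod (s n g x - s m g x) \<le> \<epsilon>"
      using N n entry_dist[OF cauchy_carrier[OF s] cauchy_carrier[OF s]] by (meson le_less_trans less_imp_le)
  qed
  then show thesis using that by blast
qed

lemma cp_lim_eqI:
  assumes s: "s \<in> sa_cauchy (algebraic_crossed_product P)" and t: "t \<in> sa_cauchy (algebraic_crossed_product P)"
    and eq: "sa_class (algebraic_crossed_product P) s = sa_class (algebraic_crossed_product P) t"
  shows "cp_lim s = cp_lim t"
proof (intro ext)
  fix g x
  have "(\<lambda>n. s n g x - t n g x) \<longlonglongrightarrow> 0"
  proof (rule Lim_null_comparison)
    show "(\<lambda>n. sa_dist (algebraic_crossed_product P) (s n) (t n)) \<longlonglongrightarrow> 0"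
      using eq alg.class_eq_iff[OF s t] by simp
    show "\<forall>\<^sub>F n in sequentially. norm (s n g x - t n g x) \<le> sa_dist (algebraic_crossed_product P) (s n) (t n)"
      using entry_dist[OF cauchy_carrier[OF s] cauchy_carrier[OF t]] by simp
  qed
  moreover have "(\<lambda>n. s n g x - t n g x) \<longlonglongrightarrow> cp_lim s g x - cp_lim t g x"
    by (intro tendsto_diff cp_lim_tendsto s t)
  ultimately show "cp_lim s g x = cp_lim t g x" using LIMSEQ_unique by fastforce
qed

lemma cp_lim_const: "cp_lim (\<lambda>n. a) = a"
  by (intro ext) (simp add: cp_lim_def limI)

section \<open>Products with single terms, and the embedded function algebra\<close>

lemma cp_mult_delta:
  assumes g: "g \<in> carrier (ps_group P)" and f: "f \<in> C0 (subtopology (ps_space P) (ps_dom P g))"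
    and h: "h \<in> carrier (ps_group P)" and f': "f' \<in> C0 (subtopology (ps_space P) (ps_dom P h))"
  shows "cp_mult P (cp_delta f g) (cp_delta f' h) =
    cp_delta (\<lambda>x. f x * f' (ps_act P (ps_inv P g) x)) (ps_mult P g h)"
proof (intro ext)
  fix k x
  note c = cp_delta_closed[OF g f] cp_delta_closed[OF h f']
  show "cp_mult P (cp_delta f g) (cp_delta f' h) k x =
    cp_delta (\<lambda>x. f x * f' (ps_act P (ps_inv P g) x)) (ps_mult P g h) k x"
  proof (cases "k \<in> carrier (ps_group P)")
    case True
    have "cp_mult P (cp_delta f g) (cp_delta f' h) k x = (\<Sum>g'\<in>{g}. cp_delta f g g' x *
        cp_delta f' h (ps_mult P (ps_inv P g') k) (ps_act P (ps_inv P g') x))"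
      by (rule cp_mult_eq[OF c True]) (use g in \<open>auto simp: cp_supp_def cp_delta_def\<close>)
    moreover have "ps_mult P (ps_inv P g) k = h \<longleftrightarrow> k = ps_mult P g h"
      using g h True by (auto simp flip: grp.m_assoc)
    ultimately show ?thesis by (simp add: cp_delta_def)
  next
    case False
    then show ?thesis using cp_mult_off[OF c] g h by (auto simp: cp_delta_def)
  qed
qed

lemma cp_star_delta:
  assumes g: "g \<in> carrier (ps_group P)" and f: "f \<in> C0 (subtopology (ps_space P) (ps_dom P g))"
  shows "cp_star P (cp_delta f g) = cp_delta (ps_pull P (ps_inv P g) (\<lambda>y. cnj (f y))) (ps_inv P g)"
proof (intro ext)
  fix k x
  note c = cp_delta_closed[OF g f]
  show "cp_star P (cp_delta f g) k x = cp_delta (ps_pull P (ps_inv P g) (\<lambda>y. cnj (f y))) (ps_inv P g) k x"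
  proof (cases "k \<in> carrier (ps_group P)")
    case True
    then have "ps_inv P k = g \<longleftrightarrow> k = ps_inv P g" using g by auto
    then show ?thesis using cp_star_eq[OF c True] True g by (auto simp: cp_delta_def ps_pull_def)
  next
    case False
    then show ?thesis using cp_star_off[OF c] g by (auto simp: cp_delta_def)
  qed
qed

lemma C0_one: "f \<in> C0 (ps_space P) \<longleftrightarrow> f \<in> C0 (subtopology (ps_space P) (ps_dom P (ps_one P)))"
  by (simp add: dom_one subtopology_topspace)

lemma cp_delta_one_closed: "f \<in> C0 (ps_space P) \<Longrightarrow> cp_delta f (ps_one P) \<in> cp_carrier P"
  using cp_delta_closed[OF grp.one_closed] C0_one by simp

text \<open>From the right a function is evaluated at the source \<open>g^{-1}.x\<close>, from the
  left at the range \<open>x\<close>. Comparing the two products shows which points an element can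
  connect.\<close>

lemma cp_mult_delta_one_right:
  assumes a: "a \<in> cp_carrier P" and f: "f \<in> C0 (ps_space P)" and g: "g \<in> carrier (ps_group P)"
  shows "cp_mult P a (cp_delta f (ps_one P)) g x = a g x * f (ps_act P (ps_inv P g) x)"
proof -
  have S: "finite (insert g (cp_supp a))" "insert g (cp_supp a) \<subseteq> carrier (ps_group P)" "cp_supp a \<subseteq> insert g (cp_supp a)"
    using cp_carrierD[OF a] g by auto
  have "cp_mult P a (cp_delta f (ps_one P)) g x = (\<Sum>h\<in>insert g (cp_supp a). a h x *
      cp_delta f (ps_one P) (ps_mult P (ps_inv P h) g) (ps_act P (ps_inv P h) x))"
    by (rule cp_mult_eq[OF a cp_delta_one_closed[OF f] g S])
  also have "\<dots> = (\<Sum>h\<in>{g}. a h x * f (ps_act P (ps_inv P h) x))"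
  proof (rule sum.mono_neutral_cong_right)
    show "\<forall>h\<in>insert g (cp_supp a) - {g}. a h x *
        cp_delta f (ps_one P) (ps_mult P (ps_inv P h) g) (ps_act P (ps_inv P h) x) = 0"
    proof
      fix h assume h: "h \<in> insert g (cp_supp a) - {g}"
      then have "h \<in> carrier (ps_group P)" "h \<noteq> g" using S by auto
      then have "ps_mult P (ps_inv P h) g \<noteq> ps_one P"
        using g by (metis grp.inv_closed grp.inv_equality grp.inv_inv)
      then show "a h x * cp_delta f (ps_one P) (ps_mult P (ps_inv P h) g) (ps_act P (ps_inv P h) x) = 0"
        by (simp add: cp_delta_def)
    qed
  qed (use g S in \<open>auto simp: cp_delta_def\<close>)
  finally show ?thesis by simp
qed

lemma cp_mult_delta_one_left:
  assumes a: "a \<in> cp_carrier P" and f: "f \<in> C0 (ps_space P)"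
  shows "cp_mult P (cp_delta f (ps_one P)) a g x = f x * a g x"
proof (cases "g \<in> carrier (ps_group P)")
  case True
  have "cp_mult P (cp_delta f (ps_one P)) a g x = (\<Sum>h\<in>{ps_one P}. cp_delta f (ps_one P) h x *
      a (ps_mult P (ps_inv P h) g) (ps_act P (ps_inv P h) x))"
    by (rule cp_mult_eq[OF cp_delta_one_closed[OF f] a True]) (auto simp: cp_supp_def cp_delta_def)
  also have "\<dots> = f x * a g x"
    using True act_one[of x] f by (cases "x \<in> topspace (ps_space P)") (auto simp: cp_delta_def C0_def)
  finally show ?thesis .
next
  case False
  then show ?thesis using cp_mult_off[OF cp_delta_one_closed[OF f] a] cp_off[OF a] by simp
qed

text \<open>The diagonal entry of \<open>a^* a\<close> at the identity is the squared norm of the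
  identity column of \<open>a\<close>.\<close>

lemma cp_star_mult_one:
  assumes a: "a \<in> cp_carrier P" and x: "x \<in> topspace (ps_space P)"
  obtains F where "finite F" "F \<subseteq> ps_at P x"
    "cp_mult P (cp_star P a) a (ps_one P) x = complex_of_real ((L2_set (\<lambda>h. cmod (a h (ps_act P h x))) F)\<^sup>2)"
proof -
  define F where "F = ps_inv P ` cp_supp (cp_star P a) \<inter> ps_at P x"
  have F: "finite F" "F \<subseteq> ps_at P x"
    using cp_carrierD[OF cp_star_closed[OF a]] by (auto simp: F_def)
  have e: "ps_one P \<in> ps_at P x" by (rule one_at[OF x])
  have "cp_mult P (cp_star P a) a (ps_mult P (ps_one P) (ps_inv P (ps_one P))) (ps_act P (ps_one P) x) =
    (\<Sum>l\<in>F. cp_star P a (ps_mult P (ps_one P) (ps_inv P l)) (ps_act P (ps_one P) x) *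
      a (ps_mult P l (ps_inv P (ps_one P))) (ps_act P l x))"
  proof (rule cp_kernel_mult[OF cp_star_closed[OF a] a e e F])
    fix g assume g: "g \<in> cp_supp (cp_star P a)" "ps_mult P (ps_inv P g) (ps_one P) \<in> ps_at P x"
    then have "g \<in> carrier (ps_group P)" using cp_carrierD[OF cp_star_closed[OF a]] by auto
    then show "ps_mult P (ps_inv P g) (ps_one P) \<in> F" using g by (simp add: F_def)
  qed
  also have "\<dots> = (\<Sum>l\<in>F. cnj (a l (ps_act P l x)) * a l (ps_act P l x))"
  proof (rule sum.cong[OF refl])
    fix l assume "l \<in> F"
    then have l: "l \<in> ps_at P x" "l \<in> carrier (ps_group P)" using F(2) by auto
    show "cp_star P a (ps_mult P (ps_one P) (ps_inv P l)) (ps_act P (ps_one P) x) *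
      a (ps_mult P l (ps_inv P (ps_one P))) (ps_act P l x) = cnj (a l (ps_act P l x)) * a l (ps_act P l x)"
      unfolding cp_kernel_star[OF a e l(1)] using l by simp
  qed
  also have "\<dots> = complex_of_real ((L2_set (\<lambda>h. cmod (a h (ps_act P h x))) F)\<^sup>2)"
    by (simp add: L2_set_def sum_nonneg mult.commute complex_norm_square del: of_real_power)
  finally show thesis using that F act_one[OF x] by simp
qed

lemma embed_eq: "sa_embed (algebraic_crossed_product P) a = sa_class (algebraic_crossed_product P) (\<lambda>n. a)"
  by (simp add: sa_embed_def)

text \<open>Coefficients depend on the class only, and those of a constant sequence are the element
  itself.\<close>

lemma embed_inj:
  assumes "a \<in> cp_carrier P" "b \<in> cp_carrier P"
    "sa_embed (algebraic_crossed_product P) a = sa_embed (algebraic_crossed_product P) b"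
  shows "a = b"
  using cp_lim_eqI[of "\<lambda>n. a" "\<lambda>n. b"] assms alg.cauchy_const by (simp add: embed_eq cp_lim_const)

definition C0_embed :: "('x \<Rightarrow> complex) \<Rightarrow> (nat \<Rightarrow> 'g \<Rightarrow> 'x \<Rightarrow> complex) set" where
  "C0_embed f = sa_embed (algebraic_crossed_product P) (cp_delta f (ps_one P))"

lemma C0_embed_inj:
  assumes "f \<in> C0 (ps_space P)" "f' \<in> C0 (ps_space P)" "C0_embed f = C0_embed f'"
  shows "f = f'"
proof -
  have "cp_delta f (ps_one P) = cp_delta f' (ps_one P)"
    using embed_inj cp_delta_one_closed assms by (simp add: C0_embed_def)
  then have "cp_delta f (ps_one P) (ps_one P) = cp_delta f' (ps_one P) (ps_one P)" by simp
  then show ?thesis by (simp add: cp_delta_def)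
qed

lemma C0_subalgebra_eq: "C0_subalgebra P = C0_embed ` C0 (ps_space P)"
  by (simp add: C0_subalgebra_def C0_embed_def)

lemma C0_embed_closed: "f \<in> C0 (ps_space P) \<Longrightarrow> C0_embed f \<in> sa_carrier (reduced_crossed_product P)"
  unfolding C0_embed_def embed_eq reduced_crossed_product_def alg.completion_carrier
  using alg.cauchy_const cp_delta_one_closed by simp

lemma C0_space_closed:
  assumes "f \<in> C0 (ps_space P)" "f' \<in> C0 (ps_space P)"
  shows "(\<lambda>x. f x + f' x) \<in> C0 (ps_space P)" "(\<lambda>x. f x * f' x) \<in> C0 (ps_space P)"
    "(\<lambda>x. c * f x) \<in> C0 (ps_space P)" "(\<lambda>x. cnj (f x)) \<in> C0 (ps_space P)"
  using C0_add[OF Hausdorff openin_topspace] C0_mult[OF Hausdorff openin_topspace openin_topspace]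
    C0_scale[OF Hausdorff openin_topspace] C0_cnj[OF Hausdorff openin_topspace] assms
  by (simp_all add: subtopology_topspace)

lemma C0_embed_hom:
  assumes f: "f \<in> C0 (ps_space P)" and f': "f' \<in> C0 (ps_space P)"
  shows "C0_embed (\<lambda>x. f x + f' x) = sa_add (reduced_crossed_product P) (C0_embed f) (C0_embed f')"
    "C0_embed (\<lambda>x. f x * f' x) = sa_mult (reduced_crossed_product P) (C0_embed f) (C0_embed f')"
    "C0_embed (\<lambda>x. c * f x) = sa_scale (reduced_crossed_product P) c (C0_embed f)"
    "C0_embed (\<lambda>x. cnj (f x)) = sa_star (reduced_crossed_product P) (C0_embed f)"
proof -
  note c = alg.cauchy_const[of "cp_delta f (ps_one P)"] alg.cauchy_const[of "cp_delta f' (ps_one P)"]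
  note d = cp_delta_one_closed[OF f] cp_delta_one_closed[OF f']
  have 1: "(\<lambda>g x. cp_delta f (ps_one P) g x + cp_delta f' (ps_one P) g x) = cp_delta (\<lambda>x. f x + f' x) (ps_one P)"
    "(\<lambda>g x. c * cp_delta f (ps_one P) g x) = cp_delta (\<lambda>x. c * f x) (ps_one P)"
    by (auto simp: cp_delta_def)
  have 2: "cp_mult P (cp_delta f (ps_one P)) (cp_delta f' (ps_one P)) = cp_delta (\<lambda>x. f x * f' x) (ps_one P)"
    by (intro ext) (simp add: cp_mult_delta_one_left[OF d(2) f] cp_delta_def)
  have "ps_pull P (ps_one P) (\<lambda>y. cnj (f y)) = (\<lambda>y. cnj (f y))"
    using f act_one by (auto simp: ps_pull_def dom_one C0_def)
  then have 3: "cp_star P (cp_delta f (ps_one P)) = cp_delta (\<lambda>x. cnj (f x)) (ps_one P)"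
    using cp_star_delta[OF grp.one_closed] f C0_one by simp
  show "C0_embed (\<lambda>x. f x + f' x) = sa_add (reduced_crossed_product P) (C0_embed f) (C0_embed f')"
    "C0_embed (\<lambda>x. f x * f' x) = sa_mult (reduced_crossed_product P) (C0_embed f) (C0_embed f')"
    "C0_embed (\<lambda>x. c * f x) = sa_scale (reduced_crossed_product P) c (C0_embed f)"
    "C0_embed (\<lambda>x. cnj (f x)) = sa_star (reduced_crossed_product P) (C0_embed f)"
    unfolding C0_embed_def embed_eq reduced_crossed_product_def
    using c d by (simp_all add: alg.completion_add alg.completion_mult alg.completion_scale alg.completion_star 1 2 3)
qed

section \<open>The topology of the transformation groupoid, and germs\<close>

lemma openin_transformation_space:
  "openin (transformation_space P) S \<longleftrightarrow> (\<forall>g x. (g, x) \<in> S \<longrightarrow> g \<in> ps_at P x \<and>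
     (\<exists>W. openin (ps_space P) W \<and> x \<in> W \<and> {g} \<times> W \<subseteq> S))"
proof -
  let ?p = "prod_topology (discrete_topology (carrier (ps_group P))) (ps_space P)"
  let ?A = "{(g, x). g \<in> carrier (ps_group P) \<and> x \<in> ps_dom P (ps_inv P g)}"
  have A: "openin ?p ?A"
    unfolding openin_prod_topology_alt
  proof clarify
    fix g x assume "g \<in> carrier (ps_group P)" "x \<in> ps_dom P (ps_inv P g)"
    then show "\<exists>U V. openin (discrete_topology (carrier (ps_group P))) U \<and> openin (ps_space P) V \<and>
        g \<in> U \<and> x \<in> V \<and> U \<times> V \<subseteq> ?A"
      using open_dom[of "ps_inv P g"] by (intro exI[of _ "{g}"] exI[of _ "ps_dom P (ps_inv P g)"]) auto
  qed
  have "openin (transformation_space P) S \<longleftrightarrow> openin ?p S \<and> S \<subseteq> ?A"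
    unfolding transformation_space_def by (rule openin_open_subtopology[OF A])
  also have "\<dots> \<longleftrightarrow> (\<forall>g x. (g, x) \<in> S \<longrightarrow> g \<in> ps_at P x \<and>
     (\<exists>W. openin (ps_space P) W \<and> x \<in> W \<and> {g} \<times> W \<subseteq> S))" (is "?l \<longleftrightarrow> ?r")
  proof
    assume l: ?l
    show ?r
    proof clarify
      fix g x assume gx: "(g, x) \<in> S"
      then obtain U V where "g \<in> U" "x \<in> V" "openin (ps_space P) V" "U \<times> V \<subseteq> S"
        using l unfolding openin_prod_topology_alt by metis
      then show "g \<in> ps_at P x \<and> (\<exists>W. openin (ps_space P) W \<and> x \<in> W \<and> {g} \<times> W \<subseteq> S)"
        using l gx by (auto simp: at_iff intro!: exI[of _ V])
    qed
  next
    assume r: ?r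
    then have SA: "S \<subseteq> ?A" by (auto simp: at_iff)
    have "openin ?p S"
      unfolding openin_prod_topology_alt
    proof clarify
      fix g x assume gx: "(g, x) \<in> S"
      then obtain W where "openin (ps_space P) W" "x \<in> W" "{g} \<times> W \<subseteq> S" using r by blast
      then show "\<exists>U V. openin (discrete_topology (carrier (ps_group P))) U \<and> openin (ps_space P) V \<and>
          g \<in> U \<and> x \<in> V \<and> U \<times> V \<subseteq> S"
        using gx SA by (intro exI[of _ "{g}"] exI[of _ W]) auto
    qed
    then show ?l using SA by blast
  qed
  finally show ?thesis .
qed

lemma topspace_transformation_space: "(g, x) \<in> topspace (transformation_space P) \<longleftrightarrow> g \<in> ps_at P x"
  using at_space[of g x] by (auto simp: transformation_space_def at_iff)

text \<open>Both the group and the target are discrete, so continuity means being locally constant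
  in the point for each fixed group element.\<close>

lemma continuous_map_transformation_space:
  "continuous_map (transformation_space P) (discrete_topology H) a \<longleftrightarrow>
    (\<forall>g x. g \<in> ps_at P x \<longrightarrow> a (g, x) \<in> H \<and>
      (\<exists>W. openin (ps_space P) W \<and> x \<in> W \<and> (\<forall>x'\<in>W. g \<in> ps_at P x' \<and> a (g, x') = a (g, x))))"
  (is "?l \<longleftrightarrow> ?r")
proof
  assume l: ?l
  show ?r
  proof (intro allI impI)
    fix g x assume g: "g \<in> ps_at P x"
    have "a ` topspace (transformation_space P) \<subseteq> H"
      using continuous_map_image_subset_topspace[OF l] by simp
    moreover have gx: "(g, x) \<in> topspace (transformation_space P)" by (simp add: g topspace_transformation_space)
    ultimately have aH: "a (g, x) \<in> H" by (metis image_subset_iff)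
    define S where "S = {p \<in> topspace (transformation_space P). a p \<in> {a (g, x)}}"
    have "openin (transformation_space P) S"
      unfolding S_def by (rule openin_continuous_map_preimage[OF l]) (simp add: aH)
    moreover have "(g, x) \<in> S" by (simp add: S_def gx)
    ultimately have "\<exists>W. openin (ps_space P) W \<and> x \<in> W \<and> {g} \<times> W \<subseteq> S"
      by (rule openin_transformation_space[THEN iffD1, rule_format, THEN conjunct2])
    then obtain W where W: "openin (ps_space P) W" "x \<in> W" "{g} \<times> W \<subseteq> S" by (elim exE conjE)
    have "g \<in> ps_at P x' \<and> a (g, x') = a (g, x)" if "x' \<in> W" for x'
    proof -
      have "(g, x') \<in> S" using W(3) that by blast
      then show ?thesis by (simp add: S_def topspace_transformation_space)
    qed
    then show "a (g, x) \<in> H \<and>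
      (\<exists>W. openin (ps_space P) W \<and> x \<in> W \<and> (\<forall>x'\<in>W. g \<in> ps_at P x' \<and> a (g, x') = a (g, x)))"
      by (intro conjI exI[of _ W] ballI aH W(1,2)) blast+
  qed
next
  assume r: ?r
  have rH: "a (g, x) \<in> H" if "g \<in> ps_at P x" for g x
    using r that by (elim allE[of _ g] allE[of _ x]) simp
  have rW: "\<exists>W. openin (ps_space P) W \<and> x \<in> W \<and> (\<forall>x'\<in>W. g \<in> ps_at P x' \<and> a (g, x') = a (g, x))"
    if "g \<in> ps_at P x" for g x
    using r that by (elim allE[of _ g] allE[of _ x]) simp
  have im: "a ` topspace (transformation_space P) \<subseteq> H"
  proof (intro image_subsetI)
    fix p assume "p \<in> topspace (transformation_space P)"
    then show "a p \<in> H" using rH by (cases p) (simp add: topspace_transformation_space)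
  qed
  have op: "openin (transformation_space P) {p \<in> topspace (transformation_space P). a p \<in> V}" for V
    unfolding openin_transformation_space
  proof (intro allI impI conjI)
    fix g x assume "(g, x) \<in> {p \<in> topspace (transformation_space P). a p \<in> V}"
    then have g: "g \<in> ps_at P x" "a (g, x) \<in> V" by (simp_all add: topspace_transformation_space)
    show "g \<in> ps_at P x" by fact
    obtain W where W: "openin (ps_space P) W" "x \<in> W" "\<forall>x'\<in>W. g \<in> ps_at P x' \<and> a (g, x') = a (g, x)"
      using rW[OF g(1)] by (elim exE conjE)
    have "{g} \<times> W \<subseteq> {p \<in> topspace (transformation_space P). a p \<in> V}"
    proof clarify
      fix x' assume "x' \<in> W"
      then show "(g, x') \<in> topspace (transformation_space P) \<and> a (g, x') \<in> V"
        using W(3) g(2) by (simp add: topspace_transformation_space)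
    qed
    then show "\<exists>W. openin (ps_space P) W \<and> x \<in> W \<and>
        {g} \<times> W \<subseteq> {p \<in> topspace (transformation_space P). a p \<in> V}"
      by (intro exI[of _ W] conjI W(1,2))
  qed
  show ?l
    unfolding continuous_map using im op by simp
qed

lemma openin_act_preimage:
  assumes g: "g \<in> carrier (ps_group P)" and A: "openin (ps_space P) A"
  shows "openin (ps_space P) {x. g \<in> ps_at P x \<and> ps_act P g x \<in> A}"
proof -
  have "continuous_map (subtopology (ps_space P) (ps_dom P (ps_inv P g))) (ps_space P) (ps_act P g)"
    using homeomorphic_imp_continuous_map[OF homeo_act[OF g]] continuous_map_into_fulltopology by blast
  from openin_continuous_map_preimage[OF this A]
  moreover have "{x \<in> topspace (subtopology (ps_space P) (ps_dom P (ps_inv P g))). ps_act P g x \<in> A} =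
      {x. g \<in> ps_at P x \<and> ps_act P g x \<in> A}"
    using g topspace_dom[of "ps_inv P g"] by (auto simp: at_iff)
  ultimately have "openin (subtopology (ps_space P) (ps_dom P (ps_inv P g)))
      {x. g \<in> ps_at P x \<and> ps_act P g x \<in> A}" by simp
  then show ?thesis using openin_trans_full open_dom g by blast
qed

text \<open>Two group elements with the same germ at a point differ by an element fixing an open set.\<close>

lemma topologically_free_germ:
  assumes tf: "topologically_free P" and h: "h \<in> carrier (ps_group P)" and h': "h' \<in> carrier (ps_group P)"
    and W: "openin (ps_space P) W" "W \<noteq> {}"
    and eq: "\<And>x. x \<in> W \<Longrightarrow> h \<in> ps_at P x \<and> h' \<in> ps_at P x \<and> ps_act P h x = ps_act P h' x"
  shows "h = h'"
proof (rule ccontr)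
  assume ne: "h \<noteq> h'"
  define k where "k = ps_mult P (ps_inv P h') h"
  have kG: "k \<in> carrier (ps_group P)" using h h' by (simp add: k_def)
  have "k \<noteq> ps_one P"
    using ne h h' unfolding k_def by (metis grp.inv_closed grp.inv_equality grp.inv_inv)
  then have dense: "subtopology (ps_space P) (ps_dom P (ps_inv P k)) closure_of
          {x \<in> ps_dom P (ps_inv P k). ps_act P k x \<noteq> x} = ps_dom P (ps_inv P k)"
    using tf kG by (simp add: topologically_free_def)
  have k: "k \<in> ps_at P x \<and> ps_act P k x = x" if "x \<in> W" for x
  proof -
    note e = eq[OF that]
    have i: "ps_inv P h' \<in> ps_at P (ps_act P h x)" using inv_at[of h' x] e by simp
    then show ?thesis
      using at_mult_iff[of h x "ps_inv P h'"] act_mult[OF _ i] act_inv_act[of h' x] e h' by (simp add: k_def)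
  qed
  obtain x where x: "x \<in> W" using W(2) by blast
  have "x \<in> subtopology (ps_space P) (ps_dom P (ps_inv P k)) closure_of
          {x \<in> ps_dom P (ps_inv P k). ps_act P k x \<noteq> x}"
    unfolding dense using k[OF x] by (simp add: at_iff)
  moreover have "openin (subtopology (ps_space P) (ps_dom P (ps_inv P k))) W"
    unfolding openin_subtopology using k W(1) by (intro exI[of _ W]) (auto simp: at_iff)
  ultimately obtain y where "y \<in> W" "ps_act P k y \<noteq> y"
    using x unfolding in_closure_of by blast
  then show False using k by blast
qed

end

section \<open>From isomorphisms of crossed products to orbit equivalence\<close>

lemma star_isomorphismD:
  assumes "star_isomorphism A B \<Phi>" "a \<in> sa_carrier A"
  shows "\<Phi> a \<in> sa_carrier B"
    "b \<in> sa_carrier A \<Longrightarrow> \<Phi> (sa_add A a b) = sa_add B (\<Phi> a) (\<Phi> b)"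
    "b \<in> sa_carrier A \<Longrightarrow> \<Phi> (sa_mult A a b) = sa_mult B (\<Phi> a) (\<Phi> b)"
    "\<Phi> (sa_scale A c a) = sa_scale B c (\<Phi> a)"
    "\<Phi> (sa_star A a) = sa_star B (\<Phi> a)"
  using assms by (auto simp: star_isomorphism_def bij_betw_def)

lemma star_isomorphism_inv:
  assumes iso: "star_isomorphism A B \<Phi>"
    and closed: "\<And>a b. a \<in> sa_carrier A \<Longrightarrow> b \<in> sa_carrier A \<Longrightarrow> sa_add A a b \<in> sa_carrier A \<and> sa_mult A a b \<in> sa_carrier A"
      "\<And>a c. a \<in> sa_carrier A \<Longrightarrow> sa_scale A c a \<in> sa_carrier A \<and> sa_star A a \<in> sa_carrier A"
  shows "star_isomorphism B A (inv_into (sa_carrier A) \<Phi>)"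
proof -
  have bij: "bij_betw \<Phi> (sa_carrier A) (sa_carrier B)" using iso by (simp add: star_isomorphism_def)
  let ?\<Psi> = "inv_into (sa_carrier A) \<Phi>"
  have c: "?\<Psi> b \<in> sa_carrier A" and r: "\<Phi> (?\<Psi> b) = b" if "b \<in> sa_carrier B" for b
    using that bij by (auto simp: bij_betw_def inv_into_into f_inv_into_f)
  have l: "?\<Psi> b = a" if "a \<in> sa_carrier A" "b = \<Phi> a" for a b
    using that bij by (simp add: bij_betw_def)
  show ?thesis
    unfolding star_isomorphism_def
  proof (intro conjI ballI allI)
    show "bij_betw ?\<Psi> (sa_carrier B) (sa_carrier A)" using bij by (rule bij_betw_inv_into)
    fix a b assume ab: "a \<in> sa_carrier B" "b \<in> sa_carrier B"
    show "?\<Psi> (sa_add B a b) = sa_add A (?\<Psi> a) (?\<Psi> b)" "?\<Psi> (sa_mult B a b) = sa_mult A (?\<Psi> a) (?\<Psi> b)"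
      by (rule l; use ab c r closed(1) star_isomorphismD(2,3)[OF iso c[OF ab(1)] c[OF ab(2)]] in simp)+
  next
    fix z a assume a: "a \<in> sa_carrier B"
    show "?\<Psi> (sa_scale B z a) = sa_scale A z (?\<Psi> a)"
      by (rule l; use a c r closed(2) star_isomorphismD(4)[OF iso c[OF a]] in simp)
  next
    fix a assume a: "a \<in> sa_carrier B"
    show "?\<Psi> (sa_star B a) = sa_star A (?\<Psi> a)"
      by (rule l; use a c r closed(2) star_isomorphismD(5)[OF iso c[OF a]] in simp)
  qed
qed

lemma (in seminormed_star_algebra) completion_closed:
  assumes "S \<in> sa_carrier (sa_completion A)"
  shows "T \<in> sa_carrier (sa_completion A) \<Longrightarrow> sa_add (sa_completion A) S T \<in> sa_carrier (sa_completion A)"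
    "T \<in> sa_carrier (sa_completion A) \<Longrightarrow> sa_mult (sa_completion A) S T \<in> sa_carrier (sa_completion A)"
    "sa_scale (sa_completion A) c S \<in> sa_carrier (sa_completion A)"
    "sa_star (sa_completion A) S \<in> sa_carrier (sa_completion A)"
  using assms cauchy_add cauchy_mult cauchy_scale cauchy_star unfolding completion_carrier
  by (auto simp: completion_add completion_mult completion_scale completion_star)

locale psys_pair = P: psys P + Q: psys Q
  for P :: "('g, 'x) partial_system_data" and Q :: "('h, 'y) partial_system_data"
begin

section \<open>Gelfand duality for the diagonal subalgebras\<close>

text \<open>For fixed \<open>y\<close> the map \<open>f \<mapsto> T f y\<close> is a character,
  hence evaluation at a point, which is taken as \<open>\<psi> y\<close>; so \<open>\<psi>\<close>
  runs against \<open>\<Phi>\<close>. For continuity, a bump function \<open>f\<close> with support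
  in \<open>U\<close> gives the open set where \<open>T f\<close> is nonzero, which
  \<open>\<psi>\<close> maps into \<open>U\<close>.\<close>

lemma C0_dual_map:
  assumes iso: "star_isomorphism (reduced_crossed_product P) (reduced_crossed_product Q) \<Phi>"
    and im: "\<Phi> ` C0_subalgebra P = C0_subalgebra Q"
  obtains T \<psi> where "\<And>f. f \<in> C0 (ps_space P) \<Longrightarrow> T f \<in> C0 (ps_space Q) \<and> \<Phi> (P.C0_embed f) = Q.C0_embed (T f)"
    "continuous_map (ps_space Q) (ps_space P) \<psi>"
    "\<And>f y. f \<in> C0 (ps_space P) \<Longrightarrow> y \<in> topspace (ps_space Q) \<Longrightarrow> T f y = f (\<psi> y)"
proof -
  have "\<exists>k\<in>C0 (ps_space Q). \<Phi> (P.C0_embed f) = Q.C0_embed k" if "f \<in> C0 (ps_space P)" for f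
    using im that unfolding P.C0_subalgebra_eq Q.C0_subalgebra_eq by blast
  then obtain T where T: "\<And>f. f \<in> C0 (ps_space P) \<Longrightarrow> T f \<in> C0 (ps_space Q)"
      "\<And>f. f \<in> C0 (ps_space P) \<Longrightarrow> \<Phi> (P.C0_embed f) = Q.C0_embed (T f)"
    by metis
  \<comment> \<open>Surjectivity makes the character at \<open>y\<close> nonzero: some
    \<open>u\<close> has \<open>T u y = 1\<close>.\<close>
  have surj: "\<exists>f\<in>C0 (ps_space P). T f = k" if k: "k \<in> C0 (ps_space Q)" for k
  proof -
    obtain f where f: "f \<in> C0 (ps_space P)" "\<Phi> (P.C0_embed f) = Q.C0_embed k"
      using im k unfolding P.C0_subalgebra_eq Q.C0_subalgebra_eq by (metis (no_types, lifting) image_iff)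
    then have "T f = k" using T Q.C0_embed_inj[OF T(1) k] by simp
    then show ?thesis using f(1) by blast
  qed
  \<comment> \<open>The identities are checked after embedding into the crossed product, where they
    follow from those of \<open>\<Phi>\<close>.\<close>
  have add: "T (\<lambda>x. f x + f' x) = (\<lambda>y. T f y + T f' y)" and mult: "T (\<lambda>x. f x * f' x) = (\<lambda>y. T f y * T f' y)"
    and scale: "T (\<lambda>x. c * f x) = (\<lambda>y. c * T f y)" and star: "T (\<lambda>x. cnj (f x)) = (\<lambda>y. cnj (T f y))"
    if f: "f \<in> C0 (ps_space P)" and f': "f' \<in> C0 (ps_space P)" for f f' c
    by (rule Q.C0_embed_inj;
        use T f f' P.C0_space_closed[OF f f'] Q.C0_space_closed[OF T(1)[OF f] T(1)[OF f']] in
        \<open>simp flip: T(2) add: P.C0_embed_hom Q.C0_embed_hom star_isomorphismD[OF iso] P.C0_embed_closed\<close>)+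
  have "\<exists>x\<in>topspace (ps_space P). \<forall>f\<in>C0 (ps_space P). T f y = f x" if y: "y \<in> topspace (ps_space Q)" for y
  proof -
    obtain k where k: "k \<in> C0 (ps_space Q)" "k y = 1"
      using C0_bump[OF Q.locally_compact Q.Hausdorff openin_topspace y] by (metis subtopology_topspace)
    then obtain u where u: "u \<in> C0 (ps_space P)" "T u = k" using surj by blast
    show ?thesis
      by (rule character_is_evaluation[OF P.Hausdorff, where \<omega> = "\<lambda>f. T f y" and k = u])
         (use add mult scale star u k in auto)
  qed
  then obtain \<psi> where \<psi>: "\<And>y. y \<in> topspace (ps_space Q) \<Longrightarrow> \<psi> y \<in> topspace (ps_space P)"
      "\<And>y f. y \<in> topspace (ps_space Q) \<Longrightarrow> f \<in> C0 (ps_space P) \<Longrightarrow> T f y = f (\<psi> y)"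
    by metis
  have "continuous_map (ps_space Q) (ps_space P) \<psi>"
    unfolding continuous_map
  proof (intro conjI allI impI)
    show "\<psi> ` topspace (ps_space Q) \<subseteq> topspace (ps_space P)" using \<psi>(1) by blast
    fix U assume U: "openin (ps_space P) U"
    show "openin (ps_space Q) {y \<in> topspace (ps_space Q). \<psi> y \<in> U}"
    proof (subst openin_subopen, intro ballI)
      fix y assume "y \<in> {y \<in> topspace (ps_space Q). \<psi> y \<in> U}"
      then have y: "y \<in> topspace (ps_space Q)" "\<psi> y \<in> U" by auto
      obtain f where f: "f \<in> C0 (subtopology (ps_space P) U)" "f (\<psi> y) = 1"
        using C0_bump[OF P.locally_compact P.Hausdorff U y(2)] by blast
      have fX: "f \<in> C0 (ps_space P)" using C0_mono_space[OF P.Hausdorff U f(1)] .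
      have "openin (ps_space Q) {z \<in> topspace (ps_space Q). T f z \<in> - {0}}"
        using T(1)[OF fX] by (intro openin_continuous_map_preimage[where Y = euclidean]) (auto simp: C0_def)
      moreover have "{z \<in> topspace (ps_space Q). T f z \<in> - {0}} \<subseteq> {y \<in> topspace (ps_space Q). \<psi> y \<in> U}"
        using \<psi>(2)[OF _ fX] f(1) C0_iff[OF P.Hausdorff U] by auto
      moreover have "y \<in> {z \<in> topspace (ps_space Q). T f z \<in> - {0}}" using y f \<psi>(2)[OF y(1) fX] by simp
      ultimately show "\<exists>V. openin (ps_space Q) V \<and> y \<in> V \<and> V \<subseteq> {y \<in> topspace (ps_space Q). \<psi> y \<in> U}"
        by blast
    qed
  qed
  then show thesis using that T \<psi>(2) by blast
qed

section \<open>Group elements recovered from the images of single terms\<close>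

text \<open>The element \<open>h\<close> is found on a whole neighbourhood of \<open>x\<close> and
  not only at \<open>x\<close>, because uniqueness and continuity of the cocycle will be read off
  germs.\<close>

lemma orbit_germ_exists:
  assumes iso: "star_isomorphism (reduced_crossed_product P) (reduced_crossed_product Q) \<Phi>"
    and T: "\<And>f. f \<in> C0 (ps_space P) \<Longrightarrow> T f \<in> C0 (ps_space Q) \<and> \<Phi> (P.C0_embed f) = Q.C0_embed (T f)"
      "\<And>f y. f \<in> C0 (ps_space P) \<Longrightarrow> y \<in> topspace (ps_space Q) \<Longrightarrow> T f y = f (\<psi> y)"
    and hom: "homeomorphic_maps (ps_space P) (ps_space Q) \<phi> \<psi>"
    and g: "g \<in> ps_at P x"
  obtains h W where "openin (ps_space P) W" "x \<in> W"
    "\<And>x'. x' \<in> W \<Longrightarrow> g \<in> ps_at P x' \<and> h \<in> ps_at Q (\<phi> x') \<and> \<phi> (ps_act P g x') = ps_act Q h (\<phi> x')"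
proof -
  let ?A = "algebraic_crossed_product P" and ?B = "algebraic_crossed_product Q"
  have cont_\<phi>: "continuous_map (ps_space P) (ps_space Q) \<phi>" using hom by (simp add: homeomorphic_maps_def)
  have \<psi>\<phi>: "\<psi> (\<phi> x) = x" if "x \<in> topspace (ps_space P)" for x using that hom by (simp add: homeomorphic_maps_def)
  have \<phi>\<psi>: "\<phi> (\<psi> y) = y" if "y \<in> topspace (ps_space Q)" for y using that hom by (simp add: homeomorphic_maps_def)
  have \<phi>Y: "\<phi> x \<in> topspace (ps_space Q)" if "x \<in> topspace (ps_space P)" for x
    using that cont_\<phi> by (auto simp: continuous_map_def)
  have gG: "g \<in> carrier (ps_group P)" using g by blast
  have x: "x \<in> topspace (ps_space P)" using P.at_space[OF g] .
  define y where "y = \<phi> x"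
  have y: "y \<in> topspace (ps_space Q)" "\<psi> y = x" using x \<phi>Y \<psi>\<phi> by (auto simp: y_def)
  obtain f where f: "f \<in> C0 (subtopology (ps_space P) (ps_dom P g))" "f (ps_act P g x) = 1"
    using C0_bump[OF P.locally_compact P.Hausdorff P.open_dom[OF gG] P.act_dom[OF g]] by blast
  define n where "n = cp_delta f g"
  have n: "n \<in> cp_carrier P" unfolding n_def by (rule P.cp_delta_closed[OF gG f(1)])
  define N where "N = sa_class ?A (\<lambda>i. n)"
  have nc: "(\<lambda>i. n) \<in> sa_cauchy ?A" using n P.alg.cauchy_const by simp
  have N: "N \<in> sa_carrier (reduced_crossed_product P)"
    unfolding N_def reduced_crossed_product_def P.alg.completion_carrier using nc by blast
  then have "\<Phi> N \<in> sa_carrier (reduced_crossed_product Q)" using star_isomorphismD(1)[OF iso] by blast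
  then obtain s where s: "s \<in> sa_cauchy ?B" "\<Phi> N = sa_class ?B s"
    unfolding reduced_crossed_product_def Q.alg.completion_carrier by blast
  note sc = Q.cauchy_carrier[OF s(1)]
  have cm: "(\<lambda>i. cp_mult Q (t i) (t' i)) \<in> sa_cauchy ?B" if "t \<in> sa_cauchy ?B" "t' \<in> sa_cauchy ?B" for t t'
    using Q.alg.cauchy_mult[OF that] by simp
  have cs: "(\<lambda>i. cp_star Q (t i)) \<in> sa_cauchy ?B" if "t \<in> sa_cauchy ?B" for t
    using Q.alg.cauchy_star[OF that] by simp
  have cd: "(\<lambda>i. cp_delta k (ps_one Q)) \<in> sa_cauchy ?B" if "k \<in> C0 (ps_space Q)" for k
    using Q.alg.cauchy_const Q.cp_delta_one_closed[OF that] by simp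
  define J where "J = Q.cp_lim s"
  have Jlim: "(\<lambda>i. s i h z) \<longlonglongrightarrow> J h z" for h z
    unfolding J_def by (rule Q.cp_lim_tendsto[OF s(1)])

  \<comment> \<open>On the side of \<open>P\<close>, multiplying \<open>N\<close> by
    \<open>k\<close> from the right equals multiplying it by the translate of \<open>k\<close> from
    the left. The relation is pushed through \<open>\<Phi>\<close> and compared at the coefficient
    of \<open>h\<close>.\<close>
  have intertwine: "J h z * T k (ps_act Q (ps_inv Q h) z) = T (ps_pull P g k) z * J h z"
    if k: "k \<in> C0 (subtopology (ps_space P) (ps_dom P (ps_inv P g)))" and h: "h \<in> carrier (ps_group Q)" for k h z
  proof -
    let ?k = "ps_pull P g k"
    have k': "?k \<in> C0 (subtopology (ps_space P) (ps_dom P g))" using P.C0_pull'[OF gG k] .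
    have kX: "k \<in> C0 (ps_space P)" and k'X: "?k \<in> C0 (ps_space P)"
      using k k' P.C0_dom gG by auto
    have "cp_mult P n (cp_delta k (ps_one P)) = cp_delta (\<lambda>x. f x * k (ps_act P (ps_inv P g) x)) g"
      unfolding n_def using P.cp_mult_delta[OF gG f(1) P.grp.one_closed] kX P.C0_one gG by simp
    also have "(\<lambda>x. f x * k (ps_act P (ps_inv P g) x)) = (\<lambda>x. ?k x * f x)"
      using P.C0_off[OF gG f(1)] by (auto simp: ps_pull_def)
    also have "cp_delta (\<lambda>x. ?k x * f x) g = cp_mult P (cp_delta ?k (ps_one P)) n"
      by (intro ext) (simp add: P.cp_mult_delta_one_left[OF n k'X], simp add: n_def cp_delta_def)
    finally have eq: "cp_mult P n (cp_delta k (ps_one P)) = cp_mult P (cp_delta ?k (ps_one P)) n" .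
    have dX: "(\<lambda>i. cp_delta k (ps_one P)) \<in> sa_cauchy ?A" "(\<lambda>i. cp_delta ?k (ps_one P)) \<in> sa_cauchy ?A"
      using P.alg.cauchy_const P.cp_delta_one_closed kX k'X by simp_all
    have "sa_mult (reduced_crossed_product P) N (P.C0_embed k) =
        sa_mult (reduced_crossed_product P) (P.C0_embed ?k) N"
      unfolding N_def P.C0_embed_def P.embed_eq reduced_crossed_product_def
        P.alg.completion_mult[OF nc dX(1)] P.alg.completion_mult[OF dX(2) nc] by (simp add: eq)
    then have "sa_mult (reduced_crossed_product Q) (\<Phi> N) (Q.C0_embed (T k)) =
        sa_mult (reduced_crossed_product Q) (Q.C0_embed (T ?k)) (\<Phi> N)"
      using star_isomorphismD(3)[OF iso N P.C0_embed_closed[OF kX]]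
        star_isomorphismD(3)[OF iso P.C0_embed_closed[OF k'X] N] T(1) kX k'X by simp
    then have "sa_class ?B (\<lambda>i. cp_mult Q (s i) (cp_delta (T k) (ps_one Q))) =
        sa_class ?B (\<lambda>i. cp_mult Q (cp_delta (T ?k) (ps_one Q)) (s i))"
      unfolding s(2) Q.C0_embed_def Q.embed_eq reduced_crossed_product_def
      using Q.alg.completion_mult[OF s(1) cd] Q.alg.completion_mult[OF cd s(1)] T(1) kX k'X by simp
    then have L: "Q.cp_lim (\<lambda>i. cp_mult Q (s i) (cp_delta (T k) (ps_one Q))) h z =
        Q.cp_lim (\<lambda>i. cp_mult Q (cp_delta (T ?k) (ps_one Q)) (s i)) h z"
      using Q.cp_lim_eqI[OF cm[OF s(1) cd[of "T k"]] cm[OF cd[of "T ?k"] s(1)]] T(1) kX k'X by simp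
    have TQ: "T k \<in> C0 (ps_space Q)" "T ?k \<in> C0 (ps_space Q)" using T(1) kX k'X by auto
    have "(\<lambda>i. s i h z * T k (ps_act Q (ps_inv Q h) z)) \<longlonglongrightarrow> J h z * T k (ps_act Q (ps_inv Q h) z)"
      by (intro tendsto_intros Jlim)
    moreover have "(\<lambda>i. T ?k z * s i h z) \<longlonglongrightarrow> T ?k z * J h z"
      by (intro tendsto_intros Jlim)
    ultimately show ?thesis
      using L unfolding Q.cp_lim_def Q.cp_mult_delta_one_right[OF sc TQ(1) h] Q.cp_mult_delta_one_left[OF sc TQ(2)]
      by (simp add: limI)
  qed

  have orbit: "\<psi> (ps_act Q h z) = ps_act P g (\<psi> z)"
    if h: "h \<in> ps_at Q z" and gz: "g \<in> ps_at P (\<psi> z)" and nz: "J h (ps_act Q h z) \<noteq> 0" for h z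
  proof (rule ccontr)
    assume ne: "\<psi> (ps_act Q h z) \<noteq> ps_act P g (\<psi> z)"
    let ?w = "\<psi> (ps_act Q h z)"
    have hH: "h \<in> carrier (ps_group Q)" and zY: "z \<in> topspace (ps_space Q)" and hz: "ps_act Q h z \<in> topspace (ps_space Q)"
      using h Q.at_space Q.act_space by auto
    have "\<psi> z \<noteq> ps_act P (ps_inv P g) ?w" if "?w \<in> ps_dom P g"
      using ne P.act_act_inv[OF gG that] by auto
    \<comment> \<open>If \<open>?w\<close> lies outside the domain of \<open>g\<close>, the
      translate of \<open>k\<close> vanishes at \<open>?w\<close> anyway and a plain bump function
      is enough; otherwise \<open>k\<close> also has to vanish at \<open>g^{-1}.?w\<close>. Either
      way the intertwining relation becomes 1 = 0.\<close>
    then obtain k where k: "k \<in> C0 (subtopology (ps_space P) (ps_dom P (ps_inv P g)))" "k (\<psi> z) = 1"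
      "?w \<in> ps_dom P g \<Longrightarrow> k (ps_act P (ps_inv P g) ?w) = 0"
      using C0_bump_separating[OF P.locally_compact P.Hausdorff P.open_dom[OF P.grp.inv_closed[OF gG]], of "\<psi> z"]
        C0_bump[OF P.locally_compact P.Hausdorff P.open_dom[OF P.grp.inv_closed[OF gG]], of "\<psi> z"]
        gz unfolding P.at_iff by metis
    have kX: "k \<in> C0 (ps_space P)" "ps_pull P g k \<in> C0 (ps_space P)"
      using k(1) P.C0_pull'[OF gG k(1)] P.C0_dom gG by auto
    have "T k z = T (ps_pull P g k) (ps_act Q h z)"
      using intertwine[OF k(1) hH, of "ps_act Q h z"] nz Q.act_inv_act[OF h] by simp
    then have "k (\<psi> z) = ps_pull P g k ?w" using T(2) kX zY hz by simp
    then show False using k(2,3) by (simp add: ps_pull_def split: if_splits)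
  qed

  \<comment> \<open>The value of \<open>\<Phi> (N\<^sup>* N)\<close> at \<open>y\<close> is the limit of the squared norms of the columns
    \<open>(s i h (h.y))\<^sub>h\<close>; these converge in norm, so the limit would be 0 if all \<open>J h (h.y)\<close> were.\<close>
  have "\<exists>h\<in>ps_at Q y. J h (ps_act Q h y) \<noteq> 0"
  proof (rule ccontr)
    assume "\<not> ?thesis"
    then have J0: "J h (ps_act Q h y) = 0" if "h \<in> ps_at Q y" for h using that by blast
    \<comment> \<open>On the domain of \<open>g\<close> this is the squared modulus of
      \<open>f (g.x)\<close>; it is the only coefficient of \<open>N^* N\<close>, and its value at
      the given point is 1.\<close>
    define q where "q = (\<lambda>x. ps_pull P (ps_inv P g) (\<lambda>y. cnj (f y)) x * f (ps_act P (ps_inv P (ps_inv P g)) x))"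
    have fc: "ps_pull P (ps_inv P g) (\<lambda>y. cnj (f y)) \<in> C0 (subtopology (ps_space P) (ps_dom P (ps_inv P g)))"
      using P.C0_pull'[of "ps_inv P g"] C0_cnj[OF P.Hausdorff P.open_dom[OF gG] f(1)] gG by simp
    have sm: "cp_mult P (cp_star P n) n = cp_delta q (ps_one P)"
      unfolding n_def P.cp_star_delta[OF gG f(1)]
        P.cp_mult_delta[OF P.grp.inv_closed[OF gG] fc gG f(1)] q_def using gG by simp
    have "cp_delta q (ps_one P) \<in> cp_carrier P"
      using P.cp_mult_closed[OF P.cp_star_closed[OF n] n] sm by simp
    then have q: "q \<in> C0 (ps_space P)"
      using P.cp_carrierD(3)[of "cp_delta q (ps_one P)" "ps_one P"] P.C0_one by (simp add: cp_delta_def)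
    have qx: "q x = 1" using f(2) g gG by (simp add: q_def ps_pull_def P.at_iff)
    have eq: "P.C0_embed q = sa_mult (reduced_crossed_product P) (sa_star (reduced_crossed_product P) N) N"
      unfolding N_def P.C0_embed_def P.embed_eq reduced_crossed_product_def P.alg.completion_star[OF nc]
        P.alg.completion_mult[OF P.alg.cauchy_star[OF nc] nc] by (simp add: sm)
    have Nst: "sa_star (reduced_crossed_product P) N \<in> sa_carrier (reduced_crossed_product P)"
      using P.alg.completion_closed(4) N unfolding reduced_crossed_product_def by blast
    have "Q.C0_embed (T q) = \<Phi> (P.C0_embed q)" using T(1)[OF q] by simp
    also have "\<dots> = sa_mult (reduced_crossed_product Q) (sa_star (reduced_crossed_product Q) (\<Phi> N)) (\<Phi> N)"
      unfolding eq by (simp only: star_isomorphismD(3)[OF iso Nst N] star_isomorphismD(5)[OF iso N])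
    also have "\<dots> = sa_class ?B (\<lambda>i. cp_mult Q (cp_star Q (s i)) (s i))"
      unfolding s(2) reduced_crossed_product_def Q.alg.completion_star[OF s(1)]
        Q.alg.completion_mult[OF Q.alg.cauchy_star[OF s(1)] s(1)] by simp
    finally have "sa_class ?B (\<lambda>i. cp_delta (T q) (ps_one Q)) = sa_class ?B (\<lambda>i. cp_mult Q (cp_star Q (s i)) (s i))"
      unfolding Q.C0_embed_def Q.embed_eq .
    then have "Q.cp_lim (\<lambda>i. cp_delta (T q) (ps_one Q)) = Q.cp_lim (\<lambda>i. cp_mult Q (cp_star Q (s i)) (s i))"
      using T(1)[OF q] by (intro Q.cp_lim_eqI cd cm cs s(1)) auto
    from this[symmetric] have "Q.cp_lim (\<lambda>i. cp_mult Q (cp_star Q (s i)) (s i)) (ps_one Q) y = T q y"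
      by (simp add: Q.cp_lim_const cp_delta_def)
    then have lim1: "(\<lambda>i. cp_mult Q (cp_star Q (s i)) (s i) (ps_one Q) y) \<longlonglongrightarrow> 1"
      using Q.cp_lim_tendsto[OF cm[OF cs[OF s(1)] s(1)], of "ps_one Q" y] T(2)[OF q y(1)] qx y(2) by simp
    have "(\<lambda>i. cp_mult Q (cp_star Q (s i)) (s i) (ps_one Q) y) \<longlonglongrightarrow> 0"
    proof (rule metric_LIMSEQ_I)
      fix \<epsilon> :: real assume "\<epsilon> > 0"
      \<comment> \<open>Chosen so that the square of a column norm bounded by
        \<open>\<delta>\<close> is strictly below \<open>\<epsilon>\<close>.\<close>
      define \<delta> where "\<delta> = sqrt (\<epsilon> / 2)"
      have \<delta>: "\<delta> > 0" "\<delta>\<^sup>2 < \<epsilon>" using \<open>\<epsilon> > 0\<close> by (auto simp: \<delta>_def)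
      obtain M where M: "\<forall>m\<ge>M. \<forall>i\<ge>M. sa_dist ?B (s m) (s i) < \<delta>"
        using Q.alg.cauchyD2[OF s(1) \<delta>(1)] by blast
      have "dist (cp_mult Q (cp_star Q (s i)) (s i) (ps_one Q) y) 0 < \<epsilon>" if i: "i \<ge> M" for i
      proof -
        obtain F where F: "finite F" "F \<subseteq> ps_at Q y"
          "cp_mult Q (cp_star Q (s i)) (s i) (ps_one Q) y =
            complex_of_real ((L2_set (\<lambda>h. cmod (s i h (ps_act Q h y))) F)\<^sup>2)"
          using Q.cp_star_mult_one[OF sc y(1)] by blast
        have "L2_set (\<lambda>h. cmod (s i h (ps_act Q h y))) F \<le> \<delta>"
        proof (rule LIMSEQ_le_const2)
          \<comment> \<open>As \<open>J\<close> vanishes along this column, the differences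
            \<open>s i - s m\<close> tend to the column of \<open>s i\<close> itself; their norms
            are below \<open>\<delta>\<close> by the Cauchy property.\<close>
          have "(\<lambda>m. L2_set (\<lambda>h. cmod (s i h (ps_act Q h y) - s m h (ps_act Q h y))) F) \<longlonglongrightarrow>
              L2_set (\<lambda>h. cmod (s i h (ps_act Q h y) - J h (ps_act Q h y))) F"
            unfolding L2_set_def by (intro tendsto_intros Jlim)
          also have "L2_set (\<lambda>h. cmod (s i h (ps_act Q h y) - J h (ps_act Q h y))) F =
              L2_set (\<lambda>h. cmod (s i h (ps_act Q h y))) F"
            using F(2) J0 by (intro L2_set_cong) auto
          finally show "(\<lambda>m. L2_set (\<lambda>h. cmod (s i h (ps_act Q h y) - s m h (ps_act Q h y))) F) \<longlonglongrightarrow>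
              L2_set (\<lambda>h. cmod (s i h (ps_act Q h y))) F" .
          show "\<exists>M. \<forall>m\<ge>M. L2_set (\<lambda>h. cmod (s i h (ps_act Q h y) - s m h (ps_act Q h y))) F \<le> \<delta>"
          proof (intro exI allI impI)
            fix m assume "m \<ge> M"
            then have "sa_dist ?B (s i) (s m) < \<delta>" using M i by blast
            then show "L2_set (\<lambda>h. cmod (s i h (ps_act Q h y) - s m h (ps_act Q h y))) F \<le> \<delta>"
              using Q.cp_column_le_norm[OF Q.cp_diff_closed[OF sc[of i] sc[of m]] F(1,2)] by (simp add: alg_dist)
          qed
        qed
        then have "(L2_set (\<lambda>h. cmod (s i h (ps_act Q h y))) F)\<^sup>2 \<le> \<delta>\<^sup>2"
          by (intro power_mono) auto
        then show ?thesis using F(3) \<delta>(2) by (simp add: norm_power)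
      qed
      then show "\<exists>M. \<forall>i\<ge>M. dist (cp_mult Q (cp_star Q (s i)) (s i) (ps_one Q) y) 0 < \<epsilon>" by blast
    qed
    from LIMSEQ_unique[OF lim1 this] show False by simp
  qed
  then obtain h where h: "h \<in> ps_at Q y" "J h (ps_act Q h y) \<noteq> 0" by blast
  have hH: "h \<in> carrier (ps_group Q)" using h by blast
  \<comment> \<open>With error at most \<open>\<delta>\<close>, the approximant \<open>s M h\<close>
    exceeds \<open>2 * \<delta>\<close> at \<open>h.y\<close>, where \<open>J h\<close> has modulus
    \<open>4 * \<delta>\<close>; and wherever it exceeds \<open>2 * \<delta>\<close>,
    \<open>J h\<close> is nonzero. Continuity of \<open>s M h\<close> makes that set open.\<close>
  define \<delta> where "\<delta> = cmod (J h (ps_act Q h y)) / 4"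
  have \<delta>: "\<delta> > 0" using h(2) by (simp add: \<delta>_def)
  obtain M where M: "\<And>n g x. n \<ge> M \<Longrightarrow> cmod (s n g x - J g x) \<le> \<delta>"
    using Q.cp_lim_uniform[OF s(1) \<delta>] unfolding J_def by blast
  define V where "V = {z \<in> topspace (ps_space Q). s M h z \<in> {w. 2 * \<delta> < cmod w}}"
  have "s M h \<in> C0 (ps_space Q)" using Q.cp_carrierD(3)[OF sc hH] Q.C0_dom[OF hH] by blast
  then have V: "openin (ps_space Q) V"
    unfolding V_def by (intro openin_continuous_map_preimage[where Y = euclidean])
      (auto simp: C0_def intro!: open_Collect_less continuous_intros)
  have JV: "J h z \<noteq> 0" if "z \<in> V" for z
    using that M[of M h z] \<delta> norm_triangle_ineq2[of "s M h z" "J h z"] by (auto simp: V_def)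
  have "2 * \<delta> < cmod (s M h (ps_act Q h y))"
    using M[of M h "ps_act Q h y"] \<delta> norm_triangle_ineq2[of "J h (ps_act Q h y)" "s M h (ps_act Q h y)"]
      norm_minus_commute[of "J h (ps_act Q h y)" "s M h (ps_act Q h y)"] unfolding \<delta>_def by linarith
  then have yV: "ps_act Q h y \<in> V" using Q.act_space[OF h(1)] by (simp add: V_def)
  define W where "W = ps_dom P (ps_inv P g) \<inter> {x \<in> topspace (ps_space P). \<phi> x \<in> {z. h \<in> ps_at Q z \<and> ps_act Q h z \<in> V}}"
  have W: "openin (ps_space P) W"
    unfolding W_def using P.open_dom gG
    by (intro openin_Int openin_continuous_map_preimage[OF cont_\<phi>] Q.openin_act_preimage hH V) auto
  show thesis
  proof (rule that[OF W])
    show "x \<in> W" using g x h(1) yV by (auto simp: W_def P.at_iff y_def)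
    fix x' assume x': "x' \<in> W"
    then have 1: "g \<in> ps_at P x'" "x' \<in> topspace (ps_space P)" "h \<in> ps_at Q (\<phi> x')" "ps_act Q h (\<phi> x') \<in> V"
      using gG by (auto simp: W_def P.at_iff)
    have "\<psi> (ps_act Q h (\<phi> x')) = ps_act P g x'"
      using orbit[OF 1(3)] \<psi>\<phi>[OF 1(2)] 1(1) JV[OF 1(4)] by simp
    then have "\<phi> (ps_act P g x') = ps_act Q h (\<phi> x')"
      using \<phi>\<psi>[OF Q.act_space[OF 1(3)]] by simp
    then show "g \<in> ps_at P x' \<and> h \<in> ps_at Q (\<phi> x') \<and> \<phi> (ps_act P g x') = ps_act Q h (\<phi> x')" using 1 by blast
  qed
qed

text \<open>A neighbourhood on which \<open>h\<close> implements \<open>g\<close> serves for each of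
  its points. By freeness the germ determines \<open>h\<close>, so the pointwise choice is constant
  on this neighbourhood, hence continuous.\<close>

lemma orbit_cocycle_exists:
  assumes tf: "topologically_free Q" and hom: "homeomorphic_maps (ps_space P) (ps_space Q) \<phi> \<psi>"
    and germ: "\<And>g x. g \<in> ps_at P x \<Longrightarrow> \<exists>h W. openin (ps_space P) W \<and> x \<in> W \<and>
      (\<forall>x'\<in>W. g \<in> ps_at P x' \<and> h \<in> ps_at Q (\<phi> x') \<and> \<phi> (ps_act P g x') = ps_act Q h (\<phi> x'))"
  obtains a where "continuous_map (transformation_space P) (discrete_topology (carrier (ps_group Q))) a"
    "\<And>g x. g \<in> ps_at P x \<Longrightarrow> a (g, x) \<in> ps_at Q (\<phi> x) \<and> \<phi> (ps_act P g x) = ps_act Q (a (g, x)) (\<phi> x)"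
proof -
  define G where "G h g x \<longleftrightarrow> (\<exists>W. openin (ps_space P) W \<and> x \<in> W \<and>
      (\<forall>x'\<in>W. g \<in> ps_at P x' \<and> h \<in> ps_at Q (\<phi> x') \<and> \<phi> (ps_act P g x') = ps_act Q h (\<phi> x')))" for h g x
  have uniq: "h = h'" if hh': "G h g x" "G h' g x" for h h' g x
  proof -
    obtain W W' where W: "openin (ps_space P) W" "x \<in> W"
        "\<forall>x'\<in>W. g \<in> ps_at P x' \<and> h \<in> ps_at Q (\<phi> x') \<and> \<phi> (ps_act P g x') = ps_act Q h (\<phi> x')"
      and W': "openin (ps_space P) W'" "x \<in> W'"
        "\<forall>x'\<in>W'. g \<in> ps_at P x' \<and> h' \<in> ps_at Q (\<phi> x') \<and> \<phi> (ps_act P g x') = ps_act Q h' (\<phi> x')"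
      using hh' unfolding G_def by blast
    show ?thesis
    proof (rule Q.topologically_free_germ[OF tf])
      show "h \<in> carrier (ps_group Q)" "h' \<in> carrier (ps_group Q)"
        using W(2,3) W'(2,3) Q.at_carrier by blast+
      have "homeomorphic_map (ps_space P) (ps_space Q) \<phi>"
        using hom homeomorphic_maps_map by blast
      then have "open_map (ps_space P) (ps_space Q) \<phi>" by (rule homeomorphic_imp_open_map)
      then show "openin (ps_space Q) (\<phi> ` (W \<inter> W'))"
        using W(1) W'(1) unfolding open_map_def by blast
      show "\<phi> ` (W \<inter> W') \<noteq> {}" using W(2) W'(2) by blast
    qed (use W(3) W'(3) in auto)
  qed
  define a where "a = (\<lambda>(g, x). SOME h. G h g x)"
  have Ga: "G (a (g, x)) g x" if "g \<in> ps_at P x" for g x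
  proof -
    have "\<exists>h. G h g x" unfolding G_def by (rule germ[OF that])
    then show ?thesis unfolding a_def prod.case by (rule someI_ex)
  qed
  show thesis
  proof (rule that[of a])
    show "continuous_map (transformation_space P) (discrete_topology (carrier (ps_group Q))) a"
      unfolding P.continuous_map_transformation_space
    proof (intro allI impI)
      fix g x assume g: "g \<in> ps_at P x"
      obtain W where W: "openin (ps_space P) W" "x \<in> W"
        "\<forall>x'\<in>W. g \<in> ps_at P x' \<and> a (g, x) \<in> ps_at Q (\<phi> x') \<and> \<phi> (ps_act P g x') = ps_act Q (a (g, x)) (\<phi> x')"
        using Ga[OF g] unfolding G_def by blast
      have "a (g, x') = a (g, x)" if "x' \<in> W" for x'
      proof (rule uniq)
        show "G (a (g, x')) g x'" using Ga W(3) that by blast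
        show "G (a (g, x)) g x'" unfolding G_def using W that by blast
      qed
      then show "a (g, x) \<in> carrier (ps_group Q) \<and>
          (\<exists>W. openin (ps_space P) W \<and> x \<in> W \<and> (\<forall>x'\<in>W. g \<in> ps_at P x' \<and> a (g, x') = a (g, x)))"
        using W by blast
    qed
    show "a (g, x) \<in> ps_at Q (\<phi> x) \<and> \<phi> (ps_act P g x) = ps_act Q (a (g, x)) (\<phi> x)" if "g \<in> ps_at P x" for g x
      using Ga[OF that] unfolding G_def by blast
  qed
qed

text \<open>Since \<open>R (T f) = f\<close>, every function takes the same value at
  \<open>x\<close> and at \<open>\<psi> (\<phi> x)\<close>, while bump functions separate
  points.\<close>

lemma C0_dual_maps_inverse:
  assumes T: "\<And>f. f \<in> C0 (ps_space P) \<Longrightarrow> T f \<in> C0 (ps_space Q) \<and> \<Phi> (P.C0_embed f) = Q.C0_embed (T f)"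
      "\<And>f y. f \<in> C0 (ps_space P) \<Longrightarrow> y \<in> topspace (ps_space Q) \<Longrightarrow> T f y = f (\<psi> y)"
    and R: "\<And>k. k \<in> C0 (ps_space Q) \<Longrightarrow> R k \<in> C0 (ps_space P) \<and> \<Psi> (Q.C0_embed k) = P.C0_embed (R k)"
      "\<And>k x. k \<in> C0 (ps_space Q) \<Longrightarrow> x \<in> topspace (ps_space P) \<Longrightarrow> R k x = k (\<phi> x)"
    and \<phi>: "continuous_map (ps_space P) (ps_space Q) \<phi>"
    and inv: "\<And>S. S \<in> C0_subalgebra P \<Longrightarrow> \<Psi> (\<Phi> S) = S"
    and x: "x \<in> topspace (ps_space P)"
  shows "\<psi> (\<phi> x) = x"
proof (rule ccontr)
  assume "\<psi> (\<phi> x) \<noteq> x"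
  then obtain f where f: "f \<in> C0 (ps_space P)" "f x = 1" "f (\<psi> (\<phi> x)) = 0"
    using C0_bump_separating[OF P.locally_compact P.Hausdorff openin_topspace x] by (metis subtopology_topspace)
  have "P.C0_embed (R (T f)) = P.C0_embed f"
    using T(1) R(1) f(1) inv[of "P.C0_embed f"] P.C0_subalgebra_eq by fastforce
  then have "R (T f) = f" using P.C0_embed_inj T(1) R(1) f(1) by blast
  moreover have "\<phi> x \<in> topspace (ps_space Q)" using \<phi> x by (auto simp: continuous_map_def)
  ultimately show False using R(2)[of "T f" x] T(2)[OF f(1), of "\<phi> x"] T(1) f x by force
qed

end

lemma crossed_product_iso_imp_coe:
  assumes P: "partial_system P" and Q: "partial_system Q"
    and tfP: "topologically_free P" and tfQ: "topologically_free Q"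
    and iso: "star_isomorphism (reduced_crossed_product P) (reduced_crossed_product Q) \<Phi>"
    and im: "\<Phi> ` C0_subalgebra P = C0_subalgebra Q"
  shows "continuously_orbit_equivalent P Q"
proof -
  interpret PQ: psys_pair P Q by unfold_locales (fact P, fact Q)
  interpret QP: psys_pair Q P by unfold_locales
  define \<Psi> where "\<Psi> = inv_into (sa_carrier (reduced_crossed_product P)) \<Phi>"
  have iso': "star_isomorphism (reduced_crossed_product Q) (reduced_crossed_product P) \<Psi>"
    unfolding \<Psi>_def
    by (rule star_isomorphism_inv[OF iso])
       (use PQ.P.alg.completion_closed in \<open>auto simp: reduced_crossed_product_def\<close>)
  have inj: "inj_on \<Phi> (sa_carrier (reduced_crossed_product P))"
    using iso by (simp add: star_isomorphism_def bij_betw_def)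
  have sub: "C0_subalgebra P \<subseteq> sa_carrier (reduced_crossed_product P)"
    using PQ.P.C0_embed_closed by (auto simp: PQ.P.C0_subalgebra_eq)
  have inv1: "\<Psi> (\<Phi> S) = S" if "S \<in> C0_subalgebra P" for S
    using that sub inj by (auto simp: \<Psi>_def)
  have im': "\<Psi> ` C0_subalgebra Q = C0_subalgebra P"
    unfolding im[symmetric] using inv1 by force
  have inv2: "\<Phi> (\<Psi> S) = S" if S: "S \<in> C0_subalgebra Q" for S
  proof -
    obtain S' where "S' \<in> C0_subalgebra P" "S = \<Phi> S'" using S im by blast
    then show ?thesis using inv1 by simp
  qed
  obtain T \<psi> where T: "\<And>f. f \<in> C0 (ps_space P) \<Longrightarrow> T f \<in> C0 (ps_space Q) \<and> \<Phi> (PQ.P.C0_embed f) = PQ.Q.C0_embed (T f)"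
    "continuous_map (ps_space Q) (ps_space P) \<psi>"
    "\<And>f y. f \<in> C0 (ps_space P) \<Longrightarrow> y \<in> topspace (ps_space Q) \<Longrightarrow> T f y = f (\<psi> y)"
    using PQ.C0_dual_map[OF iso im] by blast
  obtain R \<phi> where R: "\<And>f. f \<in> C0 (ps_space Q) \<Longrightarrow> R f \<in> C0 (ps_space P) \<and> \<Psi> (PQ.Q.C0_embed f) = PQ.P.C0_embed (R f)"
    "continuous_map (ps_space P) (ps_space Q) \<phi>"
    "\<And>f y. f \<in> C0 (ps_space Q) \<Longrightarrow> y \<in> topspace (ps_space P) \<Longrightarrow> R f y = f (\<phi> y)"
    using QP.C0_dual_map[OF iso' im'] by blast
  have hom: "homeomorphic_maps (ps_space P) (ps_space Q) \<phi> \<psi>"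
    unfolding homeomorphic_maps_def
    using T(2) R(2) PQ.C0_dual_maps_inverse[OF T(1,3) R(1,3) R(2) inv1]
      QP.C0_dual_maps_inverse[OF R(1,3) T(1,3) T(2) inv2] by blast
  have hom': "homeomorphic_maps (ps_space Q) (ps_space P) \<psi> \<phi>" using hom homeomorphic_maps_sym by blast
  have "\<exists>h W. openin (ps_space P) W \<and> x \<in> W \<and>
      (\<forall>x'\<in>W. g \<in> ps_at P x' \<and> h \<in> ps_at Q (\<phi> x') \<and> \<phi> (ps_act P g x') = ps_act Q h (\<phi> x'))"
    if "g \<in> ps_at P x" for g x
    by (rule PQ.orbit_germ_exists[OF iso T(1,3) hom that]) blast+
  from PQ.orbit_cocycle_exists[OF tfQ hom this]
  obtain a where a: "continuous_map (transformation_space P) (discrete_topology (carrier (ps_group Q))) a"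
    "\<And>g x. g \<in> ps_at P x \<Longrightarrow> a (g, x) \<in> ps_at Q (\<phi> x) \<and> \<phi> (ps_act P g x) = ps_act Q (a (g, x)) (\<phi> x)"
    by blast
  have "\<exists>h W. openin (ps_space Q) W \<and> x \<in> W \<and>
      (\<forall>x'\<in>W. g \<in> ps_at Q x' \<and> h \<in> ps_at P (\<psi> x') \<and> \<psi> (ps_act Q g x') = ps_act P h (\<psi> x'))"
    if "g \<in> ps_at Q x" for g x
    by (rule QP.orbit_germ_exists[OF iso' R(1,3) hom' that]) blast+
  from QP.orbit_cocycle_exists[OF tfP hom' this]
  obtain b where b: "continuous_map (transformation_space Q) (discrete_topology (carrier (ps_group P))) b"
    "\<And>g x. g \<in> ps_at Q x \<Longrightarrow> b (g, x) \<in> ps_at P (\<psi> x) \<and> \<psi> (ps_act Q g x) = ps_act P (b (g, x)) (\<psi> x)"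
    by blast
  show ?thesis
    unfolding continuously_orbit_equivalent_def
  proof (intro exI conjI)
    show "\<forall>(g, x)\<in>topspace (transformation_space P). a (g, x) \<in> ps_at Q (\<phi> x) \<and>
        \<phi> (ps_act P g x) = ps_act Q (a (g, x)) (\<phi> x)"
      using a(2) PQ.P.topspace_transformation_space by auto
    show "\<forall>(h, y)\<in>topspace (transformation_space Q). b (h, y) \<in> ps_at P (\<psi> y) \<and>
        \<psi> (ps_act Q h y) = ps_act P (b (h, y)) (\<psi> y)"
      using b(2) PQ.Q.topspace_transformation_space by auto
  qed (fact hom a(1) b(1))+
qed

section \<open>Orbit cocycles and groupoid isomorphisms\<close>

text \<open>The last clause is the cocycle identity, which the definition of continuous orbit
  equivalence does not contain; it makes the map on arrows multiplicative.\<close>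

definition orbit_cocycle ::
  "('g, 'x) partial_system_data \<Rightarrow> ('h, 'y) partial_system_data \<Rightarrow> ('x \<Rightarrow> 'y) \<Rightarrow> ('g \<times> 'x \<Rightarrow> 'h) \<Rightarrow> bool" where
  "orbit_cocycle P Q \<phi> a \<longleftrightarrow>
     continuous_map (transformation_space P) (discrete_topology (carrier (ps_group Q))) a \<and>
     (\<forall>g x. g \<in> ps_at P x \<longrightarrow> a (g, x) \<in> ps_at Q (\<phi> x) \<and> \<phi> (ps_act P g x) = ps_act Q (a (g, x)) (\<phi> x)) \<and>
     (\<forall>g h x. h \<in> ps_at P x \<longrightarrow> g \<in> ps_at P (ps_act P h x) \<longrightarrow>
        a (ps_mult P g h, x) = ps_mult Q (a (g, ps_act P h x)) (a (h, x)))"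

definition cocycle_equivalence where
  "cocycle_equivalence P Q \<phi> \<psi> a b \<longleftrightarrow>
     homeomorphic_maps (ps_space P) (ps_space Q) \<phi> \<psi> \<and> orbit_cocycle P Q \<phi> a \<and> orbit_cocycle Q P \<psi> b \<and>
     (\<forall>g x. g \<in> ps_at P x \<longrightarrow> b (a (g, x), \<phi> x) = g) \<and> (\<forall>h y. h \<in> ps_at Q y \<longrightarrow> a (b (h, y), \<psi> y) = h)"

lemma cocycle_equivalence_sym: "cocycle_equivalence P Q \<phi> \<psi> a b \<Longrightarrow> cocycle_equivalence Q P \<psi> \<phi> b a"
  unfolding cocycle_equivalence_def using homeomorphic_maps_sym by blast

context psys_pair
begin

section \<open>Cocycle identities forced by topological freeness\<close>

lemma locally_constant:
  assumes "continuous_map (transformation_space P) (discrete_topology H) a" "g \<in> ps_at P x"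
  obtains W where "openin (ps_space P) W" "x \<in> W" "\<And>x'. x' \<in> W \<Longrightarrow> g \<in> ps_at P x' \<and> a (g, x') = a (g, x)"
  using assms unfolding P.continuous_map_transformation_space by metis

text \<open>Near \<open>\<phi> x\<close> both sides of the cocycle identity move
  \<open>\<phi> x'\<close> to \<open>\<phi> (g.(h.x'))\<close>. As their values are locally
  constant, they are two fixed group elements with a common germ.\<close>

lemma orbit_cocycleI:
  assumes tf: "topologically_free Q" and hom: "homeomorphic_map (ps_space P) (ps_space Q) \<phi>"
    and cont: "continuous_map (transformation_space P) (discrete_topology (carrier (ps_group Q))) a"
    and eqv: "\<And>g x. g \<in> ps_at P x \<Longrightarrow> a (g, x) \<in> ps_at Q (\<phi> x) \<and> \<phi> (ps_act P g x) = ps_act Q (a (g, x)) (\<phi> x)"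
  shows "orbit_cocycle P Q \<phi> a"
  unfolding orbit_cocycle_def
proof (intro conjI allI impI)
  fix g h x assume h: "h \<in> ps_at P x" and g: "g \<in> ps_at P (ps_act P h x)"
  have hG: "h \<in> carrier (ps_group P)" and gG: "g \<in> carrier (ps_group P)" using h g by auto
  have gh: "ps_mult P g h \<in> ps_at P x" using P.at_mult_iff[OF h gG] g by simp
  obtain W1 where W1: "openin (ps_space P) W1" "x \<in> W1" "\<And>x'. x' \<in> W1 \<Longrightarrow> h \<in> ps_at P x' \<and> a (h, x') = a (h, x)"
    using locally_constant[OF cont h] by blast
  obtain W2 where W2: "openin (ps_space P) W2" "ps_act P h x \<in> W2"
      "\<And>z. z \<in> W2 \<Longrightarrow> g \<in> ps_at P z \<and> a (g, z) = a (g, ps_act P h x)"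
    using locally_constant[OF cont g] by blast
  obtain W3 where W3: "openin (ps_space P) W3" "x \<in> W3"
      "\<And>x'. x' \<in> W3 \<Longrightarrow> ps_mult P g h \<in> ps_at P x' \<and> a (ps_mult P g h, x') = a (ps_mult P g h, x)"
    using locally_constant[OF cont gh] by blast
  \<comment> \<open>Here all three values of the cocycle are constant; the one taken at
    \<open>h.x\<close> requires pulling its neighbourhood back along \<open>h\<close>.\<close>
  define W where "W = W1 \<inter> {x'. h \<in> ps_at P x' \<and> ps_act P h x' \<in> W2} \<inter> W3"
  have W: "openin (ps_space P) W" "x \<in> W"
    unfolding W_def using W1 W2 W3 P.openin_act_preimage[OF hG W2(1)] h by auto
  have oW: "openin (ps_space Q) (\<phi> ` W)"
    using homeomorphic_imp_open_map[OF hom] W(1) unfolding open_map_def by blast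
  show "a (ps_mult P g h, x) = ps_mult Q (a (g, ps_act P h x)) (a (h, x))"
  proof (rule Q.topologically_free_germ[OF tf _ _ oW])
    show "a (ps_mult P g h, x) \<in> carrier (ps_group Q)" using eqv[OF gh] by blast
    show "ps_mult Q (a (g, ps_act P h x)) (a (h, x)) \<in> carrier (ps_group Q)"
      using eqv[OF h] eqv[OF g] Q.at_carrier by blast
    show "\<phi> ` W \<noteq> {}" using W by blast
    fix y assume "y \<in> \<phi> ` W"
    then obtain x' where x': "x' \<in> W" "y = \<phi> x'" by blast
    then have h': "h \<in> ps_at P x'" "a (h, x') = a (h, x)" and g': "g \<in> ps_at P (ps_act P h x')"
      "a (g, ps_act P h x') = a (g, ps_act P h x)" and gh': "ps_mult P g h \<in> ps_at P x'"
      "a (ps_mult P g h, x') = a (ps_mult P g h, x)"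
      using W1(3) W2(3) W3(3) unfolding W_def by auto
    note e1 = eqv[OF h'(1), unfolded h'(2)] and e2 = eqv[OF g'(1), unfolded g'(2)] and e3 = eqv[OF gh'(1), unfolded gh'(2)]
    have 4: "a (g, ps_act P h x) \<in> ps_at Q (ps_act Q (a (h, x)) (\<phi> x'))" using e1 e2 by simp
    have "ps_mult Q (a (g, ps_act P h x)) (a (h, x)) \<in> ps_at Q (\<phi> x')"
      using Q.at_mult_iff[of "a (h, x)" "\<phi> x'" "a (g, ps_act P h x)"] e1 4 Q.at_carrier by blast
    moreover have "ps_act Q (ps_mult Q (a (g, ps_act P h x)) (a (h, x))) (\<phi> x') = \<phi> (ps_act P g (ps_act P h x'))"
      using Q.act_mult[OF _ 4] e1 e2 by simp
    moreover have "ps_act P (ps_mult P g h) x' = ps_act P g (ps_act P h x')"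
      by (rule P.act_mult[OF h'(1) g'(1)])
    ultimately show "a (ps_mult P g h, x) \<in> ps_at Q y \<and> ps_mult Q (a (g, ps_act P h x)) (a (h, x)) \<in> ps_at Q y \<and>
        ps_act Q (a (ps_mult P g h, x)) y = ps_act Q (ps_mult Q (a (g, ps_act P h x)) (a (h, x))) y"
      using e3 x'(2) by simp
  qed
qed (use cont eqv in auto)

text \<open>Carrying \<open>g\<close> to the other side and back gives an element with the same
  action as \<open>g\<close> on a neighbourhood of \<open>x\<close>, so freeness applies
  again.\<close>

lemma orbit_cocycle_inverse:
  assumes tf: "topologically_free P" and hom: "homeomorphic_maps (ps_space P) (ps_space Q) \<phi> \<psi>"
    and a: "continuous_map (transformation_space P) (discrete_topology (carrier (ps_group Q))) a"
      "\<And>g x. g \<in> ps_at P x \<Longrightarrow> a (g, x) \<in> ps_at Q (\<phi> x) \<and> \<phi> (ps_act P g x) = ps_act Q (a (g, x)) (\<phi> x)"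
    and b: "continuous_map (transformation_space Q) (discrete_topology (carrier (ps_group P))) b"
      "\<And>h y. h \<in> ps_at Q y \<Longrightarrow> b (h, y) \<in> ps_at P (\<psi> y) \<and> \<psi> (ps_act Q h y) = ps_act P (b (h, y)) (\<psi> y)"
    and g: "g \<in> ps_at P x"
  shows "b (a (g, x), \<phi> x) = g"
proof -
  interpret QP: psys_pair Q P by unfold_locales
  have \<psi>\<phi>: "\<psi> (\<phi> x) = x" if "x \<in> topspace (ps_space P)" for x using that hom by (simp add: homeomorphic_maps_def)
  have cont_\<phi>: "continuous_map (ps_space P) (ps_space Q) \<phi>" using hom by (simp add: homeomorphic_maps_def)
  define h where "h = a (g, x)"
  have h: "h \<in> ps_at Q (\<phi> x)" using a(2)[OF g] by (simp add: h_def)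
  obtain W1 where W1: "openin (ps_space P) W1" "x \<in> W1" "\<And>x'. x' \<in> W1 \<Longrightarrow> g \<in> ps_at P x' \<and> a (g, x') = h"
    using locally_constant[OF a(1) g] unfolding h_def by blast
  obtain W2 where W2: "openin (ps_space Q) W2" "\<phi> x \<in> W2" "\<And>z. z \<in> W2 \<Longrightarrow> h \<in> ps_at Q z \<and> b (h, z) = b (h, \<phi> x)"
    using QP.locally_constant[OF b(1) h] by blast
  define W where "W = W1 \<inter> {x' \<in> topspace (ps_space P). \<phi> x' \<in> W2}"
  have W: "openin (ps_space P) W" "x \<in> W"
    unfolding W_def using W1 W2 P.at_space[OF g] openin_continuous_map_preimage[OF cont_\<phi> W2(1)] by auto
  have "b (h, \<phi> x) = g"
  proof (rule P.topologically_free_germ[OF tf _ _ W(1)])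
    show "b (h, \<phi> x) \<in> carrier (ps_group P)" "g \<in> carrier (ps_group P)" using b(2)[OF h] g by auto
    fix x' assume "x' \<in> W"
    then have x': "g \<in> ps_at P x'" "a (g, x') = h" "x' \<in> topspace (ps_space P)" "h \<in> ps_at Q (\<phi> x')"
        "b (h, \<phi> x') = b (h, \<phi> x)"
      using W1(3) W2(3) by (auto simp: W_def)
    then show "b (h, \<phi> x) \<in> ps_at P x' \<and> g \<in> ps_at P x' \<and> ps_act P (b (h, \<phi> x)) x' = ps_act P g x'"
      using b(2)[OF x'(4)] a(2)[OF x'(1)] \<psi>\<phi>[OF x'(3)] \<psi>\<phi>[OF P.act_space[OF x'(1)]] by simp
  qed (use W in auto)
  then show ?thesis by (simp add: h_def)
qed

end

lemma coe_imp_cocycle_equivalence: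
  assumes P: "partial_system P" and Q: "partial_system Q"
    and tfP: "topologically_free P" and tfQ: "topologically_free Q"
    and coe: "continuously_orbit_equivalent P Q"
  obtains \<phi> \<psi> a b where "cocycle_equivalence P Q \<phi> \<psi> a b"
proof -
  interpret PQ: psys_pair P Q by unfold_locales (fact P, fact Q)
  interpret QP: psys_pair Q P by unfold_locales
  obtain \<phi> \<psi> a b where hom: "homeomorphic_maps (ps_space P) (ps_space Q) \<phi> \<psi>"
    and a: "continuous_map (transformation_space P) (discrete_topology (carrier (ps_group Q))) a"
    and b: "continuous_map (transformation_space Q) (discrete_topology (carrier (ps_group P))) b"
    and a': "\<forall>(g, x)\<in>topspace (transformation_space P).
           a (g, x) \<in> ps_at Q (\<phi> x) \<and> \<phi> (ps_act P g x) = ps_act Q (a (g, x)) (\<phi> x)"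
    and b': "\<forall>(h, y)\<in>topspace (transformation_space Q).
           b (h, y) \<in> ps_at P (\<psi> y) \<and> \<psi> (ps_act Q h y) = ps_act P (b (h, y)) (\<psi> y)"
    using coe unfolding continuously_orbit_equivalent_def by blast
  have a'': "\<And>g x. g \<in> ps_at P x \<Longrightarrow> a (g, x) \<in> ps_at Q (\<phi> x) \<and> \<phi> (ps_act P g x) = ps_act Q (a (g, x)) (\<phi> x)"
    using a' PQ.P.topspace_transformation_space by fastforce
  have b'': "\<And>h y. h \<in> ps_at Q y \<Longrightarrow> b (h, y) \<in> ps_at P (\<psi> y) \<and> \<psi> (ps_act Q h y) = ps_act P (b (h, y)) (\<psi> y)"
    using b' PQ.Q.topspace_transformation_space by fastforce
  have hom': "homeomorphic_maps (ps_space Q) (ps_space P) \<psi> \<phi>" using hom homeomorphic_maps_sym by blast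
  have h1: "homeomorphic_map (ps_space P) (ps_space Q) \<phi>" "homeomorphic_map (ps_space Q) (ps_space P) \<psi>"
    using hom hom' homeomorphic_maps_map by blast+
  have "cocycle_equivalence P Q \<phi> \<psi> a b"
    unfolding cocycle_equivalence_def
    using hom PQ.orbit_cocycleI[OF tfQ h1(1) a a''] QP.orbit_cocycleI[OF tfP h1(2) b b'']
      PQ.orbit_cocycle_inverse[OF tfP hom a a'' b b''] QP.orbit_cocycle_inverse[OF tfQ hom' b b'' a a''] by blast
  then show thesis using that by blast
qed

lemma cocycle_equivalence_imp_coe:
  assumes P: "partial_system P" and Q: "partial_system Q" and c: "cocycle_equivalence P Q \<phi> \<psi> a b"
  shows "continuously_orbit_equivalent P Q"
proof -
  interpret PQ: psys_pair P Q by unfold_locales (fact P, fact Q)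
  show ?thesis
    unfolding continuously_orbit_equivalent_def
  proof (intro exI conjI)
    show "homeomorphic_maps (ps_space P) (ps_space Q) \<phi> \<psi>"
      "continuous_map (transformation_space P) (discrete_topology (carrier (ps_group Q))) a"
      "continuous_map (transformation_space Q) (discrete_topology (carrier (ps_group P))) b"
      using c by (auto simp: cocycle_equivalence_def orbit_cocycle_def)
    show "\<forall>(g, x)\<in>topspace (transformation_space P). a (g, x) \<in> ps_at Q (\<phi> x) \<and>
        \<phi> (ps_act P g x) = ps_act Q (a (g, x)) (\<phi> x)"
      "\<forall>(h, y)\<in>topspace (transformation_space Q). b (h, y) \<in> ps_at P (\<psi> y) \<and>
        \<psi> (ps_act Q h y) = ps_act P (b (h, y)) (\<psi> y)"
      using c PQ.P.topspace_transformation_space PQ.Q.topspace_transformation_space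
      by (auto simp: cocycle_equivalence_def orbit_cocycle_def)
  qed
qed

section \<open>Cocycle pairs and groupoid isomorphisms\<close>

locale cocycle_pair = psys_pair P Q
  for P :: "('g, 'x) partial_system_data" and Q :: "('h, 'y) partial_system_data" +
  fixes \<phi> :: "'x \<Rightarrow> 'y" and \<psi> :: "'y \<Rightarrow> 'x" and a :: "'g \<times> 'x \<Rightarrow> 'h" and b :: "'h \<times> 'y \<Rightarrow> 'g"
  assumes equivalence: "cocycle_equivalence P Q \<phi> \<psi> a b"
begin

lemma swap: "cocycle_pair Q P \<psi> \<phi> b a"
  by unfold_locales (rule cocycle_equivalence_sym[OF equivalence])

lemma homeo: "homeomorphic_maps (ps_space P) (ps_space Q) \<phi> \<psi>"
  and cont_\<phi>: "continuous_map (ps_space P) (ps_space Q) \<phi>"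
  and \<psi>_\<phi>: "x \<in> topspace (ps_space P) \<Longrightarrow> \<psi> (\<phi> x) = x"
  and cont_a: "continuous_map (transformation_space P) (discrete_topology (carrier (ps_group Q))) a"
  and a_at: "g \<in> ps_at P x \<Longrightarrow> a (g, x) \<in> ps_at Q (\<phi> x)"
  and \<phi>_act: "g \<in> ps_at P x \<Longrightarrow> \<phi> (ps_act P g x) = ps_act Q (a (g, x)) (\<phi> x)"
  and a_mult: "h \<in> ps_at P x \<Longrightarrow> g \<in> ps_at P (ps_act P h x) \<Longrightarrow>
    a (ps_mult P g h, x) = ps_mult Q (a (g, ps_act P h x)) (a (h, x))"
  and b_a: "g \<in> ps_at P x \<Longrightarrow> b (a (g, x), \<phi> x) = g"
  using equivalence by (simp_all add: cocycle_equivalence_def orbit_cocycle_def homeomorphic_maps_def)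

lemma \<phi>_space: "x \<in> topspace (ps_space P) \<Longrightarrow> \<phi> x \<in> topspace (ps_space Q)"
  using cont_\<phi> by (auto simp: continuous_map_def)

text \<open>By the cocycle identity the value at the unit arrow is an idempotent of a group.\<close>

lemma a_one:
  assumes "x \<in> topspace (ps_space P)"
  shows "a (ps_one P, x) = ps_one Q"
proof -
  have e: "ps_one P \<in> ps_at P x" by (rule P.one_at[OF assms])
  have "a (ps_one P, x) = ps_mult Q (a (ps_one P, x)) (a (ps_one P, x))"
    using a_mult[OF e, of "ps_one P"] e P.act_one[OF assms] by simp
  then show ?thesis using a_at[OF e] Q.at_carrier Q.grp.r_cancel_one' by metis
qed

lemma a_inv:
  assumes g: "g \<in> ps_at P x"
  shows "a (ps_inv P g, ps_act P g x) = ps_inv Q (a (g, x))"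
proof -
  have i: "ps_inv P g \<in> ps_at P (ps_act P g x)" by (rule P.inv_at[OF g])
  have "ps_mult Q (a (ps_inv P g, ps_act P g x)) (a (g, x)) = ps_one Q"
    using a_mult[OF g i] a_one[OF P.at_space[OF g]] P.at_carrier[OF g] by simp
  then show ?thesis
    using a_at[OF g] a_at[OF i] Q.at_carrier Q.grp.inv_equality by metis
qed

lemma continuous_groupoid_map:
  "continuous_map (transformation_space P) (transformation_space Q) (\<lambda>(g, x). (a (g, x), \<phi> x))"
  unfolding transformation_space_def[of Q]
proof (rule continuous_map_into_subtopology)
  have "continuous_map (transformation_space P) (ps_space P) snd"
    unfolding transformation_space_def by (intro continuous_map_from_subtopology continuous_map_snd)
  then have "continuous_map (transformation_space P) (ps_space Q) (\<phi> \<circ> snd)"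
    using cont_\<phi> by (rule continuous_map_compose)
  then show "continuous_map (transformation_space P)
      (prod_topology (discrete_topology (carrier (ps_group Q))) (ps_space Q)) (\<lambda>(g, x). (a (g, x), \<phi> x))"
    using cont_a by (simp add: continuous_map_pairwise o_def split_def)
  show "(\<lambda>(g, x). (a (g, x), \<phi> x)) \<in> topspace (transformation_space P) \<rightarrow>
      {(g, x). g \<in> carrier (ps_group Q) \<and> x \<in> ps_dom Q (ps_inv Q g)}"
    using a_at P.topspace_transformation_space by (auto simp: Q.at_iff)
qed

end

lemma (in cocycle_pair) groupoid_isomorphism:
  "isomorphic_topological_groupoids (transformation_groupoid P) (transformation_groupoid Q)"
proof -
  interpret S: cocycle_pair Q P \<psi> \<phi> b a by (rule swap)
  let ?\<Theta> = "\<lambda>(g, x). (a (g, x), \<phi> x)" and ?\<Theta>' = "\<lambda>(h, y). (b (h, y), \<psi> y)"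
  have "homeomorphic_maps (transformation_space P) (transformation_space Q) ?\<Theta> ?\<Theta>'"
    unfolding homeomorphic_maps_def
    using continuous_groupoid_map S.continuous_groupoid_map b_a S.b_a \<psi>_\<phi> S.\<psi>_\<phi>
      P.topspace_transformation_space Q.topspace_transformation_space P.at_space Q.at_space by auto
  then have "homeomorphic_map (transformation_space P) (transformation_space Q) ?\<Theta>"
    using homeomorphic_maps_map by blast
  moreover have "homeomorphic_map (ps_space P) (ps_space Q) \<phi>"
    using homeo homeomorphic_maps_map by blast
  ultimately have "topological_groupoid_isomorphism (transformation_groupoid P) (transformation_groupoid Q) ?\<Theta> \<phi>"
    using \<phi>_act a_inv a_mult P.topspace_transformation_space
    by (auto simp: topological_groupoid_isomorphism_def transformation_groupoid_def)
  then show ?thesis unfolding isomorphic_topological_groupoids_def by blast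
qed

text \<open>Stated for a single map rather than an isomorphism, so that it serves
  \<open>\<Theta>\<close> and its inverse alike.\<close>

lemma (in psys_pair) orbit_cocycle_of_groupoid_map:
  assumes \<Theta>: "continuous_map (transformation_space P) (transformation_space Q) \<Theta>"
    and src: "\<And>g x. g \<in> ps_at P x \<Longrightarrow> snd (\<Theta> (g, x)) = \<theta> x"
    and rng: "\<And>g x. g \<in> ps_at P x \<Longrightarrow> ps_act Q (fst (\<Theta> (g, x))) (snd (\<Theta> (g, x))) = \<theta> (ps_act P g x)"
    and comp: "\<And>g h x. h \<in> ps_at P x \<Longrightarrow> g \<in> ps_at P (ps_act P h x) \<Longrightarrow>
      fst (\<Theta> (ps_mult P g h, x)) = ps_mult Q (fst (\<Theta> (g, ps_act P h x))) (fst (\<Theta> (h, x)))"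
  shows "orbit_cocycle P Q \<theta> (fst \<circ> \<Theta>)"
  unfolding orbit_cocycle_def
proof (intro conjI allI impI)
  have "continuous_map (transformation_space Q) (discrete_topology (carrier (ps_group Q))) fst"
    unfolding transformation_space_def by (intro continuous_map_from_subtopology continuous_map_fst)
  then show "continuous_map (transformation_space P) (discrete_topology (carrier (ps_group Q))) (fst \<circ> \<Theta>)"
    by (rule continuous_map_compose[OF \<Theta>])
next
  fix g x assume g: "g \<in> ps_at P x"
  have "\<Theta> (g, x) \<in> topspace (transformation_space Q)"
    using \<Theta> P.topspace_transformation_space[of g x] g by (auto simp: continuous_map_def)
  then have "(fst (\<Theta> (g, x)), snd (\<Theta> (g, x))) \<in> topspace (transformation_space Q)" by simp
  then show "(fst \<circ> \<Theta>) (g, x) \<in> ps_at Q (\<theta> x)"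
    unfolding Q.topspace_transformation_space src[OF g] by simp
  show "\<theta> (ps_act P g x) = ps_act Q ((fst \<circ> \<Theta>) (g, x)) (\<theta> x)"
    using src[OF g] rng[OF g] by simp
qed (use comp in simp)

lemma groupoid_isomorphism_imp_cocycle_equivalence:
  assumes P: "partial_system P" and Q: "partial_system Q"
    and iso: "isomorphic_topological_groupoids (transformation_groupoid P) (transformation_groupoid Q)"
  obtains \<phi> \<psi> a b where "cocycle_equivalence P Q \<phi> \<psi> a b"
proof -
  interpret PQ: psys_pair P Q by unfold_locales (fact P, fact Q)
  interpret QP: psys_pair Q P by unfold_locales
  note tsP = PQ.P.topspace_transformation_space and tsQ = PQ.Q.topspace_transformation_space
  obtain \<Theta> \<theta> where "topological_groupoid_isomorphism (transformation_groupoid P) (transformation_groupoid Q) \<Theta> \<theta>"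
    using iso unfolding isomorphic_topological_groupoids_def by blast
  note I = this[unfolded topological_groupoid_isomorphism_def transformation_groupoid_def, simplified]
  have hm: "homeomorphic_map (transformation_space P) (transformation_space Q) \<Theta>"
    and hm\<theta>: "homeomorphic_map (ps_space P) (ps_space Q) \<theta>" using I by auto
  have src: "snd (\<Theta> (g, x)) = \<theta> x" and rng: "ps_act Q (fst (\<Theta> (g, x))) (snd (\<Theta> (g, x))) = \<theta> (ps_act P g x)"
    if "g \<in> ps_at P x" for g x
    using I that tsP[of g x] by (auto simp: split_beta)
  have comp: "\<Theta> (ps_mult P g h, x) = (ps_mult Q (fst (\<Theta> (g, ps_act P h x))) (fst (\<Theta> (h, x))), snd (\<Theta> (h, x)))"
    if h: "h \<in> ps_at P x" and g: "g \<in> ps_at P (ps_act P h x)" for g h x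
  proof -
    have "(g, ps_act P h x) \<in> topspace (transformation_space P)" "(h, x) \<in> topspace (transformation_space P)"
      using tsP h g by auto
    moreover have "\<forall>\<gamma>\<in>topspace (transformation_space P). \<forall>\<eta>\<in>topspace (transformation_space P).
        snd \<gamma> = ps_act P (fst \<eta>) (snd \<eta>) \<longrightarrow>
        \<Theta> (ps_mult P (fst \<gamma>) (fst \<eta>), snd \<eta>) = (ps_mult Q (fst (\<Theta> \<gamma>)) (fst (\<Theta> \<eta>)), snd (\<Theta> \<eta>))"
      using I by (simp add: split_beta)
    ultimately show ?thesis by fastforce
  qed
  obtain \<Theta>' where \<Theta>': "homeomorphic_maps (transformation_space P) (transformation_space Q) \<Theta> \<Theta>'"
    using hm homeomorphic_map_maps by blast
  obtain \<theta>' where \<theta>': "homeomorphic_maps (ps_space P) (ps_space Q) \<theta> \<theta>'"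
    using hm\<theta> homeomorphic_map_maps by blast
  have inv1: "\<Theta>' (\<Theta> (g, x)) = (g, x)" if "g \<in> ps_at P x" for g x
    using \<Theta>' tsP that by (auto simp: homeomorphic_maps_def)
  have inv2: "\<Theta> (\<Theta>' (h, y)) = (h, y)" and mem: "\<Theta>' (h, y) \<in> topspace (transformation_space P)" if "h \<in> ps_at Q y" for h y
    using \<Theta>' tsQ[of h y] that by (auto simp: homeomorphic_maps_def continuous_map_def)
  have inv3: "\<theta>' (\<theta> x) = x" if "x \<in> topspace (ps_space P)" for x
    using \<theta>' that by (auto simp: homeomorphic_maps_def)
  \<comment> \<open>The isomorphism predicate speaks of \<open>\<Theta>\<close> only. Writing each
    arrow over \<open>Q\<close> as the image of an arrow over \<open>P\<close> transfers source,
    range and composition to the inverse.\<close>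
  have arrow: "\<exists>g. g \<in> ps_at P (\<theta>' y) \<and> \<Theta>' (h, y) = (g, \<theta>' y) \<and> \<Theta> (g, \<theta>' y) = (h, y)" if h: "h \<in> ps_at Q y" for h y
  proof -
    obtain g x where gx: "\<Theta>' (h, y) = (g, x)" by (cases "\<Theta>' (h, y)")
    then have g: "g \<in> ps_at P x" using mem[OF h] tsP by simp
    have eq: "\<Theta> (g, x) = (h, y)" using inv2[OF h] gx by simp
    then have "\<theta>' y = x" using src[OF g] inv3 PQ.P.at_space[OF g] by simp
    then show ?thesis using g gx eq by blast
  qed
  have oc1: "orbit_cocycle P Q \<theta> (fst \<circ> \<Theta>)"
    by (rule PQ.orbit_cocycle_of_groupoid_map)
       (use \<Theta>' src rng comp in \<open>auto simp: homeomorphic_maps_def\<close>)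
  have oc2: "orbit_cocycle Q P \<theta>' (fst \<circ> \<Theta>')"
  proof (rule QP.orbit_cocycle_of_groupoid_map)
    show "continuous_map (transformation_space Q) (transformation_space P) \<Theta>'"
      using \<Theta>' by (simp add: homeomorphic_maps_def)
    have rng': "ps_act P g (\<theta>' y) = \<theta>' (ps_act Q h y)" if "g \<in> ps_at P (\<theta>' y)" "\<Theta> (g, \<theta>' y) = (h, y)" for g h y
      using rng[OF that(1)] that inv3[OF PQ.P.act_space[OF that(1)]] by simp
    show "snd (\<Theta>' (h, y)) = \<theta>' y" if "h \<in> ps_at Q y" for h y using arrow[OF that] by auto
    show "ps_act P (fst (\<Theta>' (h, y))) (snd (\<Theta>' (h, y))) = \<theta>' (ps_act Q h y)" if h: "h \<in> ps_at Q y" for h y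
      using arrow[OF h] rng' by auto
    fix h k y assume k: "k \<in> ps_at Q y" and h: "h \<in> ps_at Q (ps_act Q k y)"
    obtain g where g: "g \<in> ps_at P (\<theta>' y)" "\<Theta>' (k, y) = (g, \<theta>' y)" "\<Theta> (g, \<theta>' y) = (k, y)"
      using arrow[OF k] by blast
    obtain g' where g': "g' \<in> ps_at P (\<theta>' (ps_act Q k y))" "\<Theta>' (h, ps_act Q k y) = (g', \<theta>' (ps_act Q k y))"
        "\<Theta> (g', \<theta>' (ps_act Q k y)) = (h, ps_act Q k y)"
      using arrow[OF h] by blast
    have r: "\<theta>' (ps_act Q k y) = ps_act P g (\<theta>' y)" using rng'[OF g(1,3)] by simp
    have g'2: "g' \<in> ps_at P (ps_act P g (\<theta>' y))" using g'(1) r by simp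
    have "\<Theta> (ps_mult P g' g, \<theta>' y) = (ps_mult Q h k, y)"
      using comp[OF g(1) g'2] g(3) g'(3) r by simp
    moreover have "ps_mult P g' g \<in> ps_at P (\<theta>' y)"
      using PQ.P.at_mult_iff[OF g(1), of g'] g'2 PQ.P.at_carrier by blast
    ultimately have "\<Theta>' (ps_mult Q h k, y) = (ps_mult P g' g, \<theta>' y)" using inv1 by metis
    then show "fst (\<Theta>' (ps_mult Q h k, y)) = ps_mult P (fst (\<Theta>' (h, ps_act Q k y))) (fst (\<Theta>' (k, y)))"
      using g(2) g'(2) by simp
  qed
  have "(fst \<circ> \<Theta>') ((fst \<circ> \<Theta>) (g, x), \<theta> x) = g" if "g \<in> ps_at P x" for g x
    using inv1[OF that] src[OF that] by (metis comp_apply fst_conv prod.collapse)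
  moreover have "(fst \<circ> \<Theta>) ((fst \<circ> \<Theta>') (h, y), \<theta>' y) = h" if "h \<in> ps_at Q y" for h y
    using arrow[OF that] by auto
  ultimately have "cocycle_equivalence P Q \<theta> \<theta>' (fst \<circ> \<Theta>) (fst \<circ> \<Theta>')"
    unfolding cocycle_equivalence_def using \<theta>' oc1 oc2 by blast
  then show thesis using that by blast
qed

section \<open>From groupoid isomorphisms to isomorphisms of crossed products\<close>

text \<open>Radial soft thresholding: the modulus is reduced by \<open>\<delta>\<close>, and the
  disc of radius \<open>\<delta>\<close> goes to 0. The maximum keeps the quotient continuous at the
  origin.\<close>

definition soft_cut :: "real \<Rightarrow> complex \<Rightarrow> complex" where
  "soft_cut \<delta> z = z * of_real (1 - \<delta> / max \<delta> (cmod z))"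

lemma soft_cut:
  assumes "\<delta> > 0"
  shows "continuous_on UNIV (soft_cut \<delta>)" "cmod z \<le> \<delta> \<Longrightarrow> soft_cut \<delta> z = 0" "cmod (z - soft_cut \<delta> z) \<le> \<delta>"
proof -
  have pos: "max \<delta> (cmod z) > 0" for z using assms by simp
  show "continuous_on UNIV (soft_cut \<delta>)"
    unfolding soft_cut_def
    by (intro continuous_intros) (use pos in \<open>auto simp: less_le\<close>)
  show "soft_cut \<delta> z = 0" if "cmod z \<le> \<delta>"
    using that assms by (simp add: soft_cut_def max_absorb1)
  have "z - soft_cut \<delta> z = z * of_real (\<delta> / max \<delta> (cmod z))"
    by (simp add: soft_cut_def algebra_simps)
  then have "cmod (z - soft_cut \<delta> z) = cmod z * (\<delta> / max \<delta> (cmod z))"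
    using assms pos[of z] by (simp add: norm_mult norm_divide)
  also have "\<dots> \<le> \<delta>"
    using assms pos[of z] by (simp add: pos_divide_le_eq mult.commute)
  finally show "cmod (z - soft_cut \<delta> z) \<le> \<delta>" .
qed

text \<open>The compact set lies inside the open domain of \<open>g\<close>, where a cocycle is
  locally constant, so the cocycle takes finitely many values on it.\<close>

definition (in psys) compactly_supported :: "('g \<Rightarrow> 'x \<Rightarrow> complex) \<Rightarrow> bool" where
  "compactly_supported c \<longleftrightarrow> (\<forall>g\<in>carrier (ps_group P).
     \<exists>K. compactin (ps_space P) K \<and> K \<subseteq> ps_dom P g \<and> (\<forall>x. x \<notin> K \<longrightarrow> c g x = 0))"

lemma (in psys) compactly_supported_dense:
  assumes c: "c \<in> cp_carrier P" and e: "\<epsilon> > 0"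
  obtains d where "d \<in> cp_carrier P" "compactly_supported d" "cp_norm P (\<lambda>g x. c g x - d g x) < \<epsilon>"
proof -
  \<comment> \<open>The norm of the error is at most the number of coefficients times
    \<open>\<delta>\<close>; the summand 1 makes the estimate strict and the quotient meaningful for
    empty support.\<close>
  define \<delta> where "\<delta> = \<epsilon> / (card (cp_supp c) + 1)"
  have \<delta>: "\<delta> > 0" using e by (simp add: \<delta>_def add_nonneg_pos)
  define d where "d = (\<lambda>g x. soft_cut \<delta> (c g x))"
  have d0: "d g = (\<lambda>x. 0)" if "g \<notin> cp_supp c" for g
    using that \<delta> by (auto simp: d_def cp_supp_def soft_cut)
  have dC: "d g \<in> C0 (subtopology (ps_space P) (ps_dom P g))" if "g \<in> carrier (ps_group P)" for g
    unfolding d_def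
    by (rule C0_continuous_compose[OF Hausdorff open_dom[OF that] cp_carrierD(3)[OF c that], of UNIV])
       (use \<delta> soft_cut in auto)
  have d: "d \<in> cp_carrier P"
    by (rule cp_carrierI[OF cp_carrierD(1,2)[OF c] dC d0])
  have "compactly_supported d"
    unfolding compactly_supported_def
  proof
    fix g assume g: "g \<in> carrier (ps_group P)"
    let ?K = "{x \<in> topspace (ps_space P). \<delta> \<le> cmod (c g x)}"
    note cg = cp_carrierD(3)[OF c g, unfolded C0_iff[OF Hausdorff open_dom[OF g]]]
    have "compactin (ps_space P) ?K" using cg \<delta> by blast
    moreover have "?K \<subseteq> ps_dom P g" using cg \<delta> by force
    moreover have "d g x = 0" if "x \<notin> ?K" for x
    proof (cases "x \<in> topspace (ps_space P)")
      case True
      then show ?thesis using that \<delta> by (simp add: d_def soft_cut)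
    next
      case False
      then have "x \<notin> ps_dom P g" using dom_subset[OF g] by blast
      then show ?thesis using cp_off[OF d] by blast
    qed
    ultimately show "\<exists>K. compactin (ps_space P) K \<and> K \<subseteq> ps_dom P g \<and> (\<forall>x. x \<notin> K \<longrightarrow> d g x = 0)" by blast
  qed
  moreover have "cp_norm P (\<lambda>g x. c g x - d g x) < \<epsilon>"
  proof -
    let ?s = "cp_supp (\<lambda>g x. c g x - d g x)"
    have "?s \<subseteq> cp_supp c" using d0 by (auto simp: cp_supp_def)
    then have "card ?s \<le> card (cp_supp c)" using cp_carrierD(1)[OF c] card_mono by blast
    have "cp_norm P (\<lambda>g x. c g x - d g x) \<le> (\<Sum>g\<in>?s. \<delta>)"
      by (rule cp_norm_le_sum[OF cp_diff_closed[OF c d]]) (use soft_cut(3)[OF \<delta>] in \<open>auto simp: d_def\<close>)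
    also have "\<dots> = card ?s * \<delta>" by simp
    also have "\<dots> \<le> card (cp_supp c) * \<delta>" using \<open>card ?s \<le> card (cp_supp c)\<close> \<delta> by (simp add: mult_right_mono)
    also have "\<dots> < (card (cp_supp c) + 1) * \<delta>" using \<delta> by (simp add: algebra_simps)
    also have "\<dots> = \<epsilon>" by (simp add: \<delta>_def)
    finally show ?thesis .
  qed
  ultimately show thesis using that d by blast
qed

section \<open>Transfer of finite sums along a cocycle pair\<close>

context cocycle_pair
begin

text \<open>On functions of arrows this is composition with the groupoid isomorphism; the coefficient of
  \<open>\<delta>\<^sub>h\<close> at \<open>y\<close> belongs to the arrow with \<^emph>\<open>range\<close> \<open>y\<close>.\<close>

definition tr :: "('g \<Rightarrow> 'x \<Rightarrow> complex) \<Rightarrow> 'h \<Rightarrow> 'y \<Rightarrow> complex" where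
  "tr c h y = (if h \<in> carrier (ps_group Q) \<and> y \<in> ps_dom Q h
     then c (b (h, ps_act Q (ps_inv Q h) y)) (\<psi> y) else 0)"

lemma tr_arrow:
  assumes g: "g \<in> ps_at P x"
  shows "tr c (a (g, x)) (\<phi> (ps_act P g x)) = c g (ps_act P g x)"
proof -
  have h: "a (g, x) \<in> ps_at Q (\<phi> x)" by (rule a_at[OF g])
  have "\<phi> (ps_act P g x) \<in> ps_dom Q (a (g, x))" using Q.act_dom[OF h] \<phi>_act[OF g] by simp
  then show ?thesis
    using h \<phi>_act[OF g] Q.act_inv_act[OF h] b_a[OF g] \<psi>_\<phi>[OF P.act_space[OF g]] Q.at_carrier[OF h]
    by (simp add: tr_def)
qed

lemma arrow_exists:
  assumes h: "h \<in> carrier (ps_group Q)" and y: "y \<in> ps_dom Q h"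
  obtains g x where "g \<in> ps_at P x" "h = a (g, x)" "y = \<phi> (ps_act P g x)"
    "\<phi> x = ps_act Q (ps_inv Q h) y" "b (h, ps_act Q (ps_inv Q h) y) = g"
proof -
  interpret S: cocycle_pair Q P \<psi> \<phi> b a by (rule swap)
  define z where "z = ps_act Q (ps_inv Q h) y"
  have hz: "h \<in> ps_at Q z" unfolding z_def by (rule Q.inv_at'[OF h y])
  have g: "b (h, z) \<in> ps_at P (\<psi> z)" by (rule S.a_at[OF hz])
  have az: "a (b (h, z), \<psi> z) = h" by (rule S.b_a[OF hz])
  have \<phi>z: "\<phi> (\<psi> z) = z" by (rule S.\<psi>_\<phi>[OF Q.at_space[OF hz]])
  have "\<phi> (ps_act P (b (h, z)) (\<psi> z)) = ps_act Q h z" unfolding \<phi>_act[OF g] az \<phi>z ..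
  also have "\<dots> = y" unfolding z_def by (rule Q.act_act_inv[OF h y])
  finally show thesis
    by (intro that[OF g az[symmetric]]) (simp_all only: \<phi>z z_def[symmetric])
qed

text \<open>Each pair of \<open>h\<close> and \<open>y\<close> with \<open>y\<close> in the domain
  of \<open>h\<close> comes from an arrow of \<open>P\<close>, by \<open>arrow_exists\<close>; so it
  suffices to compare values on the images of arrows.\<close>

lemma tr_eqI:
  assumes "\<And>h y. h \<notin> carrier (ps_group Q) \<or> y \<notin> ps_dom Q h \<Longrightarrow> d h y = 0"
    and "\<And>g x. g \<in> ps_at P x \<Longrightarrow> d (a (g, x)) (\<phi> (ps_act P g x)) = c g (ps_act P g x)"
  shows "tr c = d"
proof (intro ext)
  fix h y
  show "tr c h y = d h y"
  proof (cases "h \<in> carrier (ps_group Q) \<and> y \<in> ps_dom Q h")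
    case True
    then obtain g x where "g \<in> ps_at P x" "h = a (g, x)" "y = \<phi> (ps_act P g x)"
      using arrow_exists by metis
    then show ?thesis using assms(2) tr_arrow by simp
  next
    case False
    then show ?thesis using assms(1)[of h y] by (auto simp: tr_def)
  qed
qed

lemma tr_tr:
  assumes c: "c \<in> cp_carrier P"
  shows "cocycle_pair.tr P \<phi> a (tr c) = c"
proof -
  interpret S: cocycle_pair Q P \<psi> \<phi> b a by (rule swap)
  show ?thesis
  proof (rule S.tr_eqI)
    show "c g x = 0" if "g \<notin> carrier (ps_group P) \<or> x \<notin> ps_dom P g" for g x
      using P.cp_off[OF c] that by blast
    fix h y assume h: "h \<in> ps_at Q y"
    show "c (b (h, y)) (\<psi> (ps_act Q h y)) = tr c h (ps_act Q h y)"
      using Q.act_dom[OF h] Q.act_inv_act[OF h] h by (auto simp: tr_def)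
  qed
qed

lemma a_mult_inv:
  assumes k: "k \<in> ps_at P x" and h: "h \<in> ps_at P x"
  shows "a (ps_mult P k (ps_inv P h), ps_act P h x) = ps_mult Q (a (k, x)) (ps_inv Q (a (h, x)))"
proof -
  have kh: "ps_mult P k (ps_inv P h) \<in> ps_at P (ps_act P h x)" by (rule P.mult_inv_at(1)[OF k h])
  have "ps_mult P (ps_mult P k (ps_inv P h)) h = k"
    using P.at_carrier[OF k] P.at_carrier[OF h] by (simp add: P.grp.m_assoc)
  then have "a (k, x) = ps_mult Q (a (ps_mult P k (ps_inv P h), ps_act P h x)) (a (h, x))"
    using a_mult[OF h kh] by simp
  then show ?thesis
    using a_at[OF h] a_at[OF kh] Q.at_carrier by (simp add: Q.grp.m_assoc)
qed

text \<open>The matrix at \<open>\<phi> x\<close> is the matrix at \<open>x\<close> with rows and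
  columns renamed by \<open>k \<mapsto> a (k, x)\<close>.\<close>

lemma tr_kernel:
  assumes k: "k \<in> ps_at P x" and h: "h \<in> ps_at P x"
  shows "tr c (ps_mult Q (a (k, x)) (ps_inv Q (a (h, x)))) (\<phi> (ps_act P k x)) =
    c (ps_mult P k (ps_inv P h)) (ps_act P k x)"
  using tr_arrow[OF P.mult_inv_at(1)[OF k h], of c] a_mult_inv[OF k h] P.mult_inv_at(2)[OF k h] by simp

lemma tr_star:
  assumes c: "c \<in> cp_carrier P" and tc: "tr c \<in> cp_carrier Q"
  shows "tr (cp_star P c) = cp_star Q (tr c)"
proof (rule tr_eqI)
  show "cp_star Q (tr c) h y = 0" if "h \<notin> carrier (ps_group Q) \<or> y \<notin> ps_dom Q h" for h y
    using Q.cp_off[OF Q.cp_star_closed[OF tc]] that by blast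
  fix g x assume g: "g \<in> ps_at P x"
  have x: "x \<in> topspace (ps_space P)" by (rule P.at_space[OF g])
  have e: "ps_one P \<in> ps_at P x" "ps_one Q \<in> ps_at Q (\<phi> x)" by (rule P.one_at[OF x], rule Q.one_at[OF \<phi>_space[OF x]])
  have gG: "g \<in> carrier (ps_group P)" and aG: "a (g, x) \<in> carrier (ps_group Q)" using g a_at[OF g] by auto
  have "cp_star Q (tr c) (a (g, x)) (\<phi> (ps_act P g x)) =
      cp_star Q (tr c) (ps_mult Q (a (g, x)) (ps_inv Q (ps_one Q))) (ps_act Q (a (g, x)) (\<phi> x))"
    using \<phi>_act[OF g] aG by simp
  also have "\<dots> = cnj (tr c (ps_mult Q (ps_one Q) (ps_inv Q (a (g, x)))) (ps_act Q (ps_one Q) (\<phi> x)))"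
    by (rule Q.cp_kernel_star[OF tc a_at[OF g] e(2)])
  also have "\<dots> = cnj (c (ps_mult P (ps_one P) (ps_inv P g)) (ps_act P (ps_one P) x))"
    using tr_kernel[OF e(1) g, of c] a_one[OF x] P.act_one[OF x] Q.act_one[OF \<phi>_space[OF x]] by simp
  also have "\<dots> = cp_star P c (ps_mult P g (ps_inv P (ps_one P))) (ps_act P g x)"
    by (rule P.cp_kernel_star[OF c g e(1), symmetric])
  finally show "cp_star Q (tr c) (a (g, x)) (\<phi> (ps_act P g x)) = cp_star P c g (ps_act P g x)"
    using gG by simp
qed

lemma inj_on_a: "inj_on (\<lambda>g. a (g, x)) (ps_at P x)"
  by (rule inj_on_inverseI[of _ "\<lambda>h. b (h, \<phi> x)"]) (rule b_a)

lemma tr_mult: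
  assumes c: "c \<in> cp_carrier P" and tc: "tr c \<in> cp_carrier Q"
    and d: "d \<in> cp_carrier P" and td: "tr d \<in> cp_carrier Q"
  shows "tr (cp_mult P c d) = cp_mult Q (tr c) (tr d)"
proof (rule tr_eqI)
  interpret S: cocycle_pair Q P \<psi> \<phi> b a by (rule swap)
  show "cp_mult Q (tr c) (tr d) h y = 0" if "h \<notin> carrier (ps_group Q) \<or> y \<notin> ps_dom Q h" for h y
    using Q.cp_off[OF Q.cp_mult_closed[OF tc td]] that by blast
  fix g x assume g: "g \<in> ps_at P x"
  have x: "x \<in> topspace (ps_space P)" by (rule P.at_space[OF g])
  have y: "\<psi> (\<phi> x) = x" by (rule \<psi>_\<phi>[OF x])
  have e: "ps_one P \<in> ps_at P x" "ps_one Q \<in> ps_at Q (\<phi> x)" by (rule P.one_at[OF x], rule Q.one_at[OF \<phi>_space[OF x]])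
  have gG: "g \<in> carrier (ps_group P)" and aG: "a (g, x) \<in> carrier (ps_group Q)" using g a_at[OF g] by auto
  \<comment> \<open>Both product formulas are to run over one index set: \<open>F1\<close> covers
    the support of \<open>c\<close>, and \<open>F2\<close>, brought back by \<open>b\<close>, covers
    that of \<open>tr c\<close>.\<close>
  define F1 where "F1 = (\<lambda>k. ps_mult P (ps_inv P k) g) ` cp_supp c \<inter> ps_at P x"
  define F2 where "F2 = (\<lambda>k. ps_mult Q (ps_inv Q k) (a (g, x))) ` cp_supp (tr c) \<inter> ps_at Q (\<phi> x)"
  define F where "F = F1 \<union> (\<lambda>h. b (h, \<phi> x)) ` F2"
  have "b (h, \<phi> x) \<in> ps_at P x" if "h \<in> F2" for h using S.a_at[of h "\<phi> x"] that y by (simp add: F2_def)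
  then have F: "finite F" "F \<subseteq> ps_at P x"
    using P.cp_carrierD(1)[OF c] Q.cp_carrierD(1)[OF tc] by (auto simp: F_def F1_def F2_def)
  have aF: "finite ((\<lambda>l. a (l, x)) ` F)" "(\<lambda>l. a (l, x)) ` F \<subseteq> ps_at Q (\<phi> x)" using F a_at by auto
  have F2: "F2 \<subseteq> (\<lambda>l. a (l, x)) ` F"
  proof
    fix h assume h: "h \<in> F2"
    then have "a (b (h, \<phi> x), x) = h" using S.b_a[of h "\<phi> x"] y by (simp add: F2_def)
    then show "h \<in> (\<lambda>l. a (l, x)) ` F" using h by (force simp: F_def)
  qed
  have "cp_mult Q (tr c) (tr d) (a (g, x)) (\<phi> (ps_act P g x)) =
      cp_mult Q (tr c) (tr d) (ps_mult Q (a (g, x)) (ps_inv Q (ps_one Q))) (ps_act Q (a (g, x)) (\<phi> x))"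
    using \<phi>_act[OF g] aG by simp
  also have "\<dots> = (\<Sum>l\<in>(\<lambda>l. a (l, x)) ` F. tr c (ps_mult Q (a (g, x)) (ps_inv Q l)) (ps_act Q (a (g, x)) (\<phi> x)) *
      tr d (ps_mult Q l (ps_inv Q (ps_one Q))) (ps_act Q l (\<phi> x)))"
    by (rule Q.cp_kernel_mult[OF tc td a_at[OF g] e(2) aF]) (use F2 in \<open>auto simp: F2_def\<close>)
  also have "\<dots> = (\<Sum>l\<in>F. tr c (ps_mult Q (a (g, x)) (ps_inv Q (a (l, x)))) (ps_act Q (a (g, x)) (\<phi> x)) *
      tr d (ps_mult Q (a (l, x)) (ps_inv Q (ps_one Q))) (ps_act Q (a (l, x)) (\<phi> x)))"
    using sum.reindex[OF inj_on_subset[OF inj_on_a F(2)]] by simp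
  also have "\<dots> = (\<Sum>l\<in>F. c (ps_mult P g (ps_inv P l)) (ps_act P g x) * d (ps_mult P l (ps_inv P (ps_one P))) (ps_act P l x))"
  proof (rule sum.cong[OF refl])
    fix l assume "l \<in> F"
    then have l: "l \<in> ps_at P x" using F(2) by blast
    show "tr c (ps_mult Q (a (g, x)) (ps_inv Q (a (l, x)))) (ps_act Q (a (g, x)) (\<phi> x)) *
        tr d (ps_mult Q (a (l, x)) (ps_inv Q (ps_one Q))) (ps_act Q (a (l, x)) (\<phi> x)) =
        c (ps_mult P g (ps_inv P l)) (ps_act P g x) * d (ps_mult P l (ps_inv P (ps_one P))) (ps_act P l x)"
      using tr_kernel[OF g l, of c] tr_kernel[OF l e(1), of d] a_one[OF x] \<phi>_act[OF g] \<phi>_act[OF l] by simp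
  qed
  also have "\<dots> = cp_mult P c d (ps_mult P g (ps_inv P (ps_one P))) (ps_act P g x)"
    by (rule P.cp_kernel_mult[OF c d g e(1) F, symmetric]) (auto simp: F_def F1_def)
  finally show "cp_mult Q (tr c) (tr d) (a (g, x)) (\<phi> (ps_act P g x)) = cp_mult P c d g (ps_act P g x)"
    using gG by simp
qed

lemma tr_add: "tr (\<lambda>g x. c g x + d g x) = (\<lambda>h y. tr c h y + tr d h y)"
  and tr_scale: "tr (\<lambda>g x. z * c g x) = (\<lambda>h y. z * tr c h y)"
  and tr_diff: "tr (\<lambda>g x. c g x - d g x) = (\<lambda>h y. tr c h y - tr d h y)"
  by (simp_all add: tr_def fun_eq_iff)

text \<open>Renaming rows and columns at \<open>y\<close> by \<open>b\<close> changes neither the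
  matrix entries nor the norms of the test vectors. The swapped pair will give the reverse
  inequality.\<close>

lemma tr_norm_le:
  assumes c: "c \<in> cp_carrier P" and tc: "tr c \<in> cp_carrier Q"
  shows "cp_norm Q (tr c) \<le> cp_norm P c"
  unfolding Q.cp_norm_le_iff[OF tc P.cp_norm_nonneg[OF c]] Q.cp_bound_def cp_bound_at_def
proof (intro ballI allI impI, elim conjE)
  interpret S: cocycle_pair Q P \<psi> \<phi> b a by (rule swap)
  fix y F F' and \<eta> \<xi> :: "'h \<Rightarrow> complex"
  assume y: "y \<in> topspace (ps_space Q)" and F: "finite F" "finite F'" "F \<subseteq> ps_at Q y" "F' \<subseteq> ps_at Q y"
  let ?b = "\<lambda>k. b (k, y)" and ?a = "\<lambda>k. a (k, \<psi> y)"
  have inj: "inj_on ?b F" "inj_on ?b F'" using S.inj_on_a F inj_on_subset by blast+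
  have bat: "?b ` F \<subseteq> ps_at P (\<psi> y)" "?b ` F' \<subseteq> ps_at P (\<psi> y)" using S.a_at F by blast+
  have ab: "?a (?b k) = k" if "k \<in> ps_at Q y" for k by (rule S.b_a[OF that])
  have "(\<Sum>k\<in>F. \<Sum>h\<in>F'. \<eta> k * (tr c (ps_mult Q k (ps_inv Q h)) (ps_act Q k y) * \<xi> h)) =
      (\<Sum>k\<in>F. \<Sum>h\<in>F'. \<eta> (?a (?b k)) * (c (ps_mult P (?b k) (ps_inv P (?b h))) (ps_act P (?b k) (\<psi> y)) * \<xi> (?a (?b h))))"
  proof (intro sum.cong refl)
    fix k h assume kh: "k \<in> F" "h \<in> F'"
    then have k: "k \<in> ps_at Q y" "h \<in> ps_at Q y" using F by auto
    have "\<phi> (ps_act P (?b k) (\<psi> y)) = ps_act Q k y"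
      using \<phi>_act[OF S.a_at[OF k(1)]] ab[OF k(1)] S.\<psi>_\<phi>[OF y] by simp
    then have "tr c (ps_mult Q k (ps_inv Q h)) (ps_act Q k y) =
        c (ps_mult P (?b k) (ps_inv P (?b h))) (ps_act P (?b k) (\<psi> y))"
      using tr_kernel[OF S.a_at[OF k(1)] S.a_at[OF k(2)], of c] ab k by simp
    then show "\<eta> k * (tr c (ps_mult Q k (ps_inv Q h)) (ps_act Q k y) * \<xi> h) =
        \<eta> (?a (?b k)) * (c (ps_mult P (?b k) (ps_inv P (?b h))) (ps_act P (?b k) (\<psi> y)) * \<xi> (?a (?b h)))"
      using ab k by simp
  qed
  also have "\<dots> = (\<Sum>k\<in>?b ` F. \<Sum>h\<in>?b ` F'.
      \<eta> (?a k) * (c (ps_mult P k (ps_inv P h)) (ps_act P k (\<psi> y)) * \<xi> (?a h)))"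
    by (simp add: sum.reindex inj)
  finally have eq: "(\<Sum>k\<in>F. \<Sum>h\<in>F'. \<eta> k * (tr c (ps_mult Q k (ps_inv Q h)) (ps_act Q k y) * \<xi> h)) =
      (\<Sum>k\<in>?b ` F. \<Sum>h\<in>?b ` F'. \<eta> (?a k) * (c (ps_mult P k (ps_inv P h)) (ps_act P k (\<psi> y)) * \<xi> (?a h)))" .
  have n: "L2_set (\<lambda>k. cmod (\<eta> (?a k))) (?b ` F) = L2_set (\<lambda>k. cmod (\<eta> k)) F"
    "L2_set (\<lambda>k. cmod (\<xi> (?a k))) (?b ` F') = L2_set (\<lambda>k. cmod (\<xi> k)) F'"
    unfolding L2_set_reindex[OF inj(1)] L2_set_reindex[OF inj(2)] using ab F by (auto intro!: L2_set_cong)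
  have bd: "cp_bound_at P (\<psi> y) (cp_norm P c) c"
    using P.cp_bound_norm[OF c] S.\<phi>_space[OF y] unfolding P.cp_bound_def by blast
  show "cmod (\<Sum>k\<in>F. \<Sum>h\<in>F'. \<eta> k * (tr c (ps_mult Q k (ps_inv Q h)) (ps_act Q k y) * \<xi> h)) \<le>
      L2_set (\<lambda>k. cmod (\<eta> k)) F * (cp_norm P c * L2_set (\<lambda>h. cmod (\<xi> h)) F')"
    unfolding eq n[symmetric]
    by (rule bd[unfolded cp_bound_at_def, rule_format]) (use F bat in simp)
qed

lemma tr_norm:
  assumes c: "c \<in> cp_carrier P" and tc: "tr c \<in> cp_carrier Q"
  shows "cp_norm Q (tr c) = cp_norm P c"
proof -
  interpret S: cocycle_pair Q P \<psi> \<phi> b a by (rule swap)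
  show ?thesis using tr_norm_le[OF c tc] S.tr_norm_le[OF tc] tr_tr[OF c] c by simp
qed

text \<open>Coefficients are functions of the range of an arrow, so the cocycle is needed as a
  function of the range \<open>z\<close>, the source being \<open>g^{-1}.z\<close>.\<close>

lemma continuous_range_cocycle:
  assumes g: "g \<in> carrier (ps_group P)"
  shows "continuous_map (subtopology (ps_space P) (ps_dom P g)) (discrete_topology (carrier (ps_group Q)))
    (\<lambda>z. a (g, ps_act P (ps_inv P g) z))"
proof -
  let ?U = "subtopology (ps_space P) (ps_dom P g)"
  have "continuous_map ?U (ps_space P) (ps_act P (ps_inv P g))"
    using homeomorphic_imp_continuous_map[OF P.homeo_act[of "ps_inv P g"]] g continuous_map_into_fulltopology by auto
  then have "continuous_map ?U (prod_topology (discrete_topology (carrier (ps_group P))) (ps_space P))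
      (\<lambda>z. (g, ps_act P (ps_inv P g) z))"
    using g by (simp add: continuous_map_paired)
  then have "continuous_map ?U (transformation_space P) (\<lambda>z. (g, ps_act P (ps_inv P g) z))"
    unfolding transformation_space_def
    using P.topspace_dom[OF g] P.inv_at'[OF g] by (auto simp: continuous_map_in_subtopology P.at_iff)
  from continuous_map_compose[OF this cont_a] show ?thesis by (simp add: o_def)
qed

text \<open>On the compact set \<open>K g\<close> the cocycle takes finitely many values, so
  finitely many \<open>h\<close> occur; each of its level sets in \<open>K g\<close> is again
  compact.\<close>

lemma tr_compactly_supported:
  assumes c: "c \<in> cp_carrier P" and cs: "P.compactly_supported c"
  shows "tr c \<in> cp_carrier Q"
proof -
  interpret S: cocycle_pair Q P \<psi> \<phi> b a by (rule swap)
  note sub = P.cp_carrierD(2)[OF c] and fin = P.cp_carrierD(1)[OF c]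
  obtain K where K: "\<And>g. g \<in> carrier (ps_group P) \<Longrightarrow> compactin (ps_space P) (K g)"
      "\<And>g. g \<in> carrier (ps_group P) \<Longrightarrow> K g \<subseteq> ps_dom P g"
      "\<And>g x. g \<in> carrier (ps_group P) \<Longrightarrow> x \<notin> K g \<Longrightarrow> c g x = 0"
    using cs unfolding P.compactly_supported_def by metis
  define \<alpha> where "\<alpha> g z = a (g, ps_act P (ps_inv P g) z)" for g z
  have K': "compactin (subtopology (ps_space P) (ps_dom P g)) (K g)" if "g \<in> carrier (ps_group P)" for g
    using K(1,2)[OF that] by (simp add: compactin_subtopology)
  have \<alpha>: "continuous_map (subtopology (ps_space P) (ps_dom P g)) (discrete_topology (carrier (ps_group Q))) (\<alpha> g)"
    if "g \<in> carrier (ps_group P)" for g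
    using continuous_range_cocycle[OF that] by (simp add: \<alpha>_def[abs_def])
  \<comment> \<open>Contains the support of \<open>tr c h\<close>: the points whose arrow comes from
    some \<open>g\<close> and \<open>K g\<close> and is sent to \<open>h\<close>.\<close>
  define L where "L h = (\<Union>g\<in>cp_supp c. \<phi> ` {z \<in> K g. \<alpha> g z = h})" for h
  have nz: "y \<in> L h" if h: "h \<in> carrier (ps_group Q)" and t: "tr c h y \<noteq> 0" for h y
  proof -
    have yh: "y \<in> ps_dom Q h" using t by (auto simp: tr_def split: if_splits)
    obtain g x where gx: "g \<in> ps_at P x" "h = a (g, x)" "y = \<phi> (ps_act P g x)"
      by (rule arrow_exists[OF h yh]) (rule that)
    have cg: "c g (ps_act P g x) \<noteq> 0" using t gx tr_arrow[OF gx(1), of c] by simp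
    have "g \<in> cp_supp c" using cg cp_supp_zero by metis
    moreover have "ps_act P g x \<in> K g" using K(3)[OF P.at_carrier[OF gx(1)]] cg by blast
    moreover have "\<alpha> g (ps_act P g x) = h" using gx(2) P.act_inv_act[OF gx(1)] by (simp add: \<alpha>_def)
    ultimately show ?thesis using gx(3) by (auto simp: L_def)
  qed
  have L: "compactin (ps_space Q) (L h)" "L h \<subseteq> ps_dom Q h" if h: "h \<in> carrier (ps_group Q)" for h
  proof -
    have "compactin (ps_space Q) (\<phi> ` {z \<in> K g. \<alpha> g z = h})" if g: "g \<in> cp_supp c" for g
    proof -
      have gG: "g \<in> carrier (ps_group P)" using g sub by blast
      have "closedin (subtopology (ps_space P) (ps_dom P g))
          {z \<in> topspace (subtopology (ps_space P) (ps_dom P g)). \<alpha> g z \<in> {h}}"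
        by (rule closedin_continuous_map_preimage[OF \<alpha>[OF gG]]) (use h in simp)
      from closed_Int_compactin[OF this K'[OF gG]]
      have "compactin (subtopology (ps_space P) (ps_dom P g)) {z \<in> K g. \<alpha> g z = h}"
        using K(2)[OF gG] P.topspace_dom[OF gG] by (elim back_subst[where P = "compactin _"]) auto
      then have "compactin (ps_space P) {z \<in> K g. \<alpha> g z = h}" by (simp add: compactin_subtopology)
      then show ?thesis by (rule image_compactin[OF _ cont_\<phi>])
    qed
    then show "compactin (ps_space Q) (L h)" unfolding L_def using fin by (intro compactin_Union) auto
    show "L h \<subseteq> ps_dom Q h"
    proof
      fix y assume "y \<in> L h"
      then obtain g z where g: "g \<in> cp_supp c" "z \<in> K g" "\<alpha> g z = h" "y = \<phi> z" by (auto simp: L_def)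
      then have gG: "g \<in> carrier (ps_group P)" using sub by blast
      have zg: "z \<in> ps_dom P g" using g K(2)[OF gG] by blast
      have at: "g \<in> ps_at P (ps_act P (ps_inv P g) z)" by (rule P.inv_at'[OF gG zg])
      show "y \<in> ps_dom Q h"
        using Q.act_dom[OF a_at[OF at]] \<phi>_act[OF at] P.act_act_inv[OF gG zg] g by (simp add: \<alpha>_def)
    qed
  qed
  show ?thesis
  proof (rule Q.cp_carrierI)
    let ?S = "\<Union>g\<in>cp_supp c. \<alpha> g ` K g"
    have im: "compactin (discrete_topology (carrier (ps_group Q))) (\<alpha> g ` K g)" if "g \<in> cp_supp c" for g
      using that sub by (intro image_compactin[OF K' \<alpha>]) auto
    then show "finite ?S" "?S \<subseteq> carrier (ps_group Q)"
      using fin by (auto simp: compactin_discrete_topology)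
    show "tr c h = (\<lambda>y. 0)" if "h \<notin> ?S" for h
    proof (rule ext, rule ccontr)
      fix y assume t: "tr c h y \<noteq> 0"
      then have "h \<in> carrier (ps_group Q)" by (auto simp: tr_def split: if_splits)
      from nz[OF this t] show False using that by (auto simp: L_def)
    qed
    fix h assume h: "h \<in> carrier (ps_group Q)"
    let ?V = "subtopology (ps_space Q) (ps_dom Q h)"
    let ?\<beta> = "\<lambda>y. b (h, ps_act Q (ps_inv Q h) y)"
    \<comment> \<open>The group index of \<open>c\<close> varies with \<open>y\<close>. Splitting by
      its value gives finitely many products of a locally constant function and a fixed coefficient
      composed with \<open>\<psi>\<close>.\<close>
    have "continuous_map ?V euclidean (\<lambda>y. \<Sum>g\<in>cp_supp c. (if ?\<beta> y = g then 1 else 0) * c g (\<psi> y))"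
    proof (rule continuous_map_sum[OF fin])
      fix g assume "g \<in> cp_supp c"
      then have gG: "g \<in> carrier (ps_group P)" using sub by blast
      have "continuous_map (discrete_topology (carrier (ps_group P))) euclidean (\<lambda>k. if k = g then 1 else 0 :: complex)"
        by simp
      from continuous_map_compose[OF S.continuous_range_cocycle[OF h] this]
      have 1: "continuous_map ?V euclidean (\<lambda>y. if ?\<beta> y = g then 1 else 0 :: complex)"
        by (simp add: o_def)
      have "continuous_map (ps_space P) euclidean (c g)"
        using P.C0_dom[OF gG P.cp_carrierD(3)[OF c gG]] by (simp add: C0_def)
      from continuous_map_compose[OF continuous_map_from_subtopology[OF S.cont_\<phi>] this]
      have 2: "continuous_map ?V euclidean (\<lambda>y. c g (\<psi> y))" by (simp add: o_def)
      show "continuous_map ?V euclidean (\<lambda>y. (if ?\<beta> y = g then 1 else 0) * c g (\<psi> y))"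
        by (rule continuous_map_complex_mult[OF 1 2])
    qed
    moreover have "(\<Sum>g\<in>cp_supp c. (if ?\<beta> y = g then 1 else 0) * c g (\<psi> y)) = tr c h y" if "y \<in> topspace ?V" for y
    proof -
      have "(\<Sum>g\<in>cp_supp c. (if ?\<beta> y = g then 1 else 0) * c g (\<psi> y)) = (\<Sum>g\<in>cp_supp c. if ?\<beta> y = g then c g (\<psi> y) else 0)"
        by (intro sum.cong) auto
      also have "\<dots> = c (?\<beta> y) (\<psi> y)"
        using fin cp_supp_zero[of "?\<beta> y" c] by (simp add: sum.delta')
      finally show ?thesis using that h by (simp add: tr_def)
    qed
    ultimately have cont: "continuous_map ?V euclidean (tr c h)"
      by (rule continuous_map_eq)
    show "tr c h \<in> C0 ?V"
      unfolding C0_def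
    proof (intro CollectI conjI allI impI exI[of _ "L h"] ballI)
      show "compactin ?V (L h)" using L[OF h] by (simp add: compactin_subtopology)
      show "tr c h y = 0" if "y \<notin> topspace ?V" for y
        using that unfolding Q.topspace_dom[OF h] tr_def by simp
      show "cmod (tr c h y) < \<epsilon>" if "\<epsilon> > 0" "y \<in> topspace ?V - L h" for y \<epsilon>
      proof -
        have "tr c h y = 0" using that(2) nz[OF h] by blast
        then show ?thesis using that(1) by simp
      qed
    qed (rule cont)
  qed
qed

text \<open>Unit arrows go to unit arrows and, by injectivity of the cocycle at each source, no
  other arrow does; so the diagonal is carried to the diagonal.\<close>

lemma tr_delta_one:
  assumes f: "f \<in> C0 (ps_space P)"
  shows "tr (cp_delta f (ps_one P)) = cp_delta (\<lambda>y. if y \<in> topspace (ps_space Q) then f (\<psi> y) else 0) (ps_one Q)"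
proof (rule tr_eqI)
  let ?f = "\<lambda>y. if y \<in> topspace (ps_space Q) then f (\<psi> y) else 0"
  show "cp_delta ?f (ps_one Q) h y = 0" if "h \<notin> carrier (ps_group Q) \<or> y \<notin> ps_dom Q h" for h y
    using that Q.dom_one by (auto simp: cp_delta_def)
  fix g x assume g: "g \<in> ps_at P x"
  have x: "x \<in> topspace (ps_space P)" by (rule P.at_space[OF g])
  have "a (g, x) = ps_one Q \<longleftrightarrow> g = ps_one P"
    using inj_on_a[of x] g P.one_at[OF x] a_one[OF x] by (metis inj_on_eq_iff)
  then show "cp_delta ?f (ps_one Q) (a (g, x)) (\<phi> (ps_act P g x)) = cp_delta f (ps_one P) g (ps_act P g x)"
    using \<psi>_\<phi>[OF P.act_space[OF g]] \<phi>_space[OF P.act_space[OF g]]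
    by (cases "g = ps_one P") (simp_all add: cp_delta_def)
qed

lemma C0_transfer:
  assumes f: "f \<in> C0 (ps_space P)"
  shows "(\<lambda>y. if y \<in> topspace (ps_space Q) then f (\<psi> y) else 0) \<in> C0 (ps_space Q)"
proof (rule C0_compose_homeomorphic_map[OF _ f])
  show "homeomorphic_map (ps_space Q) (ps_space P) \<psi>"
    using homeo homeomorphic_maps_map by blast
qed

lemma crossed_product_isomorphism:
  "\<exists>\<Phi>. star_isomorphism (reduced_crossed_product P) (reduced_crossed_product Q) \<Phi> \<and>
     \<Phi> ` C0_subalgebra P = C0_subalgebra Q"
proof -
  interpret S: cocycle_pair Q P \<psi> \<phi> b a by (rule swap)
  let ?A = "algebraic_crossed_product P" and ?B = "algebraic_crossed_product Q"
  \<comment> \<open>An element of the algebraic crossed product need not transfer to a finite sum, but a compactly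
    supported one does, so the elements that transfer are dense.\<close>
  define D where "D = {c \<in> cp_carrier P. tr c \<in> cp_carrier Q}"
  define E where "E = {d \<in> cp_carrier Q. S.tr d \<in> cp_carrier P}"
  have dense_D: "\<exists>d\<in>D. sa_dist ?A c d < \<epsilon>" if c: "c \<in> sa_carrier ?A" and e: "\<epsilon> > 0" for c \<epsilon>
  proof -
    have c': "c \<in> cp_carrier P" using c by simp
    obtain d where "d \<in> cp_carrier P" "P.compactly_supported d" "cp_norm P (\<lambda>g x. c g x - d g x) < \<epsilon>"
      using P.compactly_supported_dense[OF c' e] by blast
    then show ?thesis using tr_compactly_supported[of d] by (auto simp: D_def alg_dist)
  qed
  have dense_E: "\<exists>d\<in>E. sa_dist ?B c d < \<epsilon>" if c: "c \<in> sa_carrier ?B" and e: "\<epsilon> > 0" for c \<epsilon>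
  proof -
    have c': "c \<in> cp_carrier Q" using c by simp
    obtain d where "d \<in> cp_carrier Q" "Q.compactly_supported d" "cp_norm Q (\<lambda>g x. c g x - d g x) < \<epsilon>"
      using Q.compactly_supported_dense[OF c' e] by blast
    then show ?thesis using S.tr_compactly_supported[of d] by (auto simp: E_def alg_dist)
  qed
  \<comment> \<open>Transfer along the pair and along the swapped pair undo each other, so the two
    dense sets correspond.\<close>
  have image: "tr ` D = E"
  proof (intro equalityI subsetI)
    fix d assume "d \<in> tr ` D"
    then show "d \<in> E" using tr_tr by (auto simp: D_def E_def)
  next
    fix d assume "d \<in> E"
    then have d: "d \<in> cp_carrier Q" "S.tr d \<in> cp_carrier P" by (auto simp: E_def)
    then have "S.tr d \<in> D" "d = tr (S.tr d)" using S.tr_tr[OF d(1)] by (auto simp: D_def)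
    then show "d \<in> tr ` D" by blast
  qed
  have DD: "c \<in> cp_carrier P" "tr c \<in> cp_carrier Q" if "c \<in> D" for c using that by (auto simp: D_def)
  have "\<exists>\<Phi>. star_isomorphism (sa_completion ?A) (sa_completion ?B) \<Phi> \<and>
    (\<forall>d\<in>sa_cauchy ?A. range d \<subseteq> D \<longrightarrow> \<Phi> (sa_class ?A d) = sa_class ?B (\<lambda>n. tr (d n)))"
  proof (rule isometric_star_isomorphism_extends[OF P.seminormed_algebraic_crossed_product Q.seminormed_algebraic_crossed_product _ _ _ _ _ _ _ image])
    show "D \<subseteq> sa_carrier ?A" "E \<subseteq> sa_carrier ?B" by (auto simp: D_def E_def)
    show "\<exists>d\<in>D. sa_dist ?A c d < \<epsilon>" if "c \<in> sa_carrier ?A" "\<epsilon> > 0" for c \<epsilon>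
      by (rule dense_D[OF that])
    show "\<exists>d\<in>E. sa_dist ?B c d < \<epsilon>" if "c \<in> sa_carrier ?B" "\<epsilon> > 0" for c \<epsilon>
      by (rule dense_E[OF that])
    fix c d z assume c: "c \<in> D"
    note cD = DD[OF c]
    show "tr (sa_scale ?A z c) = sa_scale ?B z (tr c)" by (simp add: tr_scale)
    show "tr (sa_star ?A c) = sa_star ?B (tr c)" using cD by (simp add: tr_star)
    show "sa_scale ?A z c \<in> D" using cD by (simp add: D_def tr_scale P.cp_scale_closed Q.cp_scale_closed)
    show "sa_star ?A c \<in> D" using cD by (simp add: D_def tr_star P.cp_star_closed Q.cp_star_closed)
    assume d: "d \<in> D"
    note dD = DD[OF d]
    show "tr (sa_add ?A c d) = sa_add ?B (tr c) (tr d)" by (simp add: tr_add)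
    show "tr (sa_mult ?A c d) = sa_mult ?B (tr c) (tr d)" using cD dD by (simp add: tr_mult)
    show "sa_add ?A c d \<in> D \<and> sa_mult ?A c d \<in> D"
      using cD dD by (simp add: D_def tr_add tr_mult P.cp_add_closed Q.cp_add_closed P.cp_mult_closed Q.cp_mult_closed)
    show "sa_dist ?B (tr c) (tr d) = sa_dist ?A c d"
      using tr_norm[OF P.cp_diff_closed[OF cD(1) dD(1)]] Q.cp_diff_closed[OF cD(2) dD(2)]
      by (simp add: alg_dist tr_diff)
  qed
  then obtain \<Phi> where \<Phi>: "star_isomorphism (sa_completion ?A) (sa_completion ?B) \<Phi>"
    "\<And>d. d \<in> sa_cauchy ?A \<Longrightarrow> range d \<subseteq> D \<Longrightarrow> \<Phi> (sa_class ?A d) = sa_class ?B (\<lambda>n. tr (d n))"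
    by blast
  let ?t = "\<lambda>f y. if y \<in> topspace (ps_space Q) then f (\<psi> y) else 0"
  have \<Phi>C: "\<Phi> (P.C0_embed f) = Q.C0_embed (?t f)" if f: "f \<in> C0 (ps_space P)" for f
  proof -
    have fc: "cp_delta f (ps_one P) \<in> cp_carrier P" using f by (rule P.cp_delta_one_closed)
    then have "(\<lambda>n. cp_delta f (ps_one P)) \<in> sa_cauchy ?A" using P.alg.cauchy_const by simp
    moreover have "tr (cp_delta f (ps_one P)) \<in> cp_carrier Q"
      unfolding tr_delta_one[OF f] by (rule Q.cp_delta_one_closed[OF C0_transfer[OF f]])
    ultimately show ?thesis
      using \<Phi>(2)[of "\<lambda>n. cp_delta f (ps_one P)"] fc tr_delta_one[OF f]
      by (simp add: P.C0_embed_def Q.C0_embed_def P.embed_eq Q.embed_eq D_def)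
  qed
  have "\<Phi> ` C0_subalgebra P = C0_subalgebra Q"
  proof (intro equalityI subsetI)
    fix T assume "T \<in> \<Phi> ` C0_subalgebra P"
    then show "T \<in> C0_subalgebra Q"
      unfolding P.C0_subalgebra_eq Q.C0_subalgebra_eq using \<Phi>C C0_transfer by auto
  next
    fix T assume "T \<in> C0_subalgebra Q"
    then obtain k where k: "k \<in> C0 (ps_space Q)" "T = Q.C0_embed k" unfolding Q.C0_subalgebra_eq by blast
    let ?f = "\<lambda>x. if x \<in> topspace (ps_space P) then k (\<phi> x) else 0"
    have f: "?f \<in> C0 (ps_space P)" by (rule S.C0_transfer[OF k(1)])
    have "?t ?f = k"
      using S.\<psi>_\<phi> S.\<phi>_space k(1) by (auto simp: C0_def fun_eq_iff)
    then have "T = \<Phi> (P.C0_embed ?f)" using \<Phi>C[OF f] k(2) by simp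
    then show "T \<in> \<Phi> ` C0_subalgebra P" using f unfolding P.C0_subalgebra_eq by blast
  qed
  then show ?thesis using \<Phi>(1) unfolding reduced_crossed_product_def by blast
qed

end

theorem theorem2p7:
  fixes P :: "('g, 'x) partial_system_data" and Q :: "('h, 'y) partial_system_data"
  assumes "partial_system P" and "partial_system Q"
  shows
    "(topologically_free P \<and> topologically_free Q \<longrightarrow>
        (continuously_orbit_equivalent P Q \<longleftrightarrow>
           isomorphic_topological_groupoids (transformation_groupoid P) (transformation_groupoid Q)) \<and>
        (isomorphic_topological_groupoids (transformation_groupoid P) (transformation_groupoid Q) \<longleftrightarrow>
           (\<exists>\<Phi>. star_isomorphism (reduced_crossed_product P) (reduced_crossed_product Q) \<Phi> \<and>
                \<Phi> ` C0_subalgebra P = C0_subalgebra Q))) \<and>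
     (isomorphic_topological_groupoids (transformation_groupoid P) (transformation_groupoid Q) \<longrightarrow>
        continuously_orbit_equivalent P Q)"
proof -
  note ps = assms
  have pair: "cocycle_pair P Q \<phi> \<psi> a b" if "cocycle_equivalence P Q \<phi> \<psi> a b" for \<phi> \<psi> a b
    by unfold_locales (fact ps that)+
  have coe_gpd: "isomorphic_topological_groupoids (transformation_groupoid P) (transformation_groupoid Q)"
    if "topologically_free P" "topologically_free Q" "continuously_orbit_equivalent P Q"
    using coe_imp_cocycle_equivalence[OF ps that] cocycle_pair.groupoid_isomorphism[OF pair] by metis
  have gpd_coe: "continuously_orbit_equivalent P Q"
    if "isomorphic_topological_groupoids (transformation_groupoid P) (transformation_groupoid Q)"
    using groupoid_isomorphism_imp_cocycle_equivalence[OF ps that] cocycle_equivalence_imp_coe[OF ps] by metis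
  have gpd_cp: "\<exists>\<Phi>. star_isomorphism (reduced_crossed_product P) (reduced_crossed_product Q) \<Phi> \<and>
      \<Phi> ` C0_subalgebra P = C0_subalgebra Q"
    if "isomorphic_topological_groupoids (transformation_groupoid P) (transformation_groupoid Q)"
    using groupoid_isomorphism_imp_cocycle_equivalence[OF ps that]
      cocycle_pair.crossed_product_isomorphism[OF pair] by metis
  show ?thesis
    using coe_gpd gpd_coe gpd_cp crossed_product_iso_imp_coe[OF ps] by blast
qed


end
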